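(* Let $g \geq 2$ be a fixed integer. Suppose $(k, \lambda)$ runs through a sequence of ordered pairs of positive integers such that $k \geq 3$, $\lambda \to \infty$, and, if $g$ is even, each $\lambda$ is also even. Suppose also that there exists some $\varepsilon_0 > 0$ so that $k < \left(\frac{1}{6} - \varepsilon_0\right) \frac{\log(\lambda g)}{\log(g)}$ for all pairs in the sequence. Then along the sequence $(k, \lambda)$ the number of $(g, k; \lambda)$-difference matrices over $\mathbb Z_g$ is \[ \frac{ g^{k \lambda g + \frac{(3k-4)(k-1)}{4}}}{\sqrt{(2 \pi \lambda)^{\binom{k}{2}(g-1)}}}[1 + o(1)].\]
   Context: Let $\mathbb Z_g$ denote the cyclic group of integers modulo $g$. A $(g, k; \lambda)$-difference matrix over $\mathbb Z_g$ is a $k \times g\lambda$ matrix $D = [d_{i\ell}]$ with entries in $\mathbb Z_g$ such that for each pair of rows $1 \leq i < j \leq k$, the multiset $\{d_{i\ell} - d_{j\ell} : 1 \leq \ell \leq g\lambda\}$ contains every element of $\mathbb Z_g$ exactly $\lambda$ times. Matrices are counted as arrays (no identification up to equivalence). *)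

theory Defs
  imports Complex_Main "HOL-Library.FuncSet"
begin

definition is_diff_matrix :: "nat \<Rightarrow> nat \<Rightarrow> nat \<Rightarrow> (nat \<times> nat \<Rightarrow> nat) \<Rightarrow> bool" where
  "is_diff_matrix g k lam D \<longleftrightarrow>
     D \<in> ({0..<k} \<times> {0..<g * lam}) \<rightarrow>\<^sub>E {0..<g} \<and>
     (\<forall>i<k. \<forall>j<k. i < j \<longrightarrow>
        (\<forall>x<g. card {l. l < g * lam \<and>
                 (int (D (i, l)) - int (D (j, l))) mod int g = int x} = lam))"

definition num_diff_matrices :: "nat \<Rightarrow> nat \<Rightarrow> nat \<Rightarrow> nat" where
  "num_diff_matrices g k lam = card {D. is_diff_matrix g k lam D}"

end

theory Submission
  imports Defs "HOL-Analysis.Analysis" "HOL-Combinatorics.Multiset_Permutations" "HOL-Real_Asymp.Real_Asymp"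
begin

text \<open>
  Write $N = g\lambda$. Detecting each balance condition by an average over $M$-th roots of unity with
  $M > N$ (a finite Fourier inversion, so that no integrals occur) turns the number of difference
  matrices into an average, over families $W$ of phase functions $W_{ij}$ on $Z_g$, of
  $\varphi(W)^N$ times a unimodular factor, where $\varphi(W)$ is the mean of
  $\prod_{i<j} W_{ij}(x_i - x_j)$ over $x \in Z_g^k$.

  If $|\varphi(W)|$ is close to 1 then, by a Cauchy-Schwarz (van der Corput) step in the two coordinates
  $i, j$, every $W_{ij}$ is close to a constant multiple of a character of $Z_g$, with a loss that does
  not depend on $k$. If these characters do not cancel as functions of $x$, then $\varphi(W)$ is small.
  The remaining families lie near one of the $g^{\binom k2 + 1 - k}$ flows and all flows contribute
  equally; this is where $\lambda$ must be even for even $g$.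

  Near the trivial flow the differences $x_i - x_j$ are pairwise independent, so $\varphi(W)$ agrees up to
  third order with the product of its single-pair analogues. The same Fourier analysis for a single pair
  gives $p = N!/(\lambda!^g g^N)$, the probability that one random word of length $N$ is balanced. Hence
  the count is asymptotic to $g^{kN} g^{\binom k2 + 1 - k} p^{\binom k2}$ without any Gaussian
  integral, and Stirling's formula with an $O(1/\lambda)$ error evaluates $p^{\binom k2}$.
\<close>

section \<open>Fourier inversion over roots of unity\<close>

text \<open>The number K of pairs may grow, so all errors have to be measured against p^K. The bound
  on k enters as K <= (ln N)^2, which makes p^K at least exp(-O((ln N)^3)). This fixes the radius
  N^(-2/5) of the neighbourhoods of characters. A family with a pair away from all characters
  contributes at most exp(-c N^(1/5)), which is negligible against p^K, while the third-order error
  near a flow, N (K N^(-2/5))^3, is N^(-1/5) up to logarithms. Every exponent strictly between -1/2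
  and -1/3 has both properties. The near-trivial sum for k rows is compared summand by summand with
  the K-th power of the single-pair sum. That comparison is relative to absolute values, whereas p
  controls only the sum itself; hence the single-pair summands must also be shown to be almost
  positive. M is chosen divisible by g, so that multiplication by a character of Z_g permutes the
  M-th roots of unity and the contributions of the flows are exactly equal.\<close>

definition pairs :: "nat \<Rightarrow> (nat \<times> nat) set" where
  "pairs k = {(i, j). i < j \<and> j < k}"

definition diff_mod :: "nat \<Rightarrow> nat \<Rightarrow> nat \<Rightarrow> nat" where
  "diff_mod g a b = nat ((int a - int b) mod int g)"

definition unity :: "nat \<Rightarrow> complex set" where
  "unity M = {z. z ^ M = 1}"

text \<open>Dual variables of a vector of letter counts: one M-th root of unity for each residue,
  extensional so that the set is finite.\<close>

definition phases :: "nat \<Rightarrow> nat \<Rightarrow> (nat \<Rightarrow> complex) set" where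
  "phases g M = ({..<g} \<rightarrow>\<^sub>E unity M)"

text \<open>A word is one column of the matrix.\<close>

definition words :: "nat \<Rightarrow> nat \<Rightarrow> (nat \<Rightarrow> nat) set" where
  "words g k = ({..<k} \<rightarrow>\<^sub>E {..<g})"

text \<open>The characteristic function, at the dual point \<open>W\<close>, of the difference
  indicators of one uniformly random column. The columns are independent, hence the powers of
  \<open>phi\<close> below.\<close>

definition phi :: "nat \<Rightarrow> nat \<Rightarrow> (nat \<times> nat \<Rightarrow> nat \<Rightarrow> complex) \<Rightarrow> complex" where
  "phi g k W = (\<Sum>x\<in>words g k. \<Prod>p\<in>pairs k. W p (diff_mod g (x (fst p)) (x (snd p)))) / of_nat g ^ k"

definition phi1 :: "nat \<Rightarrow> (nat \<Rightarrow> complex) \<Rightarrow> complex" where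
  "phi1 g b = (\<Sum>a<g. b a) / of_nat g"

text \<open>The inversion factor that selects the value \<open>lam\<close> for the count of every
  residue.\<close>

definition chi :: "nat \<Rightarrow> nat \<Rightarrow> (nat \<Rightarrow> complex) \<Rightarrow> complex" where
  "chi g lam b = (\<Prod>a<g. inverse (b a) ^ lam)"

lemma finite_pairs [simp]: "finite (pairs k)"
  by (rule finite_subset[of _ "{..<k} \<times> {..<k}"]) (auto simp: pairs_def)

lemma card_pairs: "card (pairs k) = k choose 2"
proof (induction k)
  case 0
  then show ?case by (simp add: pairs_def)
next
  case (Suc k)
  have "pairs (Suc k) = pairs k \<union> (\<lambda>i. (i, k)) ` {..<k}"
    by (auto simp: pairs_def less_Suc_eq)
  moreover have "pairs k \<inter> (\<lambda>i. (i, k)) ` {..<k} = {}"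
    by (auto simp: pairs_def)
  moreover have "card ((\<lambda>i. (i, k)) ` {..<k}) = k"
    by (simp add: card_image inj_on_def)
  ultimately show ?case
    using Suc by (simp add: card_Un_disjoint numeral_2_eq_2)
qed

lemma finite_unity [simp]: "M > 0 \<Longrightarrow> finite (unity M)"
  unfolding unity_def by (rule finite_roots_unity) simp

lemma card_unity: "M > 0 \<Longrightarrow> card (unity M) = M"
  unfolding unity_def by (rule card_roots_unity_eq)

lemma norm_unity: "M > 0 \<Longrightarrow> z \<in> unity M \<Longrightarrow> cmod z = 1"
  using power_eq_1_iff[of z M] by (simp add: unity_def)

lemma unity_nonzero: "M > 0 \<Longrightarrow> z \<in> unity M \<Longrightarrow> z \<noteq> 0"
  using norm_unity[of M z] by auto

lemma finite_phases [simp]: "M > 0 \<Longrightarrow> finite (phases g M)"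
  unfolding phases_def by (auto intro: finite_PiE)

lemma card_phases: "M > 0 \<Longrightarrow> card (phases g M) = M ^ g"
  unfolding phases_def by (simp add: card_PiE card_unity)

lemma finite_words [simp]: "finite (words g k)"
  unfolding words_def by (auto intro: finite_PiE)

lemma card_words: "card (words g k) = g ^ k"
  unfolding words_def by (simp add: card_PiE)

text \<open>Multiplying the summation variable by a primitive M-th root \<open>w\<close> multiplies
  the sum by w^(n-m), and distinct exponents below M give distinct powers of \<open>w\<close>. The
  restriction to exponents below M excludes aliasing; counts in a word of length N < M satisfy
  it.\<close>

lemma sum_unity_orthogonality:
  assumes "n < M" "m < M"
  shows "(\<Sum>z\<in>unity M. z ^ n * inverse z ^ m) = (if n = m then of_nat M else 0)"
proof (cases "n = m")
  case True
  have "(\<Sum>z\<in>unity M. z ^ n * inverse z ^ m) = (\<Sum>z\<in>unity M. 1)"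
  proof (intro sum.cong refl)
    fix z assume "z \<in> unity M"
    then have "z \<noteq> 0" using assms by (intro unity_nonzero[of M]) auto
    then show "z ^ n * inverse z ^ m = 1" using True by (simp flip: power_mult_distrib)
  qed
  then show ?thesis using True assms by (simp add: card_unity)
next
  case False
  have M: "M > 0" using assms by simp
  define w where "w = cis (2 * pi / real M)"
  have pw: "w ^ j = cis (2 * pi * real j / real M)" for j
    unfolding w_def by (subst Complex.DeMoivre) (simp add: mult_ac)
  have w0: "w \<noteq> 0" by (simp add: w_def)
  have wM: "w ^ M = 1" using M by (simp add: pw)
  have neq: "w ^ n \<noteq> w ^ m"
    using Complex.bij_betw_roots_unity[OF M] False assms
    unfolding bij_betw_def inj_on_def pw by (metis lessThan_iff)
  have bij: "bij_betw (\<lambda>z. w * z) (unity M) (unity M)"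
    using wM w0
    by (intro bij_betw_byWitness[where f' = "\<lambda>z. z / w"])
       (auto simp: unity_def power_mult_distrib power_divide)
  define S where "S = (\<Sum>z\<in>unity M. z ^ n * inverse z ^ m)"
  have "S = (\<Sum>z\<in>unity M. (w * z) ^ n * inverse (w * z) ^ m)"
    unfolding S_def by (rule sum.reindex_bij_betw[OF bij, symmetric])
  also have "\<dots> = w ^ n * inverse w ^ m * S"
    unfolding S_def sum_distrib_left by (intro sum.cong refl) (simp add: power_mult_distrib mult_ac)
  finally have "S * w ^ m = w ^ n * S"
    using w0 by (simp add: power_inverse field_simps)
  then have "S = 0" using neq by (metis mult.commute mult_right_cancel)
  then show ?thesis using False by (simp add: S_def)
qed

lemma prod_fibers:
  fixes f :: "nat \<Rightarrow> 'a::comm_monoid_mult" and N :: nat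
  assumes "\<And>l. l < N \<Longrightarrow> y l < g"
  shows "(\<Prod>l<N. f (y l)) = (\<Prod>a<g. f a ^ card {l. l < N \<and> y l = a})"
proof -
  have "(\<Prod>l<N. f (y l)) = (\<Prod>a<g. \<Prod>l\<in>{l\<in>{..<N}. y l = a}. f (y l))"
    by (rule prod.group[symmetric]) (use assms in auto)
  also have "\<dots> = (\<Prod>a<g. \<Prod>l\<in>{l. l < N \<and> y l = a}. f a)"
    by (intro prod.cong refl) auto
  also have "\<dots> = (\<Prod>a<g. f a ^ card {l. l < N \<and> y l = a})"
    by simp
  finally show ?thesis .
qed

lemma sum_power_PiE:
  fixes h :: "'x \<Rightarrow> 'a::comm_semiring_1"
  assumes "finite \<Omega>"
  shows "(\<Sum>x\<in>\<Omega>. h x) ^ N = (\<Sum>s\<in>{..<N} \<rightarrow>\<^sub>E \<Omega>. \<Prod>l<N. h (s l))"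
  using prod_sum_PiE[of "{..<N}" "\<lambda>_. \<Omega>" "\<lambda>_. h"] assms by simp

text \<open>Expanding the N-th power over sequences and exchanging the sums splits the sum over
  \<open>W\<close> into one orthogonality sum for each p and each residue a. Index set and alphabet
  are arbitrary because the identity serves twice: with \<open>J = pairs k\<close> for matrices and
  with a one-element \<open>J\<close> for a single balanced word.\<close>

lemma fourier_count:
  fixes v :: "'p \<Rightarrow> 'x \<Rightarrow> nat"
  assumes fin: "finite \<Omega>" "finite J" and M: "N < M" "lam < M"
    and v: "\<And>p x. p \<in> J \<Longrightarrow> x \<in> \<Omega> \<Longrightarrow> v p x < g"
  shows "of_nat (card {s \<in> {..<N} \<rightarrow>\<^sub>E \<Omega>. \<forall>p\<in>J. \<forall>a<g. card {l. l < N \<and> v p (s l) = a} = lam})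
            * of_nat M ^ (g * card J)
         = (\<Sum>W\<in>J \<rightarrow>\<^sub>E phases g M. (\<Sum>x\<in>\<Omega>. \<Prod>p\<in>J. W p (v p x)) ^ N * (\<Prod>p\<in>J. chi g lam (W p)))"
    (is "?L = ?R")
proof -
  let ?cnt = "\<lambda>s p a. card {l. l < N \<and> v p (s l) = a}"
  let ?S = "{..<N} \<rightarrow>\<^sub>E \<Omega>"
  have M0: "M > 0" using M by simp
  have fS: "finite ?S" using fin by (auto intro: finite_PiE)
  have cnt: "?cnt s p a < M" for s p a
  proof -
    have "?cnt s p a \<le> card {..<N}" by (rule card_mono) auto
    then show ?thesis using M by simp
  qed
  have "?R = (\<Sum>W\<in>J \<rightarrow>\<^sub>E phases g M. \<Sum>s\<in>?S. (\<Prod>l<N. \<Prod>p\<in>J. W p (v p (s l))) * (\<Prod>p\<in>J. chi g lam (W p)))"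
    using fin by (subst sum_power_PiE) (simp_all add: sum_distrib_right)
  also have "\<dots> = (\<Sum>s\<in>?S. \<Sum>W\<in>J \<rightarrow>\<^sub>E phases g M. (\<Prod>l<N. \<Prod>p\<in>J. W p (v p (s l))) * (\<Prod>p\<in>J. chi g lam (W p)))"
    by (rule sum.swap)
  also have "\<dots> = (\<Sum>s\<in>?S. if \<forall>p\<in>J. \<forall>a<g. ?cnt s p a = lam then of_nat M ^ (g * card J) else 0)"
  proof (rule sum.cong[OF refl])
    fix s assume s: "s \<in> ?S"
    have "(\<Sum>W\<in>J \<rightarrow>\<^sub>E phases g M. (\<Prod>l<N. \<Prod>p\<in>J. W p (v p (s l))) * (\<Prod>p\<in>J. chi g lam (W p)))
       = (\<Sum>W\<in>J \<rightarrow>\<^sub>E phases g M. \<Prod>p\<in>J. \<Prod>a<g. W p a ^ ?cnt s p a * inverse (W p a) ^ lam)"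
    proof (rule sum.cong[OF refl])
      fix W :: "'p \<Rightarrow> nat \<Rightarrow> complex"
      have "(\<Prod>l<N. \<Prod>p\<in>J. W p (v p (s l))) = (\<Prod>p\<in>J. \<Prod>l<N. W p (v p (s l)))"
        by (rule prod.swap)
      also have "\<dots> = (\<Prod>p\<in>J. \<Prod>a<g. W p a ^ ?cnt s p a)"
      proof (rule prod.cong[OF refl])
        fix p assume "p \<in> J"
        then have "v p (s l) < g" if "l < N" for l
          using that s by (intro v) auto
        then show "(\<Prod>l<N. W p (v p (s l))) = (\<Prod>a<g. W p a ^ ?cnt s p a)"
          by (rule prod_fibers)
      qed
      finally show "(\<Prod>l<N. \<Prod>p\<in>J. W p (v p (s l))) * (\<Prod>p\<in>J. chi g lam (W p))
        = (\<Prod>p\<in>J. \<Prod>a<g. W p a ^ ?cnt s p a * inverse (W p a) ^ lam)"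
        by (simp add: chi_def prod.distrib)
    qed
    also have "\<dots> = (\<Prod>p\<in>J. \<Sum>b\<in>phases g M. \<Prod>a<g. b a ^ ?cnt s p a * inverse (b a) ^ lam)"
      by (rule prod_sum_PiE[symmetric]) (use fin M0 in simp_all)
    also have "\<dots> = (\<Prod>p\<in>J. \<Prod>a<g. \<Sum>z\<in>unity M. z ^ ?cnt s p a * inverse z ^ lam)"
      unfolding phases_def
    proof (rule prod.cong[OF refl])
      fix p
      show "(\<Sum>b\<in>{..<g} \<rightarrow>\<^sub>E unity M. \<Prod>a<g. b a ^ ?cnt s p a * inverse (b a) ^ lam)
        = (\<Prod>a<g. \<Sum>z\<in>unity M. z ^ ?cnt s p a * inverse z ^ lam)"
        by (rule prod_sum_PiE[symmetric]) (use M0 in simp_all)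
    qed
    also have "\<dots> = (\<Prod>p\<in>J. \<Prod>a<g. if ?cnt s p a = lam then of_nat M else 0)"
      using cnt M by (simp add: sum_unity_orthogonality)
    also have "\<dots> = (if \<forall>p\<in>J. \<forall>a<g. ?cnt s p a = lam then of_nat M ^ (g * card J) else 0)"
    proof (cases "\<forall>p\<in>J. \<forall>a<g. ?cnt s p a = lam")
      case True
      then have "(\<Prod>p\<in>J. \<Prod>a<g. if ?cnt s p a = lam then of_nat M else (0::complex)) = (\<Prod>p\<in>J. \<Prod>a<g. of_nat M)"
        by (intro prod.cong refl) simp
      with True show ?thesis by (simp add: power_mult)
    next
      case False
      then obtain p a where "p \<in> J" "a < g" "?cnt s p a \<noteq> lam" by blast
      then have "(\<Prod>a<g. if ?cnt s p a = lam then of_nat M else (0::complex)) = 0"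
        by (intro prod_zero) auto
      then have "(\<Prod>p\<in>J. \<Prod>a<g. if ?cnt s p a = lam then of_nat M else (0::complex)) = 0"
        by (intro prod_zero[OF fin(2)] bexI[OF _ \<open>p \<in> J\<close>])
      with False show ?thesis by (simp only: if_False)
    qed
    finally show "(\<Sum>W\<in>J \<rightarrow>\<^sub>E phases g M. (\<Prod>l<N. \<Prod>p\<in>J. W p (v p (s l))) * (\<Prod>p\<in>J. chi g lam (W p)))
      = (if \<forall>p\<in>J. \<forall>a<g. ?cnt s p a = lam then of_nat M ^ (g * card J) else 0)" .
  qed
  also have "\<dots> = ?L"
    by (subst sum.inter_filter[OF fS, symmetric]) simp
  finally show ?thesis by simp
qed

section \<open>Difference matrices as sequences of columns\<close>

lemma diff_mod_less: "g > 0 \<Longrightarrow> diff_mod g a b < g"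
  unfolding diff_mod_def using nat_less_iff by fastforce

lemma diff_mod_eq_iff: "g > 0 \<Longrightarrow> diff_mod g a b = x \<longleftrightarrow> (int a - int b) mod int g = int x"
  unfolding diff_mod_def by (auto simp: nat_eq_iff)

text \<open>A matrix, stored as a function of (row, column), is the same as the sequence of its
  columns; \<open>?f\<close> and \<open>?h\<close> are the two directions of this currying.\<close>

lemma num_diff_matrices_eq_card:
  assumes g: "g > 0"
  shows "num_diff_matrices g k lam = card {s \<in> {..<g * lam} \<rightarrow>\<^sub>E words g k.
     \<forall>p\<in>pairs k. \<forall>a<g. card {l. l < g * lam \<and> diff_mod g (s l (fst p)) (s l (snd p)) = a} = lam}"
proof -
  let ?S = "{s \<in> {..<g * lam} \<rightarrow>\<^sub>E words g k.
     \<forall>p\<in>pairs k. \<forall>a<g. card {l. l < g * lam \<and> diff_mod g (s l (fst p)) (s l (snd p)) = a} = lam}"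
  let ?f = "\<lambda>D. \<lambda>l\<in>{..<g*lam}. \<lambda>i\<in>{..<k}. D (i, l)"
  let ?h = "\<lambda>s. \<lambda>q\<in>{0..<k} \<times> {0..<g*lam}. s (snd q) (fst q)"
  have "bij_betw ?f {D. is_diff_matrix g k lam D} ?S"
  proof (rule bij_betw_byWitness[where f' = ?h])
    show "\<forall>D\<in>{D. is_diff_matrix g k lam D}. ?h (?f D) = D"
      by (auto simp: is_diff_matrix_def fun_eq_iff PiE_def extensional_def)
    show "\<forall>s\<in>?S. ?f (?h s) = s"
    proof
      fix s assume s: "s \<in> ?S"
      then have s1: "s \<in> {..<g * lam} \<rightarrow>\<^sub>E words g k" by simp
      show "?f (?h s) = s"
      proof
        fix l
        show "?f (?h s) l = s l"
        proof (cases "l < g * lam")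
          case True
          then have "s l \<in> words g k" using s1 by (auto simp: PiE_def Pi_def)
          then show ?thesis using True by (auto simp: words_def fun_eq_iff PiE_def extensional_def)
        next
          case False
          then show ?thesis using s1 by (auto simp: PiE_def extensional_def)
        qed
      qed
    qed
    show "?f ` {D. is_diff_matrix g k lam D} \<subseteq> ?S"
    proof
      fix s assume "s \<in> ?f ` {D. is_diff_matrix g k lam D}"
      then obtain D where D: "is_diff_matrix g k lam D" and s: "s = ?f D" by auto
      have D1: "D (i,l) < g" if "i < k" "l < g * lam" for i l
        using D that unfolding is_diff_matrix_def by (auto simp: PiE_def Pi_def)
      have "s \<in> {..<g * lam} \<rightarrow>\<^sub>E words g k"
        unfolding s words_def using D1 by auto
      moreover have "card {l. l < g * lam \<and> diff_mod g (s l (fst p)) (s l (snd p)) = a} = lam"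
        if p: "p \<in> pairs k" and a: "a < g" for p a
      proof -
        obtain i j where ij: "p = (i,j)" "i < j" "j < k" using p by (auto simp: pairs_def)
        have "{l. l < g * lam \<and> diff_mod g (s l (fst p)) (s l (snd p)) = a} =
          {l. l < g * lam \<and> (int (D (i, l)) - int (D (j, l))) mod int g = int a}"
          using ij by (auto simp: s diff_mod_eq_iff[OF g])
        then show ?thesis using D ij a unfolding is_diff_matrix_def by auto
      qed
      ultimately show "s \<in> ?S" by blast
    qed
    show "?h ` ?S \<subseteq> {D. is_diff_matrix g k lam D}"
    proof
      fix D assume "D \<in> ?h ` ?S"
      then obtain s where s: "s \<in> ?S" and D: "D = ?h s" by blast
      have s1: "s l i < g" if "i < k" "l < g * lam" for i l
        using s that unfolding words_def by (auto simp: PiE_def Pi_def)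
      have "D \<in> ({0..<k} \<times> {0..<g * lam}) \<rightarrow>\<^sub>E {0..<g}"
        unfolding D using s1 by auto
      moreover have "card {l. l < g * lam \<and> (int (D (i, l)) - int (D (j, l))) mod int g = int x} = lam"
        if ij: "i < k" "j < k" "i < j" and x: "x < g" for i j x
      proof -
        have "{l. l < g * lam \<and> (int (D (i, l)) - int (D (j, l))) mod int g = int x} =
          {l. l < g * lam \<and> diff_mod g (s l (fst (i,j))) (s l (snd (i,j))) = x}"
          using ij by (auto simp: D diff_mod_eq_iff[OF g])
        moreover have "(i,j) \<in> pairs k" using ij by (simp add: pairs_def)
        moreover have "\<forall>p\<in>pairs k. \<forall>a<g. card {l. l < g * lam \<and> diff_mod g (s l (fst p)) (s l (snd p)) = a} = lam"
          using s by blast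
        ultimately show ?thesis using x by fastforce
      qed
      ultimately show "D \<in> {D. is_diff_matrix g k lam D}" by (auto simp: is_diff_matrix_def)
    qed
  qed
  then show ?thesis unfolding num_diff_matrices_def by (rule bij_betw_same_card)
qed

lemma num_diff_matrices_fourier:
  assumes g: "g > 0" and M: "g * lam < M"
  shows "of_nat (num_diff_matrices g k lam) * of_nat M ^ (g * card (pairs k))
     = of_nat g ^ (k * (g * lam)) *
       (\<Sum>W\<in>pairs k \<rightarrow>\<^sub>E phases g M. phi g k W ^ (g * lam) * (\<Prod>p\<in>pairs k. chi g lam (W p)))"
proof -
  have lM: "lam < M" using assms by (metis mult_le_mono1 One_nat_def Suc_leI le_less_trans nat_mult_1)
  have "of_nat (num_diff_matrices g k lam) * of_nat M ^ (g * card (pairs k)) =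
     (\<Sum>W\<in>pairs k \<rightarrow>\<^sub>E phases g M. (\<Sum>x\<in>words g k. \<Prod>p\<in>pairs k. W p (diff_mod g (x (fst p)) (x (snd p)))) ^ (g * lam)
        * (\<Prod>p\<in>pairs k. chi g lam (W p)) :: complex)"
    unfolding num_diff_matrices_eq_card[OF g]
    by (rule fourier_count[of "words g k" "pairs k" "g * lam" M lam "\<lambda>p x. diff_mod g (x (fst p)) (x (snd p))" g])
       (use M lM g in \<open>auto simp: diff_mod_less\<close>)
  moreover have "(\<Sum>x\<in>words g k. \<Prod>p\<in>pairs k. W p (diff_mod g (x (fst p)) (x (snd p)))) = of_nat g ^ k * phi g k W" for W
    using g by (simp add: phi_def)
  ultimately show ?thesis
    by (simp add: power_mult_distrib sum_distrib_left mult_ac flip: power_mult)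
qed

text \<open>A word with every letter occurring \<open>lam\<close> times is an ordering of the
  multiset \<open>A\<close> below, so the count is a multinomial coefficient. The product form
  avoids division in the naturals.\<close>

lemma card_balanced:
  "card {s \<in> {..<g * lam} \<rightarrow>\<^sub>E {..<g}. \<forall>a<g. card {l. l < g * lam \<and> s l = a} = lam}
     * fact lam ^ g = fact (g * lam)"
proof -
  define N where "N = g * lam"
  define A where "A = (\<Sum>a<g. replicate_mset lam a)"
  have cA: "count A a = (if a < g then lam else 0)" for a
    by (auto simp: A_def count_sum)
  have sA: "size A = N" by (simp add: A_def N_def size_multiset_sum)
  have stA: "x < g" if "x \<in># A" for x
    using that cA[of x] by (metis count_greater_zero_iff less_numeral_extra(3))
  let ?S = "{s \<in> {..<N} \<rightarrow>\<^sub>E {..<g}. \<forall>a<g. card {l. l < N \<and> s l = a} = lam}"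
  have cnt: "count (mset xs) a = card {l. l < length xs \<and> xs ! l = a}" for xs :: "nat list" and a
  proof -
    have "{l. l < length xs \<and> a = xs ! l} = {l. l < length xs \<and> xs ! l = a}" by auto
    then show ?thesis by (simp add: count_mset count_list_eq_length_filter length_filter_conv_card)
  qed
  have "bij_betw (\<lambda>s. map s [0..<N]) ?S (permutations_of_multiset A)"
  proof (rule bij_betw_byWitness[where f' = "\<lambda>xs. \<lambda>l\<in>{..<N}. xs ! l"])
    show "\<forall>s\<in>?S. (\<lambda>l\<in>{..<N}. map s [0..<N] ! l) = s"
      by (auto simp: fun_eq_iff PiE_def extensional_def)
    show "\<forall>xs\<in>permutations_of_multiset A. map (\<lambda>l\<in>{..<N}. xs ! l) [0..<N] = xs"
      using sA by (auto simp: permutations_of_multiset_def intro!: nth_equalityI)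
    show "(\<lambda>s. map s [0..<N]) ` ?S \<subseteq> permutations_of_multiset A"
    proof
      fix xs assume "xs \<in> (\<lambda>s. map s [0..<N]) ` ?S"
      then obtain s where s: "s \<in> ?S" and xs: "xs = map s [0..<N]" by blast
      have "count (mset xs) a = count A a" for a
      proof -
        have "count (mset xs) a = card {l. l < N \<and> s l = a}"
          unfolding cnt by (rule arg_cong[of _ _ card]) (auto simp: xs)
        also have "\<dots> = count A a"
        proof (cases "a < g")
          case True then show ?thesis using s by (simp add: cA)
        next
          case False
          then have "{l. l < N \<and> s l = a} = {}" using s by (auto simp: PiE_def Pi_def)
          then show ?thesis using False by (simp add: cA)
        qed
        finally show ?thesis .
      qed
      then show "xs \<in> permutations_of_multiset A"
        by (simp add: permutations_of_multiset_def multiset_eq_iff)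
    qed
    show "(\<lambda>xs. \<lambda>l\<in>{..<N}. xs ! l) ` permutations_of_multiset A \<subseteq> ?S"
    proof
      fix s assume "s \<in> (\<lambda>xs. \<lambda>l\<in>{..<N}. xs ! l) ` permutations_of_multiset A"
      then obtain xs where xs: "mset xs = A" and s: "s = (\<lambda>l\<in>{..<N}. xs ! l)"
        by (auto simp: permutations_of_multiset_def)
      have len: "length xs = N" using xs sA by auto
      have 1: "s \<in> {..<N} \<rightarrow>\<^sub>E {..<g}"
        unfolding s using len stA by (auto simp flip: xs)
      have "card {l. l < N \<and> s l = a} = lam" if "a < g" for a
      proof -
        have "card {l. l < N \<and> s l = a} = count (mset xs) a"
          unfolding cnt len by (rule arg_cong[of _ _ card]) (auto simp: s)
        then show ?thesis using that by (simp add: xs cA)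
      qed
      with 1 show "s \<in> ?S" by blast
    qed
  qed
  then have c: "card ?S = card (permutations_of_multiset A)"
    by (rule bij_betw_same_card)
  have "(\<Prod>x\<in>set_mset A. fact (count A x)) = (\<Prod>a<g. fact lam :: nat)"
  proof (rule prod.mono_neutral_cong_left)
    show "set_mset A \<subseteq> {..<g}" using stA by auto
    show "\<forall>i\<in>{..<g} - set_mset A. fact lam = (1::nat)"
      using cA by (auto simp: not_in_iff)
  qed (use cA stA in auto)
  then have "card (permutations_of_multiset A) * fact lam ^ g = fact N"
    using card_permutations_of_multiset_aux[of A] sA by simp
  then show ?thesis using c by (simp add: N_def)
qed

definition balanced_prob :: "nat \<Rightarrow> nat \<Rightarrow> real" where
  "balanced_prob g lam = fact (g * lam) / (fact lam ^ g * real g ^ (g * lam))"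

lemma balanced_prob_fourier:
  assumes g: "g > 0" and M: "g * lam < M"
  shows "of_real (balanced_prob g lam) * of_nat M ^ g
     = (\<Sum>b\<in>phases g M. phi1 g b ^ (g * lam) * chi g lam b)"
proof -
  let ?c = "card {s \<in> {..<g * lam} \<rightarrow>\<^sub>E {..<g}. \<forall>a<g. card {l. l < g * lam \<and> s l = a} = lam}"
  have lM: "lam < M" using assms by (metis mult_le_mono1 One_nat_def Suc_leI le_less_trans nat_mult_1)
  have "real ?c * fact lam ^ g = fact (g * lam)"
    using arg_cong[OF card_balanced[of g lam], of real] by simp
  then have pb: "balanced_prob g lam * real g ^ (g * lam) = real ?c"
    using g by (simp add: balanced_prob_def field_simps)
  \<comment> \<open>A function on the one-element index set is identified with its only
    value.\<close>
  have bij: "bij_betw (\<lambda>b. \<lambda>u\<in>{()}. b) (phases g M) ({()} \<rightarrow>\<^sub>E phases g M)"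
    by (rule bij_betw_byWitness[where f' = "\<lambda>W. W ()"]) (auto simp: fun_eq_iff)
  have "of_nat ?c * of_nat M ^ g = (\<Sum>W\<in>{()} \<rightarrow>\<^sub>E phases g M. (\<Sum>x\<in>{..<g}. W () x) ^ (g * lam) * chi g lam (W ()))"
    using fourier_count[of "{..<g}" "{()}" "g * lam" M lam "\<lambda>_ x. x" g] M lM by simp
  also have "\<dots> = (\<Sum>b\<in>phases g M. (\<Sum>x<g. b x) ^ (g * lam) * chi g lam b)"
    by (subst sum.reindex_bij_betw[OF bij, symmetric]) simp
  also have "\<dots> = of_nat g ^ (g * lam) * (\<Sum>b\<in>phases g M. phi1 g b ^ (g * lam) * chi g lam b)"
    using g by (simp add: phi1_def power_divide sum_distrib_left field_simps)
  finally have "of_nat g ^ (g * lam) * (of_real (balanced_prob g lam) * of_nat M ^ g)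
     = of_nat g ^ (g * lam) * (\<Sum>b\<in>phases g M. phi1 g b ^ (g * lam) * chi g lam b)"
    using arg_cong[OF pb, of complex_of_real] by (simp add: mult_ac)
  then show ?thesis using g by simp
qed

section \<open>Second-order expansion of the characteristic function\<close>

text \<open>Induction on the set. If T is the sum of the norms so far, then |P - 1| <= 2 T, and T^2
  + 2 T |z| <= (T + |z|)^2 keeps the constant at 1.\<close>

lemma prod_one_plus_approx:
  fixes z :: "'a \<Rightarrow> complex"
  assumes "finite S" "(\<Sum>s\<in>S. cmod (z s)) \<le> 1"
  shows "cmod ((\<Prod>s\<in>S. 1 + z s) - 1 - (\<Sum>s\<in>S. z s)) \<le> (\<Sum>s\<in>S. cmod (z s))\<^sup>2"
  using assms
proof (induction S rule: finite_induct)
  case empty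
  then show ?case by simp
next
  case (insert x S)
  define P where "P = (\<Prod>s\<in>S. 1 + z s)"
  define T where "T = (\<Sum>s\<in>S. cmod (z s))"
  define R where "R = (\<Sum>s\<in>S. z s)"
  have T0: "T \<ge> 0" by (simp add: T_def sum_nonneg)
  have sum1: "cmod (z x) + T \<le> 1" using insert by (simp add: T_def)
  then have T1: "T \<le> 1" using norm_ge_zero[of "z x"] by linarith
  have IH: "cmod (P - 1 - R) \<le> T\<^sup>2"
    using insert.IH T1 by (simp add: P_def T_def R_def)
  have RT: "cmod R \<le> T" unfolding R_def T_def by (rule norm_sum)
  have "cmod (P - 1) \<le> cmod (P - 1 - R) + cmod R"
    by (metis diff_add_cancel norm_triangle_ineq)
  also have "\<dots> \<le> T\<^sup>2 + T" using IH RT by simp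
  also have "\<dots> \<le> 2 * T" using T0 T1 by (simp add: power2_eq_square mult_left_le)
  finally have P1: "cmod (P - 1) \<le> 2 * T" .
  have "(1 + z x) * P - 1 - (z x + R) = (P - 1 - R) + z x * (P - 1)"
    by (simp add: algebra_simps)
  then have "cmod ((1 + z x) * P - 1 - (z x + R)) \<le> cmod (P - 1 - R) + cmod (z x) * cmod (P - 1)"
    by (metis norm_mult norm_triangle_ineq)
  also have "\<dots> \<le> T\<^sup>2 + cmod (z x) * (2 * T)"
    using IH P1 by (intro add_mono mult_left_mono) auto
  also have "\<dots> \<le> (cmod (z x) + T)\<^sup>2"
    by (simp add: power2_eq_square algebra_simps)
  finally show ?case using insert by (simp add: P_def T_def R_def)
qed

text \<open>With a = b (1 + z), the preceding estimate bounds (1 + z)^N - 1 - N z by (N e)^2, and N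
  e <= 1 turns the square into a second N e. The bound stays relative to |b|^N because the powers to
  be compared can be very small.\<close>

lemma power_close:
  assumes ab: "cmod (a - b) \<le> e * cmod b" and e: "e \<ge> 0" "real N * e \<le> 1"
  shows "cmod (a ^ N - b ^ N) \<le> 2 * real N * e * cmod b ^ N"
proof (cases "b = 0")
  case True
  then show ?thesis using ab by (cases N) auto
next
  case False
  define z where "z = a / b - 1"
  have az: "a = b * (1 + z)" using False by (simp add: z_def)
  have "cmod z * cmod b = cmod (a - b)"
    using False by (simp add: z_def left_diff_distrib flip: norm_mult)
  then have "cmod z * cmod b \<le> e * cmod b" using ab by simp
  then have ze: "cmod z \<le> e" using False by simp
  have Nz: "real N * cmod z \<le> real N * e" using ze by (simp add: mult_left_mono)
  have "cmod ((1 + z) ^ N - 1 - of_nat N * z) \<le> (real N * cmod z)\<^sup>2"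
    using prod_one_plus_approx[of "{..<N}" "\<lambda>_. z"] Nz e by simp
  also have "\<dots> \<le> (real N * e)\<^sup>2" using Nz by (intro power_mono) auto
  also have "\<dots> \<le> real N * e" using e by (simp add: power2_eq_square mult_left_le)
  finally have "cmod ((1 + z) ^ N - 1 - of_nat N * z) \<le> real N * e" .
  moreover have "cmod (of_nat N * z) \<le> real N * e" using Nz by (simp add: norm_mult)
  moreover have "cmod ((1 + z) ^ N - 1) \<le> cmod ((1 + z) ^ N - 1 - of_nat N * z) + cmod (of_nat N * z)"
    by (metis diff_add_cancel norm_triangle_ineq)
  ultimately have *: "cmod ((1 + z) ^ N - 1) \<le> 2 * real N * e" by linarith
  have "a ^ N - b ^ N = b ^ N * ((1 + z) ^ N - 1)"
    unfolding az power_mult_distrib by (simp add: algebra_simps)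
  then have "cmod (a ^ N - b ^ N) = cmod b ^ N * cmod ((1 + z) ^ N - 1)"
    by (simp add: norm_mult norm_power)
  also have "\<dots> \<le> cmod b ^ N * (2 * real N * e)"
    using * by (intro mult_left_mono) auto
  finally show ?thesis by (simp add: mult_ac)
qed

section \<open>Elementary estimates for the unit circle\<close>

lemma cis_taylor2: "cmod (cis t - (1 + \<i> * t - (t\<^sup>2 / 2 :: real))) \<le> \<bar>t\<bar> ^ 3"
proof -
  have "cmod (exp (\<i> * t) - (\<Sum>k\<le>2. (\<i> * t) ^ k / fact k)) \<le> exp \<bar>Re (\<i> * t)\<bar> * cmod (\<i> * t) ^ Suc 2 / fact 2"
    by (rule Taylor_exp)
  also have "\<dots> = \<bar>t\<bar> ^ 3 / 2" by (simp add: norm_mult numeral_3_eq_3)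
  also have "\<dots> \<le> \<bar>t\<bar> ^ 3" by simp
  also have "(\<Sum>k\<le>2. (\<i> * t) ^ k / fact k) = 1 + \<i> * t - (t\<^sup>2 / 2 :: real)"
    by (simp add: numeral_2_eq_2 power2_eq_square algebra_simps)
  finally show ?thesis by (simp add: cis_conv_exp)
qed

lemma abs_le_norm_cis:
  assumes "\<bar>t\<bar> \<le> pi"
  shows "\<bar>t\<bar> \<le> 2 * cmod (cis t - 1)"
proof -
  define u where "u = \<bar>t\<bar> / 2"
  \<comment> \<open>Half of pi lies below 1.6, and on [0, 1.6] the cubic Taylor bound still leaves
    sin u >= u / 2.\<close>
  have u: "0 \<le> u" "u \<le> 1.6"
    using assms pi_approx by (auto simp: u_def)
  have "\<bar>sin u - (\<Sum>m<3. sin_coeff m * u ^ m)\<bar> \<le> inverse (fact 3) * \<bar>u\<bar> ^ 3"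
    by (rule Maclaurin_sin_bound)
  then have "\<bar>sin u - u\<bar> \<le> u ^ 3 / 6"
    using u by (simp add: numeral_3_eq_3 sin_coeff_def fact_numeral field_simps)
  moreover have "u ^ 3 / 6 \<le> u / 2"
  proof -
    have "u * u \<le> 1.6 * 1.6" using u by (intro mult_mono) auto
    then have "u * (u * u) \<le> u * 3" using u by (intro mult_left_mono) auto
    then show ?thesis by (simp add: power3_eq_cube)
  qed
  ultimately have "sin u \<ge> u / 2" by linarith
  moreover have "\<bar>sin (t / 2)\<bar> = \<bar>sin u\<bar>"
    unfolding u_def by (cases "t \<ge> 0") (auto simp: abs_minus_commute)
  moreover have "cmod (cis t - 1) = 2 * \<bar>sin (t / 2)\<bar>"
    unfolding cis_conv_exp by (rule dist_exp_i_1)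
  ultimately show ?thesis by (simp add: u_def)
qed

lemma norm_cis_le_abs: "cmod (cis t - 1) \<le> \<bar>t\<bar>"
proof -
  have "cmod (cis t - 1) = 2 * \<bar>sin (t / 2)\<bar>"
    unfolding cis_conv_exp by (rule dist_exp_i_1)
  then show ?thesis using abs_sin_x_le_abs_x[of "t/2"] by simp
qed

section \<open>Averages over random columns\<close>

lemma sum_PiE_insert:
  assumes "s \<notin> S" "finite S" "finite (T s)" "\<And>i. i \<in> S \<Longrightarrow> finite (T i)"
  shows "(\<Sum>x\<in>PiE (insert s S) T. F x) = (\<Sum>u\<in>T s. \<Sum>y\<in>PiE S T. F (y(s := u)))"
proof -
  have "(\<Sum>x\<in>PiE (insert s S) T. F x) = (\<Sum>(u, y)\<in>T s \<times> PiE S T. F (y(s := u)))"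
    unfolding PiE_insert_eq using assms inj_combinator[of s S T]
    by (subst sum.reindex) (simp_all add: case_prod_unfold)
  then show ?thesis by (simp add: sum.cartesian_product)
qed

text \<open>Redrawing coordinate \<open>s\<close> uniformly preserves the uniform distribution on
  words. This replaces independence and conditioning in the averages below.\<close>

lemma sum_words_resample:
  fixes F :: "(nat \<Rightarrow> nat) \<Rightarrow> 'a::comm_semiring_1"
  assumes "s < k"
  shows "(\<Sum>x\<in>words g k. \<Sum>t<g. F (x(s := t))) = of_nat g * (\<Sum>x\<in>words g k. F x)"
proof -
  define S where "S = {..<k} - {s}"
  have wr: "words g k = PiE (insert s S) (\<lambda>_. {..<g})"
    using assms by (auto simp: words_def S_def insert_absorb)
  have S: "s \<notin> S" "finite S" by (auto simp: S_def)
  have split: "(\<Sum>x\<in>words g k. G x) = (\<Sum>u<g. \<Sum>y\<in>PiE S (\<lambda>_. {..<g}). G (y(s := u)))"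
    for G :: "(nat \<Rightarrow> nat) \<Rightarrow> 'a"
    unfolding wr by (rule sum_PiE_insert) (use S in auto)
  have "(\<Sum>x\<in>words g k. \<Sum>t<g. F (x(s := t))) = (\<Sum>u<g. \<Sum>y\<in>PiE S (\<lambda>_. {..<g}). \<Sum>t<g. F (y(s := t)))"
    by (subst split) simp
  also have "\<dots> = of_nat g * (\<Sum>y\<in>PiE S (\<lambda>_. {..<g}). \<Sum>t<g. F (y(s := t)))"
    by simp
  also have "(\<Sum>y\<in>PiE S (\<lambda>_. {..<g}). \<Sum>t<g. F (y(s := t))) = (\<Sum>x\<in>words g k. F x)"
    by (subst split) (rule sum.swap)
  finally show ?thesis .
qed

lemma int_diff_mod: "g > 0 \<Longrightarrow> int (diff_mod g a b) = (int a - int b) mod int g"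
  by (simp add: diff_mod_def)

lemma bij_diff_mod_left: assumes g: "g > 0" shows "bij_betw (\<lambda>t. diff_mod g t b) {..<g} {..<g}"
proof -
  have "inj_on (\<lambda>t. diff_mod g t b) {..<g}"
  proof (rule inj_onI)
    fix x y assume xy: "x \<in> {..<g}" "y \<in> {..<g}" "diff_mod g x b = diff_mod g y b"
    then have "(int x - int b) mod int g = (int y - int b) mod int g"
      unfolding int_diff_mod[OF g, symmetric] by simp
    then have "int x mod int g = int y mod int g"
      by (simp add: mod_eq_dvd_iff)
    then show "x = y" using xy by simp
  qed
  then show ?thesis
    unfolding bij_betw_def using diff_mod_less[OF g] by (intro conjI endo_inj_surj) auto
qed

lemma bij_diff_mod_right: assumes g: "g > 0" shows "bij_betw (\<lambda>t. diff_mod g b t) {..<g} {..<g}"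
proof -
  have "inj_on (\<lambda>t. diff_mod g b t) {..<g}"
  proof (rule inj_onI)
    fix x y assume xy: "x \<in> {..<g}" "y \<in> {..<g}" "diff_mod g b x = diff_mod g b y"
    then have "(int b - int x) mod int g = (int b - int y) mod int g"
      unfolding int_diff_mod[OF g, symmetric] by simp
    then have "int y mod int g = int x mod int g"
      by (simp add: mod_eq_dvd_iff)
    then show "x = y" using xy by simp
  qed
  then show ?thesis
    unfolding bij_betw_def using diff_mod_less[OF g] by (intro conjI endo_inj_surj) auto
qed

lemma sum_diff_mod_left: "g > 0 \<Longrightarrow> (\<Sum>t<g. h (diff_mod g t b)) = (\<Sum>a<g. h a)"
  using sum.reindex_bij_betw[OF bij_diff_mod_left, of g h b] .

lemma sum_diff_mod_right: "g > 0 \<Longrightarrow> (\<Sum>t<g. h (diff_mod g b t)) = (\<Sum>a<g. h a)"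
  using sum.reindex_bij_betw[OF bij_diff_mod_right, of g h b] .

text \<open>Redrawing the first coordinate of the pair makes the difference run once through all
  residues.\<close>

lemma sum_words_marginal:
  fixes h :: "nat \<Rightarrow> real"
  assumes g: "g > 0" and p: "p \<in> pairs k"
  shows "(\<Sum>x\<in>words g k. h (diff_mod g (x (fst p)) (x (snd p)))) = real g ^ k * ((\<Sum>a<g. h a) / real g)"
proof -
  have ij: "fst p < k" "fst p \<noteq> snd p" using p by (auto simp: pairs_def)
  have "real g * (\<Sum>x\<in>words g k. h (diff_mod g (x (fst p)) (x (snd p))))
    = (\<Sum>x\<in>words g k. \<Sum>t<g. h (diff_mod g t (x (snd p))))"
    by (subst sum_words_resample[OF ij(1), symmetric]) (use ij in simp)
  also have "\<dots> = real g ^ k * (\<Sum>a<g. h a)"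
    using g by (simp add: sum_diff_mod_left[of g h] card_words)
  finally show ?thesis using g by (simp add: field_simps)
qed

text \<open>Of two different pairs, \<open>p\<close> always has an endpoint outside
  \<open>q\<close>. Redrawing it averages the factor of \<open>p\<close> to zero and leaves the
  factor of \<open>q\<close> alone. Independence is only pairwise: around a triangle the three
  differences are dependent.\<close>

lemma sum_words_uncorrelated:
  fixes h h' :: "nat \<Rightarrow> real"
  assumes g: "g > 0" and p: "p \<in> pairs k" and q: "q \<in> pairs k" and pq: "p \<noteq> q"
    and h0: "(\<Sum>a<g. h a) = 0"
  shows "(\<Sum>x\<in>words g k. h (diff_mod g (x (fst p)) (x (snd p))) * h' (diff_mod g (x (fst q)) (x (snd q)))) = 0"
proof -
  let ?F = "\<lambda>x. h (diff_mod g (x (fst p)) (x (snd p))) * h' (diff_mod g (x (fst q)) (x (snd q)))"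
  obtain i j where ij: "p = (i,j)" "i < j" "j < k" using p by (auto simp: pairs_def)
  obtain i' j' where ij': "q = (i',j')" "i' < j'" "j' < k" using q by (auto simp: pairs_def)
  have "(i \<noteq> i' \<and> i \<noteq> j') \<or> (j \<noteq> i' \<and> j \<noteq> j')" using ij ij' pq by auto
  then have "\<exists>s<k. \<forall>x. (\<Sum>t<g. ?F (x(s := t))) = 0"
  proof
    assume a: "i \<noteq> i' \<and> i \<noteq> j'"
    have "(\<Sum>t<g. ?F (x(i := t))) = 0" for x
      using a ij ij' g h0 by (simp add: sum_diff_mod_left[of g h] flip: sum_distrib_right)
    then show ?thesis using ij by (intro exI[of _ i]) auto
  next
    assume a: "j \<noteq> i' \<and> j \<noteq> j'"
    have "(\<Sum>t<g. ?F (x(j := t))) = 0" for x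
      using a ij ij' g h0 by (simp add: sum_diff_mod_right[of g h] flip: sum_distrib_right)
    then show ?thesis using ij by (intro exI[of _ j]) auto
  qed
  then obtain s where s: "s < k" "\<And>x. (\<Sum>t<g. ?F (x(s := t))) = 0" by blast
  have "real g * (\<Sum>x\<in>words g k. ?F x) = 0"
    unfolding sum_words_resample[OF s(1), of ?F, symmetric] s(2) by simp
  then show ?thesis using g by simp
qed

text \<open>The variance of \<open>h\<close> at a uniform residue, provided \<open>h\<close> has
  mean zero.\<close>

definition var1 :: "nat \<Rightarrow> (nat \<Rightarrow> real) \<Rightarrow> real" where
  "var1 g h = (\<Sum>a<g. (h a)\<^sup>2) / real g"

lemma phi1_near:
  assumes g: "g > 0" and h0: "(\<Sum>a<g. h a) = 0" and eta: "\<And>a. a < g \<Longrightarrow> \<bar>h a\<bar> \<le> \<eta>"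
  shows "cmod (phi1 g (\<lambda>a. cis (h a)) - of_real (1 - var1 g h / 2)) \<le> \<eta> ^ 3"
proof -
  have "(\<Sum>a<g. (1 + \<i> * h a - ((h a)\<^sup>2 / 2 :: real))) = of_nat g + \<i> * of_real (\<Sum>a<g. h a) - of_real ((\<Sum>a<g. (h a)\<^sup>2) / 2)"
    by (simp add: sum.distrib sum_subtractf sum_distrib_left sum_divide_distrib)
  also have "\<dots> = of_nat g * of_real (1 - var1 g h / 2)"
    using g h0 by (simp add: var1_def field_simps)
  finally have e: "(\<Sum>a<g. (1 + \<i> * h a - ((h a)\<^sup>2 / 2 :: real))) = of_nat g * of_real (1 - var1 g h / 2)" .
  have "of_nat g * (phi1 g (\<lambda>a. cis (h a)) - of_real (1 - var1 g h / 2))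
      = (\<Sum>a<g. cis (h a) - (1 + \<i> * h a - ((h a)\<^sup>2 / 2 :: real)))"
    unfolding sum_subtractf[of "\<lambda>a. cis (h a)"] e using g by (simp add: phi1_def right_diff_distrib)
  from arg_cong[OF this, of cmod] have "real g * cmod (phi1 g (\<lambda>a. cis (h a)) - of_real (1 - var1 g h / 2))
      = cmod (\<Sum>a<g. cis (h a) - (1 + \<i> * h a - ((h a)\<^sup>2 / 2 :: real)))"
    unfolding norm_mult by simp
  also have "\<dots> \<le> (\<Sum>a<g. \<eta> ^ 3)"
  proof (rule sum_norm_le)
    fix a assume "a \<in> {..<g}"
    then have "\<bar>h a\<bar> ^ 3 \<le> \<eta> ^ 3" using eta by (intro power_mono) auto
    then show "cmod (cis (h a) - (1 + \<i> * h a - ((h a)\<^sup>2 / 2 :: real))) \<le> \<eta> ^ 3"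
      using cis_taylor2[of "h a"] by linarith
  qed
  also have "\<dots> = real g * \<eta> ^ 3" by simp
  finally show ?thesis using g by simp
qed

lemma prod_cis: "(\<Prod>p\<in>A. cis (f p)) = cis (\<Sum>p\<in>A. f p)"
  by (induction A rule: infinite_finite_induct) (auto simp: cis_mult)

text \<open>Mean-zero angles remove the linear term, and uncorrelatedness removes the cross terms of
  the quadratic one, so that up to second order only the sum of the single-pair variances is seen.
  Dependence between the pairs is confined to the cubic term, which is bounded trivially.\<close>

lemma phi_near:
  assumes g: "g > 0" and h0: "\<And>p. p \<in> pairs k \<Longrightarrow> (\<Sum>a<g. h p a) = 0"
    and eta: "\<And>p a. p \<in> pairs k \<Longrightarrow> a < g \<Longrightarrow> \<bar>h p a\<bar> \<le> \<eta>"
  shows "cmod (phi g k (\<lambda>p a. cis (h p a)) - of_real (1 - (\<Sum>p\<in>pairs k. var1 g (h p)) / 2))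
     \<le> (real (card (pairs k)) * \<eta>) ^ 3"
proof -
  define Y where "Y = (\<lambda>p x. h p (diff_mod g (x (fst p)) (x (snd p))))"
  define X where "X = (\<lambda>x. \<Sum>p\<in>pairs k. Y p x)"
  define V where "V = (\<Sum>p\<in>pairs k. var1 g (h p))"
  define K where "K = real (card (pairs k))"
  have mean: "(\<Sum>x\<in>words g k. X x) = 0"
    unfolding X_def by (subst sum.swap) (simp add: Y_def sum_words_marginal g h0)
  have "(\<Sum>x\<in>words g k. (X x)\<^sup>2) = (\<Sum>x\<in>words g k. \<Sum>p\<in>pairs k. \<Sum>q\<in>pairs k. Y p x * Y q x)"
    by (simp add: X_def power2_eq_square sum_product)
  also have "\<dots> = (\<Sum>p\<in>pairs k. \<Sum>x\<in>words g k. \<Sum>q\<in>pairs k. Y p x * Y q x)"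
    by (rule sum.swap)
  also have "\<dots> = (\<Sum>p\<in>pairs k. \<Sum>q\<in>pairs k. \<Sum>x\<in>words g k. Y p x * Y q x)"
    by (intro sum.cong refl sum.swap)
  also have "\<dots> = (\<Sum>p\<in>pairs k. real g ^ k * var1 g (h p))"
  proof (rule sum.cong[OF refl])
    fix p assume p: "p \<in> pairs k"
    have "(\<Sum>q\<in>pairs k. \<Sum>x\<in>words g k. Y p x * Y q x) = (\<Sum>q\<in>pairs k. if q = p then \<Sum>x\<in>words g k. (Y p x)\<^sup>2 else 0)"
    proof (rule sum.cong[OF refl])
      fix q assume q: "q \<in> pairs k"
      show "(\<Sum>x\<in>words g k. Y p x * Y q x) = (if q = p then \<Sum>x\<in>words g k. (Y p x)\<^sup>2 else 0)"
        unfolding Y_def using sum_words_uncorrelated[OF g p q _ h0[OF p], of "h q"]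
        by (auto simp: power2_eq_square)
    qed
    also have "\<dots> = (\<Sum>x\<in>words g k. (Y p x)\<^sup>2)" using p by (simp add: sum.delta)
    also have "\<dots> = real g ^ k * var1 g (h p)"
      unfolding Y_def var1_def using sum_words_marginal[OF g p, of "\<lambda>a. (h p a)\<^sup>2"] by simp
    finally show "(\<Sum>q\<in>pairs k. \<Sum>x\<in>words g k. Y p x * Y q x) = real g ^ k * var1 g (h p)" .
  qed
  finally have var: "(\<Sum>x\<in>words g k. (X x)\<^sup>2) = real g ^ k * V"
    by (simp add: V_def sum_distrib_left)
  have Xb: "\<bar>X x\<bar> \<le> K * \<eta>" for x
  proof -
    have "\<bar>X x\<bar> \<le> (\<Sum>p\<in>pairs k. \<bar>Y p x\<bar>)" unfolding X_def by (rule sum_abs)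
    also have "\<dots> \<le> (\<Sum>p\<in>pairs k. \<eta>)"
      unfolding Y_def by (intro sum_mono eta diff_mod_less g)
    finally show ?thesis by (simp add: K_def)
  qed
  have "(\<Sum>x\<in>words g k. (1 + \<i> * X x - ((X x)\<^sup>2 / 2 :: real)))
      = of_nat (g ^ k) + \<i> * of_real (\<Sum>x\<in>words g k. X x) - of_real ((\<Sum>x\<in>words g k. (X x)\<^sup>2) / 2)"
    by (simp add: sum.distrib sum_subtractf sum_distrib_left sum_divide_distrib card_words)
  also have "\<dots> = of_nat g ^ k * of_real (1 - V / 2)"
    by (simp add: mean var algebra_simps)
  finally have e: "(\<Sum>x\<in>words g k. (1 + \<i> * X x - ((X x)\<^sup>2 / 2 :: real))) = of_nat g ^ k * of_real (1 - V / 2)" .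
  have ph: "phi g k (\<lambda>p a. cis (h p a)) = (\<Sum>x\<in>words g k. cis (X x)) / of_nat g ^ k"
    by (simp add: phi_def X_def Y_def prod_cis)
  have "of_nat g ^ k * (phi g k (\<lambda>p a. cis (h p a)) - of_real (1 - V / 2))
      = (\<Sum>x\<in>words g k. cis (X x) - (1 + \<i> * X x - ((X x)\<^sup>2 / 2 :: real)))"
    unfolding sum_subtractf[of "\<lambda>x. cis (X x)"] e using g by (simp add: ph right_diff_distrib)
  from arg_cong[OF this, of cmod] have "real g ^ k * cmod (phi g k (\<lambda>p a. cis (h p a)) - of_real (1 - V / 2))
      = cmod (\<Sum>x\<in>words g k. cis (X x) - (1 + \<i> * X x - ((X x)\<^sup>2 / 2 :: real)))"
    unfolding norm_mult norm_power by simp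
  also have "\<dots> \<le> (\<Sum>x\<in>words g k. (K * \<eta>) ^ 3)"
  proof (rule sum_norm_le)
    fix x
    have "\<bar>X x\<bar> ^ 3 \<le> (K * \<eta>) ^ 3" using Xb by (intro power_mono) auto
    then show "cmod (cis (X x) - (1 + \<i> * X x - ((X x)\<^sup>2 / 2 :: real))) \<le> (K * \<eta>) ^ 3"
      using cis_taylor2[of "X x"] by linarith
  qed
  also have "\<dots> = real g ^ k * (K * \<eta>) ^ 3" by (simp add: card_words)
  finally show ?thesis using g by (simp add: V_def K_def)
qed

section \<open>Phases with a large characteristic function are near characters\<close>

text \<open>For unimodular \<open>b\<close> the value is 1 exactly when the quotients of cyclically
  consecutive values all coincide, that is, when \<open>b\<close> is a constant multiple of a
  character. The defect from 1 measures the distance from such functions.\<close>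

definition shift_corr :: "nat \<Rightarrow> (nat \<Rightarrow> complex) \<Rightarrow> real" where
  "shift_corr g b = cmod (\<Sum>a<g. b ((a + 1) mod g) * cnj (b a)) / real g"

definition omega :: "nat \<Rightarrow> complex" where
  "omega g = cis (2 * pi / real g)"

lemma diff_mod_Suc_mod:
  assumes g: "g > 0"
  shows "diff_mod g ((t + 1) mod g) u = (diff_mod g t u + 1) mod g"
proof -
  have "int (diff_mod g ((t + 1) mod g) u) = int ((diff_mod g t u + 1) mod g)"
    using g by (simp add: int_diff_mod zmod_int mod_simps algebra_simps)
  then show ?thesis by simp
qed

text \<open>The triangle inequality in \<open>u\<close> removes \<open>B\<close>, Cauchy-Schwarz in
  \<open>u\<close> squares the inner sum, and after expanding the square \<open>A\<close> enters
  only through its modulus. What remains are autocorrelations of \<open>b\<close>.\<close>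

lemma van_der_corput:
  assumes g: "g > 0" and b: "\<And>a. a < g \<Longrightarrow> cmod (b a) = 1"
    and A: "\<And>t. t < g \<Longrightarrow> cmod (A t) = 1" and B: "\<And>u. u < g \<Longrightarrow> cmod (B u) = 1"
  shows "(cmod (\<Sum>u<g. \<Sum>t<g. b (diff_mod g t u) * A t * B u))\<^sup>2 \<le> real g ^ 3 * (real g - 1 + shift_corr g b)"
proof -
  define T where "T = (\<lambda>u. \<Sum>t<g. b (diff_mod g t u) * A t)"
  define C where "C = (\<lambda>t t'. \<Sum>u<g. b (diff_mod g t u) * cnj (b (diff_mod g t' u)))"
  have bd: "cmod (b (diff_mod g t u)) = 1" for t u using b diff_mod_less[OF g] by blast
  have "cmod (\<Sum>u<g. \<Sum>t<g. b (diff_mod g t u) * A t * B u) = cmod (\<Sum>u<g. T u * B u)"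
    by (simp add: T_def sum_distrib_right)
  also have "\<dots> \<le> (\<Sum>u<g. cmod (T u * B u))" by (rule norm_sum)
  also have "\<dots> = (\<Sum>u<g. cmod (T u))"
    by (intro sum.cong refl) (simp add: norm_mult B)
  finally have "(cmod (\<Sum>u<g. \<Sum>t<g. b (diff_mod g t u) * A t * B u))\<^sup>2 \<le> (\<Sum>u<g. cmod (T u))\<^sup>2"
    by (intro power_mono) auto
  also have "\<dots> \<le> (\<Sum>u<g. (cmod (T u))\<^sup>2) * real g"
    using sum_squared_le_sum_of_squares[of "\<lambda>u. cmod (T u)" "{..<g}"] g by simp
  also have "\<dots> \<le> real g * (real g * (real g - 1 + shift_corr g b)) * real g"
  proof (rule mult_right_mono)
    have "complex_of_real (\<Sum>u<g. (cmod (T u))\<^sup>2) = (\<Sum>u<g. T u * cnj (T u))"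
      by (simp add: complex_norm_square del: of_real_power)
    also have "\<dots> = (\<Sum>u<g. \<Sum>t<g. \<Sum>t'<g. b (diff_mod g t u) * A t * (cnj (b (diff_mod g t' u)) * cnj (A t')))"
      by (simp add: T_def sum_product)
    also have "\<dots> = (\<Sum>t<g. \<Sum>u<g. \<Sum>t'<g. b (diff_mod g t u) * A t * (cnj (b (diff_mod g t' u)) * cnj (A t')))"
      by (rule sum.swap)
    also have "\<dots> = (\<Sum>t<g. \<Sum>t'<g. \<Sum>u<g. b (diff_mod g t u) * A t * (cnj (b (diff_mod g t' u)) * cnj (A t')))"
      by (intro sum.cong refl sum.swap)
    also have "\<dots> = (\<Sum>t<g. \<Sum>t'<g. A t * cnj (A t') * C t t')"
      unfolding C_def sum_distrib_left by (intro sum.cong refl) (simp add: mult_ac)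
    also have "\<dots> = (\<Sum>t'<g. \<Sum>t<g. A t * cnj (A t') * C t t')"
      by (rule sum.swap)
    finally have "complex_of_real (\<Sum>u<g. (cmod (T u))\<^sup>2) = (\<Sum>t'<g. \<Sum>t<g. A t * cnj (A t') * C t t')" .
    from arg_cong[OF this, of cmod]
    have "(\<Sum>u<g. (cmod (T u))\<^sup>2) = cmod (\<Sum>t'<g. \<Sum>t<g. A t * cnj (A t') * C t t')"
      by (simp only: norm_of_real abs_of_nonneg[OF sum_nonneg] zero_le_power2)
    also have "\<dots> \<le> (\<Sum>t'<g. real g * (real g - 1 + shift_corr g b))"
    proof (rule sum_norm_le)
      fix t' assume t': "t' \<in> {..<g}"
      \<comment> \<open>For each \<open>t'\<close> only the correlation at shift 1 is kept and the
        other g - 1 are bounded by g. A gain at this one shift suffices because 1 generates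
        Z_g.\<close>
      define s where "s = (t' + 1) mod g"
      have s: "s \<in> {..<g}" using g by (simp add: s_def)
      have Cle: "cmod (C t t') \<le> real g" for t
      proof -
        have "cmod (C t t') \<le> (\<Sum>u<g. 1)"
          unfolding C_def by (rule sum_norm_le) (simp add: norm_mult bd)
        then show ?thesis by simp
      qed
      have "C s t' = (\<Sum>u<g. b ((diff_mod g t' u + 1) mod g) * cnj (b (diff_mod g t' u)))"
        unfolding C_def s_def diff_mod_Suc_mod[OF g] ..
      also have "\<dots> = (\<Sum>a<g. b ((a + 1) mod g) * cnj (b a))"
        using sum_diff_mod_right[OF g, of "\<lambda>a. b ((a + 1) mod g) * cnj (b a)" t'] .
      finally have Cs: "cmod (C s t') = real g * shift_corr g b" using g by (simp add: shift_corr_def)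
      have "cmod (\<Sum>t<g. A t * cnj (A t') * C t t') \<le> (\<Sum>t<g. cmod (A t * cnj (A t') * C t t'))"
        by (rule norm_sum)
      also have "\<dots> = (\<Sum>t<g. cmod (C t t'))"
        using t' by (intro sum.cong refl) (simp add: norm_mult A)
      also have "\<dots> = cmod (C s t') + (\<Sum>t\<in>{..<g} - {s}. cmod (C t t'))"
        using s by (intro sum.remove) auto
      also have "\<dots> \<le> real g * shift_corr g b + (\<Sum>t\<in>{..<g} - {s}. real g)"
        unfolding Cs by (intro add_left_mono sum_mono Cle)
      also have "(\<Sum>t\<in>{..<g} - {s}. real g) = (real g - 1) * real g"
        using s g by (simp add: card_Diff_singleton of_nat_diff)
      finally show "cmod (\<Sum>t<g. A t * cnj (A t') * C t t') \<le> real g * (real g - 1 + shift_corr g b)"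
        by (simp add: algebra_simps)
    qed
    finally show "(\<Sum>u<g. (cmod (T u))\<^sup>2) \<le> real g * (real g * (real g - 1 + shift_corr g b))" by simp
  qed simp
  finally show ?thesis by (simp add: power3_eq_cube mult_ac)
qed

lemma phi1_far:
  assumes g: "g > 0" and b: "\<And>a. a < g \<Longrightarrow> cmod (b a) = 1"
  shows "(cmod (phi1 g b))\<^sup>2 \<le> 1 - (1 - shift_corr g b) / real g"
proof -
  have "(\<Sum>u<g. \<Sum>t<g. b (diff_mod g t u) * 1 * 1) = of_nat g * (of_nat g * phi1 g b)"
    using g by (simp add: sum_diff_mod_left[of g b] phi1_def)
  then have "real g ^ 4 * (cmod (phi1 g b))\<^sup>2 = (cmod (\<Sum>u<g. \<Sum>t<g. b (diff_mod g t u) * 1 * 1))\<^sup>2"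
    by (simp add: norm_mult power_mult_distrib power4_eq_xxxx power2_eq_square)
  also have "\<dots> \<le> real g ^ 3 * (real g - 1 + shift_corr g b)"
    by (rule van_der_corput) (use g b in auto)
  also have "\<dots> = real g ^ 4 * (1 - (1 - shift_corr g b) / real g)"
    using g by (simp add: field_simps power4_eq_xxxx power3_eq_cube)
  finally show ?thesis using g by simp
qed

text \<open>With all coordinates other than i and j frozen, no pair except \<open>p\<close> contains
  both, so the product has the form W(t - u) A(t) B(u) and \<open>van_der_corput\<close> applies.
  The other pairs enter only as unimodular factors, which is why the loss does not grow with
  k.\<close>

lemma phi_far:
  assumes g: "g > 0" and W: "\<And>q a. q \<in> pairs k \<Longrightarrow> a < g \<Longrightarrow> cmod (W q a) = 1" and p: "p \<in> pairs k"
  shows "(cmod (phi g k W))\<^sup>2 \<le> 1 - (1 - shift_corr g (W p)) / real g"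
proof -
  obtain i j where ij: "p = (i, j)" "i < j" "j < k" using p by (auto simp: pairs_def)
  define Z where "Z = (\<lambda>q x. W q (diff_mod g (x (fst q)) (x (snd q))))"
  define F where "F = (\<lambda>x. \<Prod>q\<in>pairs k. Z q x)"
  \<comment> \<open>Pairs that touch j: they form the factor depending on \<open>u\<close>; all
    others except \<open>p\<close> form the factor depending on \<open>t\<close>.\<close>
  define J where "J = {q :: nat \<times> nat. fst q = j \<or> snd q = j}"
  define R where "R = pairs k - {p}"
  define Q where "Q = real g ^ 3 * (real g - 1 + shift_corr g (W p))"
  have fR: "finite R" by (simp add: R_def)
  have nZ: "cmod (Z q x) = 1" if "q \<in> R" for q x
    unfolding Z_def using that by (intro W diff_mod_less g) (auto simp: R_def)
  have fact: "F (x(j := u, i := t)) = W p (diff_mod g t u) * (\<Prod>q\<in>R - J. Z q (x(i := t))) * (\<Prod>q\<in>R \<inter> J. Z q (x(j := u)))"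
    for x t u
  proof -
    have "F (x(j := u, i := t)) = Z p (x(j := u, i := t)) * (\<Prod>q\<in>R. Z q (x(j := u, i := t)))"
      unfolding F_def R_def using p by (intro prod.remove) auto
    also have "Z p (x(j := u, i := t)) = W p (diff_mod g t u)"
      using ij by (simp add: Z_def)
    also have "(\<Prod>q\<in>R. Z q (x(j := u, i := t)))
        = (\<Prod>q\<in>R \<inter> J. Z q (x(j := u, i := t))) * (\<Prod>q\<in>R - J. Z q (x(j := u, i := t)))"
      by (rule prod.Int_Diff[OF fR])
    also have "(\<Prod>q\<in>R \<inter> J. Z q (x(j := u, i := t))) = (\<Prod>q\<in>R \<inter> J. Z q (x(j := u)))"
    proof (rule prod.cong[OF refl])
      fix q assume "q \<in> R \<inter> J"
      then have "fst q \<noteq> i" "snd q \<noteq> i" using ij by (auto simp: R_def J_def pairs_def)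
      then show "Z q (x(j := u, i := t)) = Z q (x(j := u))" by (simp add: Z_def)
    qed
    also have "(\<Prod>q\<in>R - J. Z q (x(j := u, i := t))) = (\<Prod>q\<in>R - J. Z q (x(i := t)))"
    proof (rule prod.cong[OF refl])
      fix q assume "q \<in> R - J"
      then have "fst q \<noteq> j" "snd q \<noteq> j" by (auto simp: J_def)
      then show "Z q (x(j := u, i := t)) = Z q (x(i := t))" by (simp add: Z_def)
    qed
    finally show ?thesis by (simp only: mult_ac)
  qed
  have vdc: "cmod (\<Sum>u<g. \<Sum>t<g. F (x(j := u, i := t))) \<le> sqrt Q" for x
  proof -
    have "(cmod (\<Sum>u<g. \<Sum>t<g. W p (diff_mod g t u) * (\<Prod>q\<in>R - J. Z q (x(i := t))) * (\<Prod>q\<in>R \<inter> J. Z q (x(j := u)))))\<^sup>2 \<le> Q"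
      unfolding Q_def
    proof (rule van_der_corput[OF g])
      show "cmod (\<Prod>q\<in>R - J. Z q (x(i := t))) = 1" for t
        unfolding prod_norm[symmetric] by (rule prod.neutral) (simp add: nZ)
      show "cmod (\<Prod>q\<in>R \<inter> J. Z q (x(j := u))) = 1" for u
        unfolding prod_norm[symmetric] by (rule prod.neutral) (simp add: nZ)
    qed (use W p in auto)
    then show ?thesis unfolding fact by (rule real_le_rsqrt)
  qed
  have Q0: "Q \<ge> 0" unfolding Q_def shift_corr_def using g by (intro mult_nonneg_nonneg add_nonneg_nonneg) auto
  have i: "i < k" and j: "j < k" using ij by auto
  have "of_nat g * (of_nat g * (\<Sum>x\<in>words g k. F x)) = of_nat g * (\<Sum>x\<in>words g k. \<Sum>t<g. F (x(i := t)))"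
    unfolding sum_words_resample[OF i, of F] ..
  also have "\<dots> = (\<Sum>x\<in>words g k. \<Sum>u<g. \<Sum>t<g. F (x(j := u, i := t)))"
    unfolding sum_words_resample[OF j, of "\<lambda>x. \<Sum>t<g. F (x(i := t))", symmetric] ..
  finally have "real g * (real g * cmod (\<Sum>x\<in>words g k. F x)) = cmod (\<Sum>x\<in>words g k. \<Sum>u<g. \<Sum>t<g. F (x(j := u, i := t)))"
    by (metis norm_mult norm_of_nat)
  also have "\<dots> \<le> (\<Sum>x\<in>words g k. sqrt Q)"
    by (rule sum_norm_le) (rule vdc)
  also have "\<dots> = real g ^ k * sqrt Q" by (simp add: card_words)
  finally have "real g * (real g * cmod (\<Sum>x\<in>words g k. F x)) \<le> real g ^ k * sqrt Q" .
  moreover have "cmod (\<Sum>x\<in>words g k. F x) = real g ^ k * cmod (phi g k W)"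
    using g by (simp add: phi_def F_def Z_def norm_divide norm_power)
  ultimately have "real g ^ k * ((real g)\<^sup>2 * cmod (phi g k W)) \<le> real g ^ k * sqrt Q"
    by (simp add: power2_eq_square mult_ac)
  then have "(real g)\<^sup>2 * cmod (phi g k W) \<le> sqrt Q" using g by simp
  then have "((real g)\<^sup>2 * cmod (phi g k W))\<^sup>2 \<le> (sqrt Q)\<^sup>2" by (intro power_mono) auto
  then have "real g ^ 4 * (cmod (phi g k W))\<^sup>2 \<le> Q"
    using Q0 by (simp add: power_mult_distrib flip: power_mult)
  also have "Q = real g ^ 4 * (1 - (1 - shift_corr g (W p)) / real g)"
    using g by (simp add: Q_def field_simps power4_eq_xxxx power3_eq_cube)
  finally show ?thesis using g by simp
qed

section \<open>Approximate characters of Z_g\<close>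

lemma omega_power: "omega g ^ n = cis (2 * pi * real n / real g)"
  unfolding omega_def by (subst Complex.DeMoivre) (simp add: mult_ac)

lemma norm_omega [simp]: "cmod (omega g) = 1"
  by (simp add: omega_def)

lemma omega_nonzero [simp]: "omega g \<noteq> 0"
  by (simp add: omega_def)

lemma omega_power_g: "g > 0 \<Longrightarrow> omega g ^ g = 1"
  by (simp add: omega_power)

lemma norm_diff_square_unit:
  assumes "cmod x = 1" "cmod y = 1"
  shows "(cmod (x - y))\<^sup>2 = 2 - 2 * Re (x * cnj y)"
proof -
  have "(Re x)\<^sup>2 + (Im x)\<^sup>2 = 1" "(Re y)\<^sup>2 + (Im y)\<^sup>2 = 1"
    using assms by (metis cmod_power2 power_one)+
  then show ?thesis unfolding cmod_power2
    by (simp add: power2_eq_square algebra_simps)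
qed

text \<open>The quotients \<open>z\<close> of consecutive values have a sum of almost maximal
  modulus, hence all lie near one direction \<open>\<zeta>\<close>. Their cyclic product is 1, so
  the g-th power of \<open>\<zeta>\<close> is near 1 and \<open>\<zeta>\<close> is near a power of
  \<open>omega g\<close>. Walking from \<open>b 0\<close> through the residues accumulates fewer
  than g errors of size 3 s.\<close>

lemma near_character:
  assumes g: "g > 0" and b: "\<And>a. a < g \<Longrightarrow> cmod (b a) = 1"
    and e: "e \<ge> 0" "real g * e < 1" and corr: "shift_corr g b \<ge> 1 - e"
  shows "\<exists>c<g. \<forall>a<g. cmod (b a - b 0 * omega g ^ (c * a)) \<le> 3 * real g * sqrt (2 * real g * e)"
proof -
  define z where "z = (\<lambda>a. b ((a + 1) mod g) * cnj (b a))"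
  define S where "S = (\<Sum>a<g. z a)"
  define \<zeta> where "\<zeta> = S / of_real (cmod S)"
  define s where "s = sqrt (2 * real g * e)"
  have s0: "s \<ge> 0" using e by (simp add: s_def)
  have nS: "cmod S = real g * shift_corr g b" using g by (simp add: S_def z_def shift_corr_def)
  have "real g * shift_corr g b \<ge> real g * (1 - e)" using corr by (intro mult_left_mono) auto
  then have nS': "cmod S \<ge> real g - real g * e" by (simp add: nS algebra_simps)
  have g1: "real g \<ge> 1" using g by linarith
  have S0: "cmod S > 0" using nS' e g1 by linarith
  have n\<zeta>: "cmod \<zeta> = 1" using S0 by (simp add: \<zeta>_def norm_divide)
  have nz: "cmod (z a) = 1" if "a < g" for a
    using that g b by (simp add: z_def norm_mult)
  have "S * cnj \<zeta> = of_real (cmod S)"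
    using S0 by (simp add: \<zeta>_def complex_norm_square[symmetric] power2_eq_square)
  then have Resum: "(\<Sum>a<g. Re (z a * cnj \<zeta>)) = cmod S"
    by (metis Re_complex_of_real Re_sum S_def sum_distrib_right)
  \<comment> \<open>Each of the g real parts is at most 1 and their sum is at least g - g e, so none
    of them is below 1 - g e.\<close>
  have close: "cmod (z a - \<zeta>) \<le> s" if a: "a < g" for a
  proof -
    have "(\<Sum>t<g. Re (z t * cnj \<zeta>)) = Re (z a * cnj \<zeta>) + (\<Sum>t\<in>{..<g} - {a}. Re (z t * cnj \<zeta>))"
      using a by (intro sum.remove) auto
    also have "(\<Sum>t\<in>{..<g} - {a}. Re (z t * cnj \<zeta>)) \<le> (\<Sum>t\<in>{..<g} - {a}. 1)"
    proof (rule sum_mono)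
      fix t assume "t \<in> {..<g} - {a}"
      then have "cmod (z t * cnj \<zeta>) = 1" using nz n\<zeta> by (simp add: norm_mult)
      then show "Re (z t * cnj \<zeta>) \<le> 1" by (metis complex_Re_le_cmod)
    qed
    also have "\<dots> = real g - 1" using a by (simp add: card_Diff_singleton of_nat_diff)
    finally have "Re (z a * cnj \<zeta>) \<ge> 1 - real g * e" using Resum nS' by linarith
    then have "(cmod (z a - \<zeta>))\<^sup>2 \<le> 2 * real g * e"
      unfolding norm_diff_square_unit[OF nz[OF a] n\<zeta>] by simp
    then show ?thesis unfolding s_def by (rule real_le_rsqrt)
  qed
  have prodz: "(\<Prod>a<g. z a) = 1"
  proof -
    have cyc: "(\<Prod>a<g. b ((a + 1) mod g)) = (\<Prod>a<g. b a)"
    proof -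
      obtain m where m: "g = Suc m" using g by (cases g) auto
      have "(\<Prod>a<g. b ((a + 1) mod g)) = (\<Prod>a<m. b ((a + 1) mod g)) * b 0"
        unfolding m by simp
      also have "(\<Prod>a<m. b ((a + 1) mod g)) = (\<Prod>a<m. b (Suc a))"
        by (intro prod.cong refl) (simp add: m)
      also have "(\<Prod>a<m. b (Suc a)) * b 0 = (\<Prod>a<g. b a)"
        unfolding m prod.lessThan_Suc_shift by simp
      finally show ?thesis .
    qed
    have "cmod (\<Prod>a<g. b a) = 1"
      unfolding prod_norm[symmetric] by (rule prod.neutral) (simp add: b)
    then have "(\<Prod>a<g. b a) * cnj (\<Prod>a<g. b a) = 1"
      by (simp only: complex_norm_square[symmetric]) simp
    then show ?thesis unfolding z_def prod.distrib cyc by simp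
  qed
  have "cmod ((\<Prod>a<g. \<zeta>) - (\<Prod>a<g. z a)) \<le> (\<Sum>a<g. cmod (\<zeta> - z a))"
    by (rule norm_prod_diff) (auto simp: n\<zeta> nz)
  also have "\<dots> \<le> (\<Sum>a<g. s)"
    by (intro sum_mono) (use close in \<open>auto simp: norm_minus_commute\<close>)
  finally have pow: "cmod (\<zeta> ^ g - 1) \<le> real g * s" by (simp add: prodz)
  define \<tau> where "\<tau> = Arg \<zeta>"
  have \<zeta>\<tau>: "\<zeta> = cis \<tau>"
    using n\<zeta> cis_Arg[of \<zeta>] by (cases "\<zeta> = 0") (auto simp: \<tau>_def sgn_eq)
  \<comment> \<open>The nearest multiple of 2 pi / g. Rounding puts g r into [-pi, pi], where the
    chord length controls the angle.\<close>
  define m where "m = round (real g * \<tau> / (2 * pi))"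
  define r where "r = \<tau> - 2 * pi * of_int m / real g"
  have "\<bar>of_int m - real g * \<tau> / (2 * pi)\<bar> \<le> 1 / 2"
    unfolding m_def by (rule of_int_round_abs_le)
  moreover have gr: "real g * r = - (2 * pi * (of_int m - real g * \<tau> / (2 * pi)))"
    using g by (simp add: r_def field_simps)
  ultimately have "\<bar>real g * r\<bar> \<le> 2 * pi * (1 / 2)"
    unfolding gr abs_minus_cancel abs_mult by (intro mult_mono) auto
  then have grpi: "\<bar>real g * r\<bar> \<le> pi" by simp
  have cisint: "cis (2 * pi * of_int n) = 1" for n :: int
    by (simp add: cis_multiple_2pi)
  have "\<zeta> ^ g = cis (real g * \<tau>)" by (simp add: \<zeta>\<tau> Complex.DeMoivre)
  also have "real g * \<tau> = real g * r + 2 * pi * of_int m"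
    using g by (simp add: r_def field_simps)
  also have "cis \<dots> = cis (real g * r)"
    unfolding cis_mult[symmetric] cisint by simp
  finally have "\<bar>real g * r\<bar> \<le> 2 * (real g * s)"
    using abs_le_norm_cis[OF grpi] pow by simp
  \<comment> \<open>Taking the g-th root loses nothing: the g multiplying the angle cancels against
    the g summands that bounded the error of the g-th power.\<close>
  then have rs: "\<bar>r\<bar> \<le> 2 * s" using g by (simp add: abs_mult)
  define c where "c = nat (m mod int g)"
  have cg: "c < g" using g by (simp add: c_def nat_less_iff)
  have "int c = m - int g * (m div int g)"
    using g by (simp add: c_def minus_mult_div_eq_mod)
  then have "real c = of_int m - real g * of_int (m div int g)"
    by (metis of_int_diff of_int_mult of_int_of_nat_eq)
  then have "2 * pi * real c / real g = 2 * pi * of_int m / real g + 2 * pi * of_int (- (m div int g))"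
    using g by (simp add: diff_divide_distrib right_diff_distrib)
  then have "omega g ^ c = cis (2 * pi * of_int m / real g) * cis (2 * pi * of_int (- (m div int g)))"
    unfolding omega_power cis_mult by simp
  then have omc: "omega g ^ c = cis (2 * pi * of_int m / real g)" unfolding cisint by simp
  have "\<zeta> - omega g ^ c = omega g ^ c * (cis r - 1)"
    unfolding omc right_diff_distrib cis_mult by (simp add: r_def \<zeta>\<tau>)
  then have "cmod (\<zeta> - omega g ^ c) = cmod (cis r - 1)" by (simp add: norm_mult norm_power)
  also have "\<dots> \<le> 2 * s" using norm_cis_le_abs[of r] rs by linarith
  finally have \<zeta>c: "cmod (\<zeta> - omega g ^ c) \<le> 2 * s" .
  have zc: "cmod (z a - omega g ^ c) \<le> 3 * s" if "a < g" for a
    using norm_triangle_ineq[of "z a - \<zeta>" "\<zeta> - omega g ^ c"] close[OF that] \<zeta>c by simp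
  have main: "cmod (b a - b 0 * omega g ^ (c * a)) \<le> real a * (3 * s)" if "a < g" for a
    using that
  proof (induction a)
    case 0
    then show ?case by simp
  next
    case (Suc a)
    have ba: "b a * cnj (b a) = 1" using b[of a] Suc.prems
      by (simp only: complex_norm_square[symmetric]) simp
    have bz: "b (Suc a) = b a * z a"
      using Suc.prems ba by (simp add: z_def mult_ac)
    have "b (Suc a) - b 0 * omega g ^ (c * Suc a) = (b a - b 0 * omega g ^ (c * a)) * z a + b 0 * omega g ^ (c * a) * (z a - omega g ^ c)"
      by (simp add: bz algebra_simps power_add)
    then have "cmod (b (Suc a) - b 0 * omega g ^ (c * Suc a))
       \<le> cmod (b a - b 0 * omega g ^ (c * a)) * cmod (z a) + cmod (b 0) * cmod (z a - omega g ^ c)"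
      using norm_triangle_ineq[of "(b a - b 0 * omega g ^ (c * a)) * z a" "b 0 * omega g ^ (c * a) * (z a - omega g ^ c)"]
      by (simp add: norm_mult norm_power)
    also have "\<dots> = cmod (b a - b 0 * omega g ^ (c * a)) + cmod (z a - omega g ^ c)"
      using nz[of a] b[of 0] Suc.prems by simp
    also have "\<dots> \<le> real a * (3 * s) + 3 * s"
      using Suc.IH Suc.prems zc[of a] by simp
    finally show ?case by (simp add: algebra_simps)
  qed
  show ?thesis
  proof (intro exI[of _ c] conjI allI impI cg)
    fix a assume a: "a < g"
    have "real a * (3 * s) \<le> real g * (3 * s)" using a s0 by (intro mult_right_mono) auto
    then show "cmod (b a - b 0 * omega g ^ (c * a)) \<le> 3 * real g * sqrt (2 * real g * e)"
      using main[OF a] by (simp add: s_def)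
  qed
qed

text \<open>Closeness to a character is tested relative to \<open>b 0\<close>, because a common
  factor of all values cancels later against \<open>chi\<close>. For c = 0 these are the nearly
  constant phases.\<close>

definition nbhd :: "nat \<Rightarrow> nat \<Rightarrow> real \<Rightarrow> nat \<Rightarrow> (nat \<Rightarrow> complex) set" where
  "nbhd g M \<delta> c = {b \<in> phases g M. \<forall>a<g. cmod (b a - b 0 * omega g ^ (c * a)) \<le> \<delta>}"

lemma norm_phases: "M > 0 \<Longrightarrow> b \<in> phases g M \<Longrightarrow> a < g \<Longrightarrow> cmod (b a) = 1"
  unfolding phases_def by (intro norm_unity[of M]) auto

lemma finite_nbhd [simp]: "M > 0 \<Longrightarrow> finite (nbhd g M \<delta> c)"
  by (simp add: nbhd_def)

lemma root_unity_sum: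
  fixes z :: complex
  assumes "z ^ g = 1" "z \<noteq> 1"
  shows "(\<Sum>j<g. z ^ j) = 0"
proof -
  have "(1 - z) * (\<Sum>j<g. z ^ j) = 1 - z ^ g"
    by (rule one_diff_power_eq[symmetric])
  then show ?thesis using assms by simp
qed

text \<open>The powers of \<open>z\<close> sum to 0, so g is the modulus of the sum of the 1 - z^j
  for j < g, and each of these is at most g |z - 1|.\<close>

lemma root_unity_far:
  assumes g: "g > 0" and z: "z ^ g = 1" "z \<noteq> 1"
  shows "cmod (z - 1) \<ge> 1 / real g"
proof -
  have nz: "cmod z = 1" using power_eq_1_iff[of z g] z g by simp
  have "real g = cmod (of_nat g - (\<Sum>j<g. z ^ j))"
    using root_unity_sum[OF z] by simp
  also have "\<dots> = cmod (\<Sum>j<g. 1 - z ^ j)" by (simp add: sum_subtractf)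
  also have "\<dots> \<le> (\<Sum>j<g. real g * cmod (z - 1))"
  proof (rule sum_norm_le)
    fix j assume "j \<in> {..<g}"
    then have "real j * cmod (z - 1) \<le> real g * cmod (z - 1)"
      by (intro mult_right_mono) auto
    moreover have "cmod (z ^ j - 1 ^ j) \<le> real j * cmod (z - 1)"
      by (rule norm_power_diff) (auto simp: nz)
    ultimately show "cmod (1 - z ^ j) \<le> real g * cmod (z - 1)"
      by (simp add: norm_minus_commute)
  qed
  also have "\<dots> = real g * (real g * cmod (z - 1))" by simp
  finally show ?thesis using g by (simp add: field_simps)
qed

lemma omega_power_inj: "c < g \<Longrightarrow> c' < g \<Longrightarrow> omega g ^ c = omega g ^ c' \<Longrightarrow> c = c'"
  using Complex.bij_betw_roots_unity[of g] unfolding bij_betw_def inj_on_def omega_power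
  by (cases "g = 0") auto

lemma omega_power_eq_1: "c < g \<Longrightarrow> omega g ^ c = 1 \<longleftrightarrow> c = 0"
  using omega_power_inj[of c g 0] by auto

lemma omega_power_mod: assumes "g > 0" shows "omega g ^ (n mod g) = omega g ^ n"
proof -
  have "omega g ^ n = omega g ^ (g * (n div g) + n mod g)" by simp
  also have "\<dots> = omega g ^ (n mod g)"
    unfolding power_add power_mult omega_power_g[OF assms] by simp
  finally show ?thesis by simp
qed

lemma omega_power_root: assumes "g > 0" shows "(omega g ^ n) ^ g = 1"
proof -
  have "(omega g ^ n) ^ g = (omega g ^ g) ^ n" by (simp add: mult.commute flip: power_mult)
  then show ?thesis using omega_power_g[OF assms] by simp
qed

lemma omega_diff_mod:
  assumes g: "g > 0"
  shows "omega g ^ diff_mod g a b = omega g ^ a / omega g ^ b"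
proof -
  have "int ((diff_mod g a b + b) mod g) = int (a mod g)"
    using g by (simp add: zmod_int int_diff_mod mod_simps)
  then have "(diff_mod g a b + b) mod g = a mod g" by simp
  then have "omega g ^ (diff_mod g a b + b) = omega g ^ a"
    using omega_power_mod[OF g, of "diff_mod g a b + b"] omega_power_mod[OF g, of a] by simp
  then show ?thesis by (simp add: power_add field_simps)
qed

text \<open>Residue 1 alone separates the characters: their values there are distinct g-th roots of
  unity, hence at least 1 / g apart.\<close>

lemma nbhd_disjoint:
  assumes g: "g \<ge> 2" and M: "M > 0" and \<delta>: "2 * \<delta> < 1 / real g"
    and c: "c < g" "c' < g" and b: "b \<in> nbhd g M \<delta> c" "b \<in> nbhd g M \<delta> c'"
  shows "c = c'"
proof (rule ccontr)
  assume ne: "c \<noteq> c'"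
  define z where "z = omega g ^ c / omega g ^ c'"
  have z1: "z \<noteq> 1" using ne omega_power_inj[OF c] by (auto simp: z_def)
  have zg: "z ^ g = 1"
    using g by (simp add: z_def power_divide omega_power_root)
  have n0: "cmod (b 0) = 1" using norm_phases[OF M, of b g 0] b g by (auto simp: nbhd_def)
  have d: "cmod (b 1 - b 0 * omega g ^ c) \<le> \<delta>" "cmod (b 1 - b 0 * omega g ^ c') \<le> \<delta>"
    using b g by (auto simp: nbhd_def dest!: spec[of _ 1])
  have "b 0 * omega g ^ c' * (z - 1) = (b 1 - b 0 * omega g ^ c') - (b 1 - b 0 * omega g ^ c)"
    by (simp add: z_def field_simps)
  from arg_cong[OF this, of cmod]
  have "cmod (z - 1) = cmod ((b 1 - b 0 * omega g ^ c') - (b 1 - b 0 * omega g ^ c))"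
    by (simp add: norm_mult norm_power n0)
  also have "\<dots> \<le> 2 * \<delta>"
    using norm_triangle_ineq4[of "b 1 - b 0 * omega g ^ c'" "b 1 - b 0 * omega g ^ c"] d by linarith
  also have "\<dots> < 1 / real g" by (rule \<delta>)
  finally show False using root_unity_far[OF _ zg z1] g by simp
qed

text \<open>Contrapositive of \<open>near_character\<close>; the constant 18 g^3 comes from solving
  3 g sqrt(2 g e) = \<open>\<delta>\<close> for \<open>e\<close>.\<close>

lemma shift_corr_remote:
  assumes g: "g \<ge> 2" and M: "M > 0" and \<delta>: "0 < \<delta>" "\<delta> \<le> 1"
    and b: "b \<in> phases g M" and far: "\<And>c. c < g \<Longrightarrow> b \<notin> nbhd g M \<delta> c"
  shows "shift_corr g b \<le> 1 - \<delta>\<^sup>2 / (18 * real g ^ 3)"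
proof (rule ccontr)
  assume "\<not> ?thesis"
  then have r: "shift_corr g b \<ge> 1 - \<delta>\<^sup>2 / (18 * real g ^ 3)" by simp
  define e where "e = \<delta>\<^sup>2 / (18 * real g ^ 3)"
  have e0: "e \<ge> 0" by (simp add: e_def)
  have g1: "real g \<ge> 1" using g by simp
  have ge: "real g * e = \<delta>\<^sup>2 / (18 * (real g)\<^sup>2)"
    using g by (simp add: e_def power3_eq_cube power2_eq_square)
  have "\<delta>\<^sup>2 \<le> 1" using \<delta> by (simp add: power_le_one)
  moreover have "(real g)\<^sup>2 \<ge> 1" using g1 by simp
  ultimately have "\<delta>\<^sup>2 < 18 * (real g)\<^sup>2" by linarith
  then have ge1: "real g * e < 1" unfolding ge using g by (simp add: divide_less_eq)
  have "2 * real g * e = (\<delta> / (3 * real g))\<^sup>2"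
    using ge by (simp add: power_divide power_mult_distrib)
  then have "3 * real g * sqrt (2 * real g * e) = \<delta>"
    using \<delta> g by (simp add: real_sqrt_abs)
  moreover have "\<exists>c<g. \<forall>a<g. cmod (b a - b 0 * omega g ^ (c * a)) \<le> 3 * real g * sqrt (2 * real g * e)"
    by (rule near_character) (use g e0 ge1 r norm_phases[OF M b] in \<open>auto simp: e_def\<close>)
  ultimately show False using far b by (auto simp: nbhd_def)
qed

lemma power_le_exp_of_square:
  assumes "(cmod z)\<^sup>2 \<le> 1 - x"
  shows "cmod z ^ N \<le> exp (- (real N * x / 2))"
proof -
  have "(cmod z)\<^sup>2 \<le> exp (- x)" using assms exp_ge_add_one_self[of "-x"] by linarith
  also have "\<dots> = (exp (- x / 2))\<^sup>2" by (simp flip: exp_double)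
  finally have "cmod z \<le> exp (- x / 2)" by (rule power2_le_imp_le) simp
  then have "cmod z ^ N \<le> exp (- x / 2) ^ N" by (intro power_mono) auto
  then show ?thesis by (simp add: exp_of_nat_mult[symmetric])
qed

text \<open>One remote pair makes the whole term small, whatever the other pairs do. The denominator
  36 g^4 is the 18 g^3 of \<open>shift_corr_remote\<close>, times g from \<open>phi_far\<close>,
  times 2 for passing from the squared modulus to the modulus.\<close>

lemma phi_remote:
  assumes g: "g \<ge> 2" and M: "M > 0" and \<delta>: "0 < \<delta>" "\<delta> \<le> 1"
    and W: "W \<in> pairs k \<rightarrow>\<^sub>E phases g M" and p: "p \<in> pairs k"
    and far: "\<And>c. c < g \<Longrightarrow> W p \<notin> nbhd g M \<delta> c"
  shows "cmod (phi g k W) ^ N \<le> exp (- (real N * \<delta>\<^sup>2 / (36 * real g ^ 4)))"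
proof -
  have Wp: "W p \<in> phases g M" using W p by auto
  have "(cmod (phi g k W))\<^sup>2 \<le> 1 - (1 - shift_corr g (W p)) / real g"
  proof (rule phi_far)
    show "cmod (W q a) = 1" if "q \<in> pairs k" "a < g" for q a
      using norm_phases[OF M _ that(2), of "W q"] W that by auto
  qed (use g p in auto)
  also have "\<dots> \<le> 1 - (\<delta>\<^sup>2 / (18 * real g ^ 3)) / real g"
    using shift_corr_remote[OF g M \<delta> Wp far] by (intro diff_left_mono divide_right_mono) auto
  finally have "(cmod (phi g k W))\<^sup>2 \<le> 1 - (\<delta>\<^sup>2 / (18 * real g ^ 3)) / real g" .
  from power_le_exp_of_square[OF this, of N] show ?thesis
    by (simp add: power4_eq_xxxx power3_eq_cube mult_ac)
qed

lemma phi1_remote: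
  assumes g: "g \<ge> 2" and M: "M > 0" and \<delta>: "0 < \<delta>" "\<delta> \<le> 1"
    and b: "b \<in> phases g M" and far: "\<And>c. c < g \<Longrightarrow> b \<notin> nbhd g M \<delta> c"
  shows "cmod (phi1 g b) ^ N \<le> exp (- (real N * \<delta>\<^sup>2 / (36 * real g ^ 4)))"
proof -
  have "(cmod (phi1 g b))\<^sup>2 \<le> 1 - (1 - shift_corr g b) / real g"
    by (rule phi1_far) (use g b M norm_phases in auto)
  also have "\<dots> \<le> 1 - (\<delta>\<^sup>2 / (18 * real g ^ 3)) / real g"
    using shift_corr_remote[OF g M \<delta> b far] by (intro diff_left_mono divide_right_mono) auto
  finally have "(cmod (phi1 g b))\<^sup>2 \<le> 1 - (\<delta>\<^sup>2 / (18 * real g ^ 3)) / real g" .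
  from power_le_exp_of_square[OF this, of N] show ?thesis
    by (simp add: power4_eq_xxxx power3_eq_cube mult_ac)
qed

text \<open>A nontrivial character has mean zero, so only the approximation error is left.\<close>

lemma phi1_nontrivial:
  assumes g: "g > 0" and b: "b \<in> nbhd g M \<delta> c" and c: "c < g" "c \<noteq> 0"
  shows "cmod (phi1 g b) \<le> \<delta>"
proof -
  have "(\<Sum>a<g. (omega g ^ c) ^ a) = 0"
  proof (rule root_unity_sum)
    show "(omega g ^ c) ^ g = 1"
      by (rule omega_power_root[OF g])
    show "omega g ^ c \<noteq> 1" using c omega_power_eq_1 by simp
  qed
  then have "(\<Sum>a<g. b 0 * omega g ^ (c * a)) = 0"
    by (simp add: power_mult flip: sum_distrib_left)
  then have "of_nat g * phi1 g b = (\<Sum>a<g. b a - b 0 * omega g ^ (c * a))"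
    using g by (simp add: phi1_def sum_subtractf)
  from arg_cong[OF this, of cmod]
  have "real g * cmod (phi1 g b) = cmod (\<Sum>a<g. b a - b 0 * omega g ^ (c * a))"
    by (simp add: norm_mult)
  also have "\<dots> \<le> (\<Sum>a<g. \<delta>)"
    by (rule sum_norm_le) (use b in \<open>auto simp: nbhd_def\<close>)
  finally show ?thesis using g by simp
qed

section \<open>Flows\<close>

definition psi :: "nat \<Rightarrow> nat \<Rightarrow> (nat \<times> nat \<Rightarrow> nat) \<Rightarrow> (nat \<Rightarrow> nat) \<Rightarrow> complex" where
  "psi g k c x = (\<Prod>p\<in>pairs k. omega g ^ (c p * diff_mod g (x (fst p)) (x (snd p))))"

text \<open>
  \<^term>\<open>psi g k c x\<close> is the product of the characters $d \mapsto \omega^{c_{ij} d}$ at $d = x_i - x_j$; it is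
  identically 1 iff $c$, read as a $Z_g$-valued function on the oriented edges of the complete graph,
  satisfies flow conservation at every vertex.
\<close>

definition flows :: "nat \<Rightarrow> nat \<Rightarrow> (nat \<times> nat \<Rightarrow> nat) set" where
  "flows g k = {c \<in> pairs k \<rightarrow>\<^sub>E {..<g}. \<forall>x\<in>words g k. psi g k c x = 1}"

lemma finite_flows [simp]: "finite (flows g k)"
  unfolding flows_def by (simp add: finite_PiE)

text \<open>Orthogonality for a character of the group of words: if it differs from 1 at some
  \<open>y\<close>, translating all words by \<open>y\<close> multiplies the sum by that
  value.\<close>

lemma sum_psi:
  assumes g: "g > 0" and c: "c \<in> pairs k \<rightarrow>\<^sub>E {..<g}"
  shows "(\<Sum>x\<in>words g k. psi g k c x) = (if c \<in> flows g k then of_nat g ^ k else 0)"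
proof (cases "c \<in> flows g k")
  case True
  then have "(\<Sum>x\<in>words g k. psi g k c x) = (\<Sum>x\<in>words g k. 1)"
    by (intro sum.cong refl) (auto simp: flows_def)
  then show ?thesis using True by (simp add: card_words)
next
  case False
  then obtain y where y: "y \<in> words g k" "psi g k c y \<noteq> 1" using c by (auto simp: flows_def)
  define f where "f = (\<lambda>x. \<lambda>s\<in>{..<k}. (x s + y s) mod g)"
  have fw: "f x \<in> words g k" for x
    using g by (auto simp: f_def words_def)
  have inj: "inj_on f (words g k)"
  proof (rule inj_onI)
    fix x x' assume x: "x \<in> words g k" "x' \<in> words g k" and fx: "f x = f x'"
    show "x = x'"
    proof (rule PiE_ext[of _ "{..<k}" "\<lambda>_. {..<g}"])
      fix s assume s: "s \<in> {..<k}"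
      then have "(x s + y s) mod g = (x' s + y s) mod g" using fun_cong[OF fx, of s] by (simp add: f_def)
      from arg_cong[OF this, of int]
      have "(int (x s) + int (y s)) mod int g = (int (x' s) + int (y s)) mod int g"
        by (simp only: zmod_int of_nat_add)
      then have "int (x s) mod int g = int (x' s) mod int g" by (simp add: mod_eq_dvd_iff)
      moreover have "x s < g" "x' s < g" using x s by (auto simp: words_def)
      ultimately show "x s = x' s" by simp
    qed (use x in \<open>auto simp: words_def\<close>)
  qed
  have bij: "bij_betw f (words g k) (words g k)"
    unfolding bij_betw_def using inj fw by (intro conjI endo_inj_surj) auto
  have mult: "psi g k c (f x) = psi g k c x * psi g k c y" for x
    unfolding psi_def prod.distrib[symmetric]
  proof (rule prod.cong[OF refl])
    fix p assume p: "p \<in> pairs k"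
    then have ij: "fst p < k" "snd p < k" by (auto simp: pairs_def)
    have "omega g ^ diff_mod g (f x (fst p)) (f x (snd p))
       = omega g ^ diff_mod g (x (fst p)) (x (snd p)) * omega g ^ diff_mod g (y (fst p)) (y (snd p))"
      using ij by (simp add: omega_diff_mod[OF g] f_def omega_power_mod[OF g] power_add)
    moreover have "omega g ^ (c p * n) = (omega g ^ n) ^ c p" for n
      by (simp add: mult.commute flip: power_mult)
    ultimately show "omega g ^ (c p * diff_mod g (f x (fst p)) (f x (snd p)))
       = omega g ^ (c p * diff_mod g (x (fst p)) (x (snd p))) * omega g ^ (c p * diff_mod g (y (fst p)) (y (snd p)))"
      by (simp add: power_mult_distrib)
  qed
  have "(\<Sum>x\<in>words g k. psi g k c x) = (\<Sum>x\<in>words g k. psi g k c (f x))"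
    by (rule sum.reindex_bij_betw[OF bij, symmetric])
  also have "\<dots> = (\<Sum>x\<in>words g k. psi g k c x) * psi g k c y"
    by (simp add: mult sum_distrib_right)
  finally have "(\<Sum>x\<in>words g k. psi g k c x) * (1 - psi g k c y) = 0"
    by (simp add: algebra_simps)
  then show ?thesis using y False by simp
qed

text \<open>Sum \<^const>\<open>psi\<close> over all $c$ and $x$ in both orders: for fixed $x$ the sum vanishes unless $x$ is constant.\<close>

lemma card_flows:
  assumes g: "g > 0" and k: "k > 0"
  shows "card (flows g k) * g ^ k = g ^ (card (pairs k) + 1)"
proof -
  let ?C = "pairs k \<rightarrow>\<^sub>E {..<g}"
  let ?d = "\<lambda>x p. diff_mod g (x (fst p)) (x (snd p))"
  have fl: "flows g k \<subseteq> ?C" by (auto simp: flows_def)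
  have fC: "finite ?C" by (simp add: finite_PiE)
  have "(\<Sum>c\<in>?C. \<Sum>x\<in>words g k. psi g k c x) = (\<Sum>c\<in>?C. if c \<in> flows g k then of_nat g ^ k else 0)"
    by (intro sum.cong refl sum_psi g)
  also have "\<dots> = of_nat (card (flows g k) * g ^ k)"
    using fl fC by (simp add: sum.If_cases Int_absorb1)
  finally have 1: "(\<Sum>c\<in>?C. \<Sum>x\<in>words g k. psi g k c x) = of_nat (card (flows g k) * g ^ k)" .
  let ?E = "{x \<in> words g k. \<forall>p\<in>pairs k. ?d x p = 0}"
  have "(\<Sum>c\<in>?C. \<Sum>x\<in>words g k. psi g k c x) = (\<Sum>x\<in>words g k. \<Sum>c\<in>?C. psi g k c x)"
    by (rule sum.swap)
  also have "\<dots> = (\<Sum>x\<in>words g k. if \<forall>p\<in>pairs k. ?d x p = 0 then of_nat g ^ card (pairs k) else 0)"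
  proof (rule sum.cong[OF refl])
    fix x
    have "(\<Sum>c\<in>?C. psi g k c x) = (\<Prod>p\<in>pairs k. \<Sum>c<g. omega g ^ (c * ?d x p))"
      unfolding psi_def by (rule prod_sum_PiE[symmetric]) auto
    also have "\<dots> = (\<Prod>p\<in>pairs k. if ?d x p = 0 then of_nat g else 0)"
    proof (rule prod.cong[OF refl])
      fix p
      show "(\<Sum>c<g. omega g ^ (c * ?d x p)) = (if ?d x p = 0 then of_nat g else 0)"
      proof (cases "?d x p = 0")
        case False
        have "(\<Sum>c<g. (omega g ^ ?d x p) ^ c) = 0"
        proof (rule root_unity_sum)
          show "(omega g ^ ?d x p) ^ g = 1"
            by (rule omega_power_root[OF g])
          show "omega g ^ ?d x p \<noteq> 1" using False omega_power_eq_1[OF diff_mod_less[OF g]] by simp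
        qed
        then show ?thesis using False by (simp add: power_mult[symmetric] mult.commute)
      qed simp
    qed
    also have "\<dots> = (if \<forall>p\<in>pairs k. ?d x p = 0 then of_nat g ^ card (pairs k) else 0)"
    proof (cases "\<forall>p\<in>pairs k. ?d x p = 0")
      case True
      then have "(\<Prod>p\<in>pairs k. if ?d x p = 0 then of_nat g else (0::complex)) = (\<Prod>p\<in>pairs k. of_nat g)"
        by (intro prod.cong refl) simp
      then show ?thesis using True by simp
    next
      case False
      then obtain p where "p \<in> pairs k" "?d x p \<noteq> 0" by blast
      then have "(\<Prod>p\<in>pairs k. if ?d x p = 0 then of_nat g else (0::complex)) = 0"
        by (intro prod_zero bexI[of _ p]) simp_all
      with False show ?thesis by (simp only: if_False)
    qed
    finally show "(\<Sum>c\<in>?C. psi g k c x) = (if \<forall>p\<in>pairs k. ?d x p = 0 then of_nat g ^ card (pairs k) else 0)" .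
  qed
  also have "\<dots> = of_nat (card ?E * g ^ card (pairs k))"
    by (subst sum.inter_filter[symmetric]) simp_all
  also have "card ?E = g"
  proof -
    have dz: "diff_mod g a b = 0 \<longleftrightarrow> a = b" if "a < g" "b < g" for a b
    proof -
      have "diff_mod g a b = 0 \<longleftrightarrow> int a mod int g = int b mod int g"
        by (simp add: diff_mod_eq_iff[OF g] mod_eq_dvd_iff mod_eq_0_iff_dvd)
      then show ?thesis using that by simp
    qed
    have "?E = (\<lambda>a. \<lambda>s\<in>{..<k}. a) ` {..<g}"
    proof (intro set_eqI iffI)
      fix x assume x: "x \<in> ?E"
      have eq: "x s = x 0" if s: "s < k" for s
      proof (cases "s = 0")
        case False
        then have "(0, s) \<in> pairs k" using s by (simp add: pairs_def)
        moreover have "\<forall>p\<in>pairs k. ?d x p = 0" using x by simp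
        ultimately have "?d x (0, s) = 0" by (rule bspec[rotated])
        then have "diff_mod g (x 0) (x s) = 0" by simp
        moreover have "x 0 < g" "x s < g" using x s k by (auto simp: words_def PiE_iff)
        ultimately show ?thesis using dz[of "x 0" "x s"] by simp
      qed simp
      have "x = (\<lambda>s\<in>{..<k}. x 0)"
      proof
        fix s
        show "x s = (\<lambda>s\<in>{..<k}. x 0) s"
          using eq[of s] x by (cases "s < k") (simp_all add: words_def PiE_iff extensional_def)
      qed
      moreover have "x 0 < g" using x k by (auto simp: words_def PiE_iff)
      ultimately show "x \<in> (\<lambda>a. \<lambda>s\<in>{..<k}. a) ` {..<g}" by blast
    next
      fix x assume "x \<in> (\<lambda>a. \<lambda>s\<in>{..<k}. a) ` {..<g}"
      then show "x \<in> ?E" using dz by (auto simp: words_def pairs_def split: if_splits)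
    qed
    moreover have "inj_on (\<lambda>a. \<lambda>s\<in>{..<k}. a) {..<g}"
      using k by (intro inj_onI) (auto dest: fun_cong[of _ _ 0])
    ultimately show ?thesis by (simp add: card_image)
  qed
  finally have "of_nat (card (flows g k) * g ^ k) = (of_nat (g * g ^ card (pairs k)) :: complex)"
    unfolding 1 .
  then show ?thesis unfolding of_nat_eq_iff by simp
qed

text \<open>Replacing each \<open>W p\<close> by its exact multiple of a character costs at most
  \<open>\<delta>\<close> per pair, since all factors are unimodular. The exact average vanishes by
  \<open>sum_psi\<close>.\<close>

lemma phi_nonflow:
  assumes g: "g > 0" and M: "M > 0" and c: "c \<in> pairs k \<rightarrow>\<^sub>E {..<g}" "c \<notin> flows g k"
    and W: "\<And>p. p \<in> pairs k \<Longrightarrow> W p \<in> nbhd g M \<delta> (c p)"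
  shows "cmod (phi g k W) \<le> real (card (pairs k)) * \<delta>"
proof -
  let ?d = "\<lambda>x p. diff_mod g (x (fst p)) (x (snd p))"
  have nW: "cmod (W p a) = 1" if "p \<in> pairs k" "a < g" for p a
    using norm_phases[OF M _ that(2), of "W p"] W[OF that(1)] by (simp add: nbhd_def)
  have "(\<Sum>x\<in>words g k. \<Prod>p\<in>pairs k. W p 0 * omega g ^ (c p * ?d x p)) = (\<Prod>p\<in>pairs k. W p 0) * (\<Sum>x\<in>words g k. psi g k c x)"
    by (simp add: prod.distrib psi_def sum_distrib_left)
  also have "\<dots> = 0" using sum_psi[OF g c(1)] c(2) by simp
  finally have "of_nat g ^ k * phi g k W = (\<Sum>x\<in>words g k. (\<Prod>p\<in>pairs k. W p (?d x p)) - (\<Prod>p\<in>pairs k. W p 0 * omega g ^ (c p * ?d x p)))"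
    using g by (simp add: phi_def sum_subtractf)
  from arg_cong[OF this, of cmod]
  have "real g ^ k * cmod (phi g k W) = cmod (\<Sum>x\<in>words g k. (\<Prod>p\<in>pairs k. W p (?d x p)) - (\<Prod>p\<in>pairs k. W p 0 * omega g ^ (c p * ?d x p)))"
    by (simp add: norm_mult norm_power)
  also have "\<dots> \<le> (\<Sum>x\<in>words g k. real (card (pairs k)) * \<delta>)"
  proof (rule sum_norm_le)
    fix x
    have "cmod ((\<Prod>p\<in>pairs k. W p (?d x p)) - (\<Prod>p\<in>pairs k. W p 0 * omega g ^ (c p * ?d x p)))
       \<le> (\<Sum>p\<in>pairs k. cmod (W p (?d x p) - W p 0 * omega g ^ (c p * ?d x p)))"
      by (rule norm_prod_diff) (use g in \<open>simp_all add: nW diff_mod_less norm_mult norm_power\<close>)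
    also have "\<dots> \<le> (\<Sum>p\<in>pairs k. \<delta>)"
      using W diff_mod_less[OF g] by (intro sum_mono) (auto simp: nbhd_def)
    finally show "cmod ((\<Prod>p\<in>pairs k. W p (?d x p)) - (\<Prod>p\<in>pairs k. W p 0 * omega g ^ (c p * ?d x p))) \<le> real (card (pairs k)) * \<delta>"
      by simp
  qed
  also have "\<dots> = real g ^ k * (real (card (pairs k)) * \<delta>)" by (simp add: card_words)
  finally show ?thesis using g by simp
qed

text \<open>Up to sign the exponent of \<open>omega g\<close> is c lam g (g - 1) / 2. It is a
  multiple of g because g - 1 is even when g is odd, and lam is even when g is even.\<close>

lemma chi_character:
  assumes g: "g > 0" and par: "even g \<Longrightarrow> even lam"
  shows "(\<Prod>a<g. inverse (omega g ^ (c * a)) ^ lam) = 1"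
proof -
  have "(\<Prod>a<g. omega g ^ (c * a)) = omega g ^ (c * (\<Sum>a<g. a))"
    by (simp add: power_sum sum_distrib_left)
  moreover have "omega g ^ (c * (\<Sum>a<g. a) * lam) = 1"
  proof -
    have "2 * (\<Sum>a<g. a) = g * (g - 1)"
    proof (induction g)
      case (Suc n)
      then show ?case by (cases n) (auto simp: algebra_simps)
    qed simp
    then have "g dvd (\<Sum>a<g. a) * lam"
    proof (cases "even g")
      case True
      then obtain h where "lam = 2 * h" using par by (auto elim: evenE)
      then have "(\<Sum>a<g. a) * lam = (2 * (\<Sum>a<g. a)) * h" by simp
      also have "\<dots> = g * ((g - 1) * h)" unfolding \<open>2 * (\<Sum>a<g. a) = g * (g - 1)\<close> by simp
      finally show ?thesis by simp
    next
      case False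
      then obtain h where h: "g - 1 = 2 * h" by (auto elim!: oddE)
      then have "(\<Sum>a<g. a) = g * h" using \<open>2 * (\<Sum>a<g. a) = g * (g - 1)\<close> by simp
      then show ?thesis by simp
    qed
    then obtain q where "(\<Sum>a<g. a) * lam = g * q" by (rule dvdE)
    then have "c * (\<Sum>a<g. a) * lam = g * (c * q)" by simp
    then show ?thesis unfolding power_mult[of _ g] by (simp only: omega_power_g[OF g] power_mult power_one)
  qed
  ultimately have "(\<Prod>a<g. omega g ^ (c * a)) ^ lam = 1" by (simp add: power_mult)
  then have "inverse ((\<Prod>a<g. omega g ^ (c * a)) ^ lam) = 1" by simp
  then show ?thesis
    by (simp only: power_inverse[symmetric] prod_inversef[symmetric] prod_power_distrib o_def)
qed

text \<open>Multiplying by the characters of the flow carries one product of neighbourhoods onto the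
  other: \<open>g dvd M\<close> keeps the values among the M-th roots of unity, the flow condition
  leaves \<open>phi\<close> unchanged, and the parity condition leaves \<open>chi\<close>
  unchanged.\<close>

lemma flow_shift:
  assumes g: "g > 0" and M: "M > 0" "g dvd M" and par: "even g \<Longrightarrow> even lam"
    and c: "c \<in> flows g k"
  shows "(\<Sum>W\<in>(\<Pi>\<^sub>E p\<in>pairs k. nbhd g M \<delta> (c p)). phi g k W ^ N * (\<Prod>p\<in>pairs k. chi g lam (W p)))
    = (\<Sum>W\<in>(\<Pi>\<^sub>E p\<in>pairs k. nbhd g M \<delta> 0). phi g k W ^ N * (\<Prod>p\<in>pairs k. chi g lam (W p)))"
proof -
  let ?d = "\<lambda>x p. diff_mod g (x (fst p)) (x (snd p))"
  define f where "f = (\<lambda>W. \<lambda>p\<in>pairs k. \<lambda>a\<in>{..<g}. W p a * omega g ^ (c p * a))"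
  define h where "h = (\<lambda>W. \<lambda>p\<in>pairs k. \<lambda>a\<in>{..<g}. W p a / omega g ^ (c p * a))"
  have omnM: "(omega g ^ n) ^ M = 1" for n
  proof -
    obtain q where "M = g * q" using M(2) by (rule dvdE)
    then show ?thesis by (simp only: power_mult omega_power_root[OF g] power_one)
  qed
  have up: "(\<lambda>a\<in>{..<g}. b a * omega g ^ (e * a)) \<in> nbhd g M \<delta> e" if b: "b \<in> nbhd g M \<delta> 0" for b e
  proof -
    have "b a * omega g ^ (e * a) - b 0 * omega g ^ (e * a) = (b a - b 0) * omega g ^ (e * a)" for a
      by (simp add: algebra_simps)
    then show ?thesis using b g
      by (auto simp: nbhd_def phases_def unity_def power_mult_distrib omnM norm_mult norm_power PiE_iff)
  qed
  have down: "(\<lambda>a\<in>{..<g}. b a / omega g ^ (e * a)) \<in> nbhd g M \<delta> 0" if b: "b \<in> nbhd g M \<delta> e" for b e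
  proof -
    have eq: "b a / omega g ^ (e * a) - b 0 = (b a - b 0 * omega g ^ (e * a)) / omega g ^ (e * a)" for a
      by (simp add: field_simps)
    have "cmod (b a / omega g ^ (e * a) - b 0) \<le> \<delta>" if "a < g" for a
      unfolding eq using b that by (simp add: nbhd_def norm_divide norm_power)
    then show ?thesis using b g
      by (auto simp: nbhd_def phases_def unity_def power_divide omnM PiE_iff)
  qed
  have bij: "bij_betw f (\<Pi>\<^sub>E p\<in>pairs k. nbhd g M \<delta> 0) (\<Pi>\<^sub>E p\<in>pairs k. nbhd g M \<delta> (c p))"
  proof (rule bij_betw_byWitness[where f' = h])
    \<comment> \<open>Outside \<open>pairs k\<close>, and at arguments not below g, the functions
      have the default value \<open>undefined\<close>; \<open>restrict\<close> in \<open>f\<close>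
      and \<open>h\<close> has to reproduce it for the two maps to be mutually inverse.\<close>
    have und: "b a = undefined" if "b \<in> nbhd g M \<delta> e" "\<not> a < g" for b e a
      using that by (auto simp: nbhd_def phases_def PiE_iff extensional_def)
    show "\<forall>W\<in>\<Pi>\<^sub>E p\<in>pairs k. nbhd g M \<delta> 0. h (f W) = W"
    proof
      fix W assume W: "W \<in> (\<Pi>\<^sub>E p\<in>pairs k. nbhd g M \<delta> 0)"
      show "h (f W) = W"
      proof (rule ext)+
        fix p a
        show "h (f W) p a = W p a"
          using W und[of "W p" 0 a] PiE_arb[OF W, of p] by (auto simp: h_def f_def PiE_iff extensional_def)
      qed
    qed
    show "\<forall>W\<in>\<Pi>\<^sub>E p\<in>pairs k. nbhd g M \<delta> (c p). f (h W) = W"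
    proof
      fix W assume W: "W \<in> (\<Pi>\<^sub>E p\<in>pairs k. nbhd g M \<delta> (c p))"
      show "f (h W) = W"
      proof (rule ext)+
        fix p a
        show "f (h W) p a = W p a"
          using W und[of "W p" "c p" a] PiE_arb[OF W, of p] by (auto simp: h_def f_def PiE_iff extensional_def)
      qed
    qed
    show "f ` (\<Pi>\<^sub>E p\<in>pairs k. nbhd g M \<delta> 0) \<subseteq> (\<Pi>\<^sub>E p\<in>pairs k. nbhd g M \<delta> (c p))"
      using up by (auto simp: f_def PiE_iff)
    show "h ` (\<Pi>\<^sub>E p\<in>pairs k. nbhd g M \<delta> (c p)) \<subseteq> (\<Pi>\<^sub>E p\<in>pairs k. nbhd g M \<delta> 0)"
      using down by (auto simp: h_def PiE_iff)
  qed
  have phi: "phi g k (f W) = phi g k W" for W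
  proof -
    have "(\<Prod>p\<in>pairs k. f W p (?d x p)) = (\<Prod>p\<in>pairs k. W p (?d x p))" if x: "x \<in> words g k" for x
    proof -
      have "(\<Prod>p\<in>pairs k. f W p (?d x p)) = (\<Prod>p\<in>pairs k. W p (?d x p)) * psi g k c x"
        unfolding psi_def prod.distrib[symmetric]
        by (intro prod.cong refl) (simp add: f_def diff_mod_less g)
      then show ?thesis using c x by (simp add: flows_def)
    qed
    then show ?thesis by (simp add: phi_def)
  qed
  have chi: "chi g lam (f W p) = chi g lam (W p)" if "p \<in> pairs k" for W p
  proof -
    have "chi g lam (f W p) = (\<Prod>a<g. inverse (W p a) ^ lam * inverse (omega g ^ (c p * a)) ^ lam)"
      unfolding chi_def using that
      by (intro prod.cong refl) (simp add: f_def power_mult_distrib)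
    moreover have "(\<Prod>a<g. inverse (omega g ^ (c p * a)) ^ lam) = 1"
      by (rule chi_character[OF g]) (rule par)
    ultimately show ?thesis
      unfolding prod.distrib by (simp add: chi_def)
  qed
  show ?thesis
    by (subst sum.reindex_bij_betw[OF bij, symmetric]) (simp add: phi chi)
qed

section \<open>Comparison with independent pairs\<close>

definition term1 :: "nat \<Rightarrow> nat \<Rightarrow> (nat \<Rightarrow> complex) \<Rightarrow> complex" where
  "term1 g lam b = phi1 g b ^ (g * lam) * chi g lam b"

definition termk :: "nat \<Rightarrow> nat \<Rightarrow> nat \<Rightarrow> (nat \<times> nat \<Rightarrow> nat \<Rightarrow> complex) \<Rightarrow> complex" where
  "termk g k lam W = phi g k W ^ (g * lam) * (\<Prod>p\<in>pairs k. chi g lam (W p))"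

lemma norm_chi: "M > 0 \<Longrightarrow> b \<in> phases g M \<Longrightarrow> cmod (chi g lam b) = 1"
  unfolding chi_def prod_norm[symmetric]
  by (intro prod.neutral) (auto simp: norm_power norm_inverse norm_phases)

text \<open>A common phase is split off so that the angles have mean zero. The chord bound gives
  angles up to 2 \<open>\<delta>\<close> relative to \<open>b 0\<close>, and subtracting their mean
  costs another 2 \<open>\<delta>\<close>.\<close>

lemma nbhd_angles:
  assumes g: "g > 0" and M: "M > 0" and b: "b \<in> nbhd g M \<delta> 0"
  shows "\<exists>u h. cmod u = 1 \<and> (\<forall>a<g. b a = u * cis (h a)) \<and> (\<Sum>a<g. h a) = 0 \<and> (\<forall>a<g. \<bar>h a\<bar> \<le> 4 * \<delta>)"
proof -
  have bn: "cmod (b a) = 1" if "a < g" for a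
    using norm_phases[OF M _ that] b by (simp add: nbhd_def)
  have b0: "b 0 \<noteq> 0" using bn[of 0] g by auto
  define \<theta> where "\<theta> = (\<lambda>a. Arg (b a / b 0))"
  have \<theta>: "b a = b 0 * cis (\<theta> a)" if "a < g" for a
  proof -
    have n: "cmod (b a / b 0) = 1" using bn[OF that] bn[of 0] g by (simp add: norm_divide)
    then have "b a / b 0 \<noteq> 0" by auto
    then have "cis (\<theta> a) = b a / b 0"
      using n by (simp add: \<theta>_def cis_Arg sgn_eq)
    then show ?thesis using b0 by simp
  qed
  have \<theta>b: "\<bar>\<theta> a\<bar> \<le> 2 * \<delta>" if a: "a < g" for a
  proof -
    have "\<bar>\<theta> a\<bar> \<le> pi" unfolding \<theta>_def using Arg_bounded[of "b a / b 0"] by auto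
    then have "\<bar>\<theta> a\<bar> \<le> 2 * cmod (cis (\<theta> a) - 1)" by (rule abs_le_norm_cis)
    also have "cmod (cis (\<theta> a) - 1) = cmod (b 0 * (cis (\<theta> a) - 1))"
      using bn[of 0] g by (simp add: norm_mult)
    also have "b 0 * (cis (\<theta> a) - 1) = b a - b 0"
      using \<theta>[OF a] by (simp add: algebra_simps)
    also have "cmod (b a - b 0) \<le> \<delta>" using b a by (auto simp: nbhd_def)
    finally show ?thesis by simp
  qed
  define m where "m = (\<Sum>a<g. \<theta> a) / real g"
  have "\<bar>\<Sum>a<g. \<theta> a\<bar> \<le> (\<Sum>a<g. \<bar>\<theta> a\<bar>)" by (rule sum_abs)
  also have "\<dots> \<le> (\<Sum>a<g. 2 * \<delta>)" by (rule sum_mono) (simp add: \<theta>b)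
  finally have mb: "\<bar>m\<bar> \<le> 2 * \<delta>" using g by (simp add: m_def abs_divide field_simps)
  show ?thesis
  proof (intro exI conjI allI impI)
    show "cmod (b 0 * cis m) = 1" using bn[of 0] g by (simp add: norm_mult)
    show "b a = b 0 * cis m * cis (\<theta> a - m)" if "a < g" for a
      using \<theta>[OF that] by (simp add: cis_mult mult.assoc)
    show "(\<Sum>a<g. \<theta> a - m) = 0" using g by (simp add: sum_subtractf m_def)
    show "\<bar>\<theta> a - m\<bar> \<le> 4 * \<delta>" if "a < g" for a
      using \<theta>b[OF that] mb by linarith
  qed
qed

lemma chi_angles:
  assumes "\<And>a. a < g \<Longrightarrow> b a = u * cis (h a)" "(\<Sum>a<g. h a) = 0"
  shows "chi g lam b = inverse u ^ (g * lam)"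
proof -
  have "chi g lam b = (\<Prod>a<g. inverse u ^ lam * cis (- h a) ^ lam)"
    unfolding chi_def using assms(1)
    by (intro prod.cong refl) (simp add: power_mult_distrib cis_inverse)
  also have "\<dots> = inverse u ^ (g * lam) * cis (\<Sum>a<g. - h a) ^ lam"
    by (simp add: prod.distrib prod_cis flip: prod_power_distrib power_mult) (simp add: mult.commute)
  also have "(\<Sum>a<g. - h a) = 0" using assms(2) by (simp add: sum_negf)
  finally show ?thesis by simp
qed

text \<open>The word length is exactly g lam, so the common phase cancels between
  \<open>phi1\<close> and \<open>chi\<close>; the mean-zero angles leave nothing else in
  \<open>chi\<close>.\<close>

lemma term1_angles:
  assumes g: "g > 0" and u: "cmod u = 1" and b: "\<And>a. a < g \<Longrightarrow> b a = u * cis (h a)" and h: "(\<Sum>a<g. h a) = 0"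
  shows "term1 g lam b = phi1 g (\<lambda>a. cis (h a)) ^ (g * lam)"
proof -
  have "phi1 g b = u * phi1 g (\<lambda>a. cis (h a))"
    using b by (simp add: phi1_def sum_distrib_left)
  moreover have "u \<noteq> 0" using u by auto
  ultimately show ?thesis
    using chi_angles[OF b h, of lam] by (simp add: term1_def power_mult_distrib power_inverse)
qed

lemma termk_angles:
  assumes g: "g > 0" and u: "\<And>p. p \<in> pairs k \<Longrightarrow> cmod (u p) = 1"
    and W: "\<And>p a. p \<in> pairs k \<Longrightarrow> a < g \<Longrightarrow> W p a = u p * cis (h p a)"
    and h: "\<And>p. p \<in> pairs k \<Longrightarrow> (\<Sum>a<g. h p a) = 0"
  shows "termk g k lam W = phi g k (\<lambda>p a. cis (h p a)) ^ (g * lam)"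
proof -
  have "phi g k W = (\<Prod>p\<in>pairs k. u p) * phi g k (\<lambda>p a. cis (h p a))"
    unfolding phi_def times_divide_eq_right sum_distrib_left prod.distrib[symmetric]
    using W diff_mod_less[OF g] by (intro arg_cong2[of _ _ _ _ "(/)"] sum.cong prod.cong refl) auto
  moreover have "(\<Prod>p\<in>pairs k. chi g lam (W p)) = inverse (\<Prod>p\<in>pairs k. u p) ^ (g * lam)"
  proof -
    have "(\<Prod>p\<in>pairs k. chi g lam (W p)) = (\<Prod>p\<in>pairs k. inverse (u p) ^ (g * lam))"
      by (intro prod.cong refl chi_angles[where h = "h _"]) (auto simp: W h)
    also have "\<dots> = inverse (\<Prod>p\<in>pairs k. u p) ^ (g * lam)"
      unfolding prod_power_distrib[symmetric] prod_inversef[symmetric] o_def ..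
    finally show ?thesis .
  qed
  moreover have "(\<Prod>p\<in>pairs k. u p) \<noteq> 0" using u by fastforce
  ultimately show ?thesis by (simp add: termk_def power_mult_distrib power_inverse)
qed

lemma var1_bounds:
  assumes g: "g > 0" and h: "\<And>a. a < g \<Longrightarrow> \<bar>h a\<bar> \<le> \<eta>"
  shows "0 \<le> var1 g h" "var1 g h \<le> \<eta>\<^sup>2"
proof -
  show "0 \<le> var1 g h" by (simp add: var1_def sum_nonneg)
  have "(\<Sum>a<g. (h a)\<^sup>2) \<le> (\<Sum>a<g. \<eta>\<^sup>2)"
  proof (rule sum_mono)
    fix a assume "a \<in> {..<g}"
    then have "\<bar>h a\<bar>\<^sup>2 \<le> \<eta>\<^sup>2" using h by (intro power_mono) auto
    then show "(h a)\<^sup>2 \<le> \<eta>\<^sup>2" by simp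
  qed
  then show "var1 g h \<le> \<eta>\<^sup>2" using g by (simp add: var1_def field_simps)
qed

text \<open>
  The phase of a near-trivial term is of third order, so that $\sum |f|$ and $\sum f$ agree up to a
  factor $1 + o(1/\binom k2)$; this is what makes the product error bound survive $\binom k2$-th powers.
\<close>

lemma term1_near_positive:
  assumes g: "g > 0" and M: "M > 0" and b: "b \<in> nbhd g M \<delta> 0"
    and \<delta>: "0 \<le> \<delta>" "4 * \<delta> \<le> 1 / 2" "4 * real (g * lam) * (4 * \<delta>) ^ 3 \<le> 1"
  shows "cmod (term1 g lam b - of_real (cmod (term1 g lam b))) \<le> 8 * real (g * lam) * (4 * \<delta>) ^ 3 * cmod (term1 g lam b)"
proof -
  define \<eta> where "\<eta> = 4 * \<delta>"
  define N where "N = g * lam"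
  obtain u h where uh: "cmod u = 1" "\<And>a. a < g \<Longrightarrow> b a = u * cis (h a)" "(\<Sum>a<g. h a) = 0"
    "\<And>a. a < g \<Longrightarrow> \<bar>h a\<bar> \<le> \<eta>"
    using nbhd_angles[OF g M b] unfolding \<eta>_def by blast
  define w where "w = phi1 g (\<lambda>a. cis (h a))"
  define r where "r = 1 - var1 g h / 2"
  have \<eta>: "0 \<le> \<eta>" "\<eta> \<le> 1 / 2" using \<delta> by (auto simp: \<eta>_def)
  have v: "0 \<le> var1 g h" "var1 g h \<le> \<eta>\<^sup>2" using var1_bounds[OF g uh(4)] by auto
  have \<eta>2: "\<eta>\<^sup>2 \<le> 1 / 4" using power_mono[OF \<eta>(2,1), of 2] by (simp add: power_divide)
  have \<eta>3: "\<eta> ^ 3 \<le> 1 / 8" using power_mono[OF \<eta>(2,1), of 3] by (simp add: power_divide)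
  have wr: "cmod (w - of_real r) \<le> \<eta> ^ 3"
    unfolding w_def r_def by (rule phi1_near[OF g uh(3,4)])
  have r: "r \<ge> 7 / 8" using v \<eta>2 by (simp add: r_def)
  have "\<bar>r - cmod w\<bar> \<le> \<eta> ^ 3"
    using norm_triangle_ineq3[of w "of_real r"] wr r by (simp add: abs_minus_commute)
  \<comment> \<open>This lower bound turns the absolute error of third order into a relative one, as
    \<open>power_close\<close> requires.\<close>
  then have w: "cmod w \<ge> 1 / 2" using r \<eta>3 by linarith
  have "cmod (w - of_real (cmod w)) \<le> cmod (w - of_real r) + cmod (of_real r - of_real (cmod w))"
    using norm_triangle_ineq[of "w - of_real r" "of_real r - of_real (cmod w)"] by simp
  also have "cmod (of_real r - of_real (cmod w)) = \<bar>r - cmod w\<bar>"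
    by (metis norm_of_real of_real_diff)
  also have "cmod (w - of_real r) + \<bar>r - cmod w\<bar> \<le> 2 * \<eta> ^ 3"
    using wr \<open>\<bar>r - cmod w\<bar> \<le> \<eta> ^ 3\<close> by linarith
  also have "\<dots> \<le> 4 * \<eta> ^ 3 * cmod w"
    using mult_left_mono[OF w, of "4 * \<eta> ^ 3"] \<eta> by simp
  finally have "cmod (w - of_real (cmod w)) \<le> 4 * \<eta> ^ 3 * cmod (of_real (cmod w))"
    by simp
  then have "cmod (w ^ N - of_real (cmod w) ^ N) \<le> 2 * real N * (4 * \<eta> ^ 3) * cmod (of_real (cmod w)) ^ N"
    by (rule power_close) (use \<delta> \<eta> in \<open>simp_all add: \<eta>_def N_def\<close>)
  moreover have "term1 g lam b = w ^ N"
    unfolding w_def N_def by (rule term1_angles[OF g uh(1,2,3)])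
  ultimately show ?thesis by (simp add: norm_power N_def \<eta>_def)
qed

text \<open>Both \<open>F\<close> and \<open>P\<close> are 1 minus half the total variance up to
  third order. With y = K \<open>\<eta>\<close> there are three errors of size y^3: the cubic term
  of \<open>phi\<close>, the quadratic remainder of the product, and the sum of the single-pair
  cubic terms. As |P| >= 1/2, the relative error is 6 y^3, and \<open>power_close\<close> multiplies
  it by 2 N.\<close>

lemma termk_near_product:
  assumes g: "g > 0" and M: "M > 0" and k: "k \<ge> 2"
    and W: "\<And>p. p \<in> pairs k \<Longrightarrow> W p \<in> nbhd g M \<delta> 0"
    and K: "K = real (card (pairs k))"
    and \<delta>: "0 \<le> \<delta>" "K * (4 * \<delta>) \<le> 1 / 2" "6 * real (g * lam) * (K * (4 * \<delta>)) ^ 3 \<le> 1"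
  shows "cmod (termk g k lam W - (\<Prod>p\<in>pairs k. term1 g lam (W p)))
      \<le> 12 * real (g * lam) * (K * (4 * \<delta>)) ^ 3 * (\<Prod>p\<in>pairs k. cmod (term1 g lam (W p)))"
proof -
  define \<eta> where "\<eta> = 4 * \<delta>"
  define N where "N = g * lam"
  have "\<exists>uh. \<forall>p\<in>pairs k. cmod (fst (uh p)) = 1 \<and> (\<forall>a<g. W p a = fst (uh p) * cis (snd (uh p) a)) \<and>
     (\<Sum>a<g. snd (uh p) a) = 0 \<and> (\<forall>a<g. \<bar>snd (uh p) a\<bar> \<le> \<eta>)"
  proof (rule bchoice, rule ballI)
    fix p assume "p \<in> pairs k"
    then show "\<exists>y. cmod (fst y) = 1 \<and> (\<forall>a<g. W p a = fst y * cis (snd y a)) \<and>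
        (\<Sum>a<g. snd y a) = 0 \<and> (\<forall>a<g. \<bar>snd y a\<bar> \<le> \<eta>)"
      using nbhd_angles[OF g M W[of p]] unfolding \<eta>_def by auto
  qed
  then obtain uh where uh: "\<And>p. p \<in> pairs k \<Longrightarrow> cmod (fst (uh p)) = 1 \<and> (\<forall>a<g. W p a = fst (uh p) * cis (snd (uh p) a)) \<and>
     (\<Sum>a<g. snd (uh p) a) = 0 \<and> (\<forall>a<g. \<bar>snd (uh p) a\<bar> \<le> \<eta>)" by blast
  define u where "u = (\<lambda>p. fst (uh p))"
  define h where "h = (\<lambda>p. snd (uh p))"
  have u: "cmod (u p) = 1" and Wp: "\<And>a. a < g \<Longrightarrow> W p a = u p * cis (h p a)"
    and h0: "(\<Sum>a<g. h p a) = 0" and hb: "\<And>a. a < g \<Longrightarrow> \<bar>h p a\<bar> \<le> \<eta>" if "p \<in> pairs k" for p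
    using uh[OF that] by (auto simp: u_def h_def)
  define w where "w = (\<lambda>p. phi1 g (\<lambda>a. cis (h p a)))"
  define v where "v = (\<lambda>p. var1 g (h p))"
  define z where "z = (\<lambda>p. w p - 1)"
  define P where "P = (\<Prod>p\<in>pairs k. w p)"
  define F where "F = phi g k (\<lambda>p a. cis (h p a))"
  have "(0, 1) \<in> pairs k" using k by (simp add: pairs_def)
  then have "card (pairs k) > 0" by (auto simp: card_gt_0_iff)
  then have K1: "K \<ge> 1" by (simp add: K)
  have \<eta>0: "0 \<le> \<eta>" using \<delta> by (simp add: \<eta>_def)
  have K\<eta>: "K * \<eta> \<le> 1 / 2" using \<delta> by (simp add: \<eta>_def)
  have "\<eta> \<le> K * \<eta>" using mult_right_mono[OF K1 \<eta>0] by simp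
  then have \<eta>: "\<eta> \<le> 1 / 2" using K\<eta> by linarith
  define y where "y = K * \<eta>"
  have y: "0 \<le> y" "y \<le> 1 / 2" "\<eta> \<le> y"
    using K1 \<eta>0 K\<eta> \<open>\<eta> \<le> K * \<eta>\<close> by (auto simp: y_def)
  have zv: "cmod (z p - of_real (- v p / 2)) \<le> \<eta> ^ 3" if "p \<in> pairs k" for p
    using phi1_near[OF g h0 hb, OF that that] by (simp add: z_def w_def v_def algebra_simps)
  have zb: "cmod (z p) \<le> \<eta>\<^sup>2" if p: "p \<in> pairs k" for p
  proof -
    have vb: "0 \<le> v p" "v p \<le> \<eta>\<^sup>2" unfolding v_def using var1_bounds[OF g hb[OF p]] by auto
    have "cmod (z p) \<le> cmod (z p - of_real (- v p / 2)) + cmod (of_real (- v p / 2))"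
      by (metis diff_add_cancel norm_triangle_ineq)
    also have "cmod (of_real (- v p / 2)) = v p / 2"
      unfolding norm_of_real using vb by simp
    finally have "cmod (z p) \<le> \<eta> ^ 3 + \<eta>\<^sup>2 / 2" using zv[OF p] vb by linarith
    moreover have "\<eta> ^ 3 \<le> \<eta>\<^sup>2 / 2"
      using mult_left_mono[OF \<eta>, of "\<eta>\<^sup>2"] by (simp add: power3_eq_cube power2_eq_square)
    ultimately show ?thesis by linarith
  qed
  have T: "(\<Sum>p\<in>pairs k. cmod (z p)) \<le> K * \<eta>\<^sup>2"
    using sum_mono[of "pairs k" "\<lambda>p. cmod (z p)" "\<lambda>_. \<eta>\<^sup>2"] zb by (simp add: K)
  have K\<eta>2: "K * \<eta>\<^sup>2 \<le> y * y"
    using mult_right_mono[OF y(3,1)] K1 \<eta>0 mult_left_mono[OF y(3), of y] y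
    by (simp add: y_def power2_eq_square mult_ac)
  have yy: "y * y \<le> 1 / 4" using mult_mono[OF y(2,2)] y by simp
  have T1: "(\<Sum>p\<in>pairs k. cmod (z p)) \<le> 1" using T K\<eta>2 yy by linarith
  have T0: "0 \<le> (\<Sum>p\<in>pairs k. cmod (z p))" by (simp add: sum_nonneg)
  have "(\<Sum>p\<in>pairs k. cmod (z p))\<^sup>2 \<le> (K * \<eta>\<^sup>2)\<^sup>2" using T T0 by (intro power_mono) auto
  then have P1: "cmod (P - 1 - (\<Sum>p\<in>pairs k. z p)) \<le> (K * \<eta>\<^sup>2)\<^sup>2"
    using prod_one_plus_approx[OF finite_pairs T1] by (simp add: P_def z_def)
  have K4: "(K * \<eta>\<^sup>2)\<^sup>2 \<le> y ^ 3"
  proof -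
    have "(K * \<eta>\<^sup>2)\<^sup>2 = (y * y) * (\<eta> * \<eta>)" by (simp add: y_def power2_eq_square mult_ac)
    also have "\<dots> \<le> (y * y) * (1 * y)" using \<eta> y \<eta>0 by (intro mult_left_mono mult_mono) auto
    finally show ?thesis by (simp add: power3_eq_cube)
  qed
  have S: "cmod ((\<Sum>p\<in>pairs k. z p) - of_real (- (\<Sum>p\<in>pairs k. v p) / 2)) \<le> y ^ 3"
  proof -
    have "(\<Sum>p\<in>pairs k. z p) - of_real (- (\<Sum>p\<in>pairs k. v p) / 2) = (\<Sum>p\<in>pairs k. z p - of_real (- v p / 2))"
      by (simp add: sum.distrib sum_divide_distrib)
    then have "cmod ((\<Sum>p\<in>pairs k. z p) - of_real (- (\<Sum>p\<in>pairs k. v p) / 2)) \<le> (\<Sum>p\<in>pairs k. \<eta> ^ 3)"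
      using sum_norm_le[of "pairs k" "\<lambda>p. z p - of_real (- v p / 2)" "\<lambda>_. \<eta> ^ 3"] zv by simp
    also have "\<dots> = y * (\<eta> * \<eta>)" by (simp add: K y_def power3_eq_cube)
    also have "\<dots> \<le> y * (y * y)" using y \<eta>0 by (intro mult_left_mono mult_mono) auto
    finally show ?thesis by (simp add: power3_eq_cube)
  qed
  have F1: "cmod (F - of_real (1 - (\<Sum>p\<in>pairs k. v p) / 2)) \<le> y ^ 3"
    unfolding F_def v_def y_def K by (rule phi_near[OF g h0 hb])
  have FP: "cmod (F - P) \<le> 3 * y ^ 3"
  proof -
    have "F - P = (F - of_real (1 - (\<Sum>p\<in>pairs k. v p) / 2)) - (P - 1 - (\<Sum>p\<in>pairs k. z p))
       - ((\<Sum>p\<in>pairs k. z p) - of_real (- (\<Sum>p\<in>pairs k. v p) / 2))"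
      by (simp add: field_simps)
    then have "cmod (F - P) \<le> cmod (F - of_real (1 - (\<Sum>p\<in>pairs k. v p) / 2)) + cmod (P - 1 - (\<Sum>p\<in>pairs k. z p))
       + cmod ((\<Sum>p\<in>pairs k. z p) - of_real (- (\<Sum>p\<in>pairs k. v p) / 2))"
      by (metis (no_types, lifting) add_mono_thms_linordered_semiring(3) norm_triangle_ineq4 order_trans)
    then show ?thesis using F1 P1 K4 S by linarith
  qed
  have Plow: "cmod P \<ge> 1 / 2"
  proof -
    have "cmod (P - 1) \<le> cmod (P - 1 - (\<Sum>p\<in>pairs k. z p)) + cmod (\<Sum>p\<in>pairs k. z p)"
      by (metis diff_add_cancel norm_triangle_ineq)
    also have "\<dots> \<le> y ^ 3 + y * y"
      using P1 K4 norm_sum[of z "pairs k"] T K\<eta>2 by linarith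
    also have "y ^ 3 \<le> 1 / 8" using power_mono[OF y(2,1), of 3] by (simp add: power_divide)
    finally have "cmod (P - 1) \<le> 1 / 2" using yy by linarith
    then show ?thesis using norm_triangle_ineq2[of 1 "1 - P"] by (simp add: norm_minus_commute)
  qed
  have y3: "0 \<le> y ^ 3" using y by simp
  have "cmod (F - P) \<le> 6 * y ^ 3 * cmod P"
    using FP mult_left_mono[OF Plow, of "6 * y ^ 3"] y3 by linarith
  then have "cmod (F ^ N - P ^ N) \<le> 2 * real N * (6 * y ^ 3) * cmod P ^ N"
    by (rule power_close) (use \<delta> y3 in \<open>simp_all add: y_def \<eta>_def N_def mult_ac\<close>)
  moreover have "termk g k lam W = F ^ N"
    unfolding F_def N_def by (rule termk_angles[OF g u Wp h0])
  moreover have t1: "term1 g lam (W p) = w p ^ N" if "p \<in> pairs k" for p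
    unfolding w_def N_def by (rule term1_angles[OF g u Wp h0]) (use that in auto)
  moreover have "(\<Prod>p\<in>pairs k. term1 g lam (W p)) = P ^ N"
    by (simp add: P_def t1 flip: prod_power_distrib)
  moreover have "(\<Prod>p\<in>pairs k. cmod (term1 g lam (W p))) = cmod P ^ N"
    by (simp add: P_def t1 prod_norm norm_power flip: prod_power_distrib)
  ultimately show ?thesis by (simp add: N_def y_def \<eta>_def)
qed

text \<open>Away from the flows the summands are bounded pointwise: by the first error if some pair
  is remote from all characters, by the second if every pair is near a character but these form no
  flow. Bounding the number of such families by the number of all families is harmless, since the
  average divides by the latter.\<close>

lemma num_diff_matrices_approx:
  assumes g: "g \<ge> 2" and k: "k \<ge> 2" and par: "even g \<Longrightarrow> even lam"
    and M: "g * lam < M" "g dvd M" and \<delta>: "0 < \<delta>" "\<delta> \<le> 1" "2 * \<delta> < 1 / real g"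
  shows "cmod (of_nat (num_diff_matrices g k lam) / of_nat g ^ (k * (g * lam))
      - of_nat (card (flows g k)) * (\<Sum>W\<in>(\<Pi>\<^sub>E p\<in>pairs k. nbhd g M \<delta> 0). termk g k lam W) / of_nat M ^ (g * card (pairs k)))
    \<le> exp (- (real (g * lam) * \<delta>\<^sup>2 / (36 * real g ^ 4))) + (real (card (pairs k)) * \<delta>) ^ (g * lam)"
    (is "_ \<le> ?t1 + ?t2")
proof -
  define \<Omega> where "\<Omega> = (pairs k \<rightarrow>\<^sub>E phases g M)"
  define U where "U = (\<lambda>c. \<Pi>\<^sub>E p\<in>pairs k. nbhd g M \<delta> (c p))"
  define Good where "Good = (\<Union>c\<in>flows g k. U c)"
  have g0: "g > 0" and M0: "M > 0" using g M by auto
  have fin: "finite \<Omega>" unfolding \<Omega>_def using M0 by (simp add: finite_PiE)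
  have U\<Omega>: "U c \<subseteq> \<Omega>" for c
    unfolding U_def \<Omega>_def by (rule PiE_mono) (simp add: nbhd_def)
  have G\<Omega>: "Good \<subseteq> \<Omega>" using U\<Omega> by (auto simp: Good_def)
  \<comment> \<open>The condition 2 \<open>\<delta>\<close> < 1 / g prevents a family from being
    counted for two flows.\<close>
  have disj: "U c \<inter> U c' = {}" if c: "c \<in> flows g k" "c' \<in> flows g k" "c \<noteq> c'" for c c'
  proof (rule ccontr)
    assume "U c \<inter> U c' \<noteq> {}"
    then obtain W where W: "W \<in> U c" "W \<in> U c'" by blast
    have cP: "c \<in> pairs k \<rightarrow>\<^sub>E {..<g}" "c' \<in> pairs k \<rightarrow>\<^sub>E {..<g}" using c by (auto simp: flows_def)
    have "c p = c' p" if p: "p \<in> pairs k" for p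
    proof (rule nbhd_disjoint[OF g M0 \<delta>(3)])
      show "c p < g" "c' p < g" using cP p by auto
      show "W p \<in> nbhd g M \<delta> (c p)" "W p \<in> nbhd g M \<delta> (c' p)" using W p by (auto simp: U_def)
    qed
    then have "c = c'" using cP by (rule_tac PiE_ext)
    then show False using c by simp
  qed
  have small: "cmod (termk g k lam W) \<le> ?t1 + ?t2" if W: "W \<in> \<Omega> - Good" for W
  proof -
    have W\<Omega>: "W \<in> pairs k \<rightarrow>\<^sub>E phases g M" using W by (simp add: \<Omega>_def)
    have "cmod (\<Prod>p\<in>pairs k. chi g lam (W p)) = 1"
      unfolding prod_norm[symmetric] using W\<Omega> norm_chi[OF M0] by (intro prod.neutral) auto
    then have n: "cmod (termk g k lam W) = cmod (phi g k W) ^ (g * lam)"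
      by (simp add: termk_def norm_mult norm_power)
    show ?thesis
    proof (cases "\<exists>p\<in>pairs k. \<forall>c<g. W p \<notin> nbhd g M \<delta> c")
      case True
      then obtain p where p: "p \<in> pairs k" "\<And>c. c < g \<Longrightarrow> W p \<notin> nbhd g M \<delta> c" by blast
      have "cmod (termk g k lam W) \<le> ?t1"
        unfolding n by (rule phi_remote[OF g M0 \<delta>(1,2) W\<Omega> p])
      moreover have "?t2 \<ge> 0" using \<delta> by simp
      ultimately show ?thesis by linarith
    next
      case False
      then have "\<forall>p\<in>pairs k. \<exists>c. c < g \<and> W p \<in> nbhd g M \<delta> c" by blast
      from bchoice[OF this] obtain c0 where c0: "\<forall>p\<in>pairs k. c0 p < g \<and> W p \<in> nbhd g M \<delta> (c0 p)" ..
      define c where "c = restrict c0 (pairs k)"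
      have c: "c \<in> pairs k \<rightarrow>\<^sub>E {..<g}" using c0 by (auto simp: c_def)
      have Wc: "W p \<in> nbhd g M \<delta> (c p)" if "p \<in> pairs k" for p using c0 that by (simp add: c_def)
      have "W \<in> U c" using W\<Omega> Wc by (auto simp: U_def PiE_iff)
      then have "c \<notin> flows g k" using W by (auto simp: Good_def)
      then have "cmod (phi g k W) \<le> real (card (pairs k)) * \<delta>"
        by (rule phi_nonflow[OF g0 M0 c _ Wc])
      then have "cmod (termk g k lam W) \<le> ?t2"
        unfolding n by (intro power_mono) auto
      then show ?thesis by (smt (verit) exp_ge_zero)
    qed
  qed
  have split: "(\<Sum>W\<in>\<Omega>. termk g k lam W) = (\<Sum>W\<in>\<Omega> - Good. termk g k lam W) + (\<Sum>W\<in>Good. termk g k lam W)"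
    by (rule sum.subset_diff[OF G\<Omega> fin])
  have "(\<Sum>W\<in>Good. termk g k lam W) = (\<Sum>c\<in>flows g k. \<Sum>W\<in>U c. termk g k lam W)"
    unfolding Good_def
  proof (rule sum.UNION_disjoint)
    show "\<forall>i\<in>flows g k. finite (U i)" using finite_subset[OF U\<Omega> fin] by blast
    show "\<forall>i\<in>flows g k. \<forall>j\<in>flows g k. i \<noteq> j \<longrightarrow> U i \<inter> U j = {}" using disj by blast
  qed simp
  also have "\<dots> = (\<Sum>c\<in>flows g k. \<Sum>W\<in>(\<Pi>\<^sub>E p\<in>pairs k. nbhd g M \<delta> 0). termk g k lam W)"
    unfolding U_def termk_def by (intro sum.cong[OF refl] flow_shift g0 M0 M(2) par)
  finally have good: "(\<Sum>W\<in>Good. termk g k lam W) = of_nat (card (flows g k)) * (\<Sum>W\<in>(\<Pi>\<^sub>E p\<in>pairs k. nbhd g M \<delta> 0). termk g k lam W)"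
    by simp
  have four: "of_nat (num_diff_matrices g k lam) / of_nat g ^ (k * (g * lam)) = (\<Sum>W\<in>\<Omega>. termk g k lam W) / of_nat M ^ (g * card (pairs k))"
    using num_diff_matrices_fourier[OF g0 M(1), of k] g0 M0
    unfolding termk_def \<Omega>_def by (simp add: field_simps)
  have card\<Omega>: "real (card \<Omega>) = real M ^ (g * card (pairs k))"
    unfolding \<Omega>_def by (simp add: card_PiE card_phases[OF M0] power_mult)
  have t0: "0 \<le> ?t1 + ?t2" using \<delta> by simp
  have "cmod (\<Sum>W\<in>\<Omega> - Good. termk g k lam W) \<le> (\<Sum>W\<in>\<Omega> - Good. ?t1 + ?t2)"
    by (rule sum_norm_le) (rule small)
  also have "\<dots> = real (card (\<Omega> - Good)) * (?t1 + ?t2)" by simp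
  also have "\<dots> \<le> real (card \<Omega>) * (?t1 + ?t2)"
    using t0 fin by (intro mult_right_mono of_nat_mono card_mono) auto
  finally have bad: "cmod (\<Sum>W\<in>\<Omega> - Good. termk g k lam W) \<le> real M ^ (g * card (pairs k)) * (?t1 + ?t2)"
    unfolding card\<Omega> .
  have "of_nat (num_diff_matrices g k lam) / of_nat g ^ (k * (g * lam))
      - of_nat (card (flows g k)) * (\<Sum>W\<in>(\<Pi>\<^sub>E p\<in>pairs k. nbhd g M \<delta> 0). termk g k lam W) / of_nat M ^ (g * card (pairs k))
     = (\<Sum>W\<in>\<Omega> - Good. termk g k lam W) / of_nat M ^ (g * card (pairs k))"
    unfolding four split good by (simp add: add_divide_distrib)
  then show ?thesis
    using bad M0 by (simp add: norm_divide norm_power divide_le_eq mult.commute)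
qed

text \<open>The analogue for one pair. The trivial character plays the role of the flows, since
  every other character has mean zero.\<close>

lemma balanced_prob_approx:
  assumes g: "g \<ge> 2" and M: "g * lam < M" "g dvd M" and \<delta>: "0 < \<delta>" "\<delta> \<le> 1"
  shows "cmod (of_real (balanced_prob g lam) - (\<Sum>b\<in>nbhd g M \<delta> 0. term1 g lam b) / of_nat M ^ g)
    \<le> exp (- (real (g * lam) * \<delta>\<^sup>2 / (36 * real g ^ 4))) + \<delta> ^ (g * lam)"
    (is "_ \<le> ?t1 + ?t2")
proof -
  have g0: "g > 0" and M0: "M > 0" using g M by auto
  have sub: "nbhd g M \<delta> 0 \<subseteq> phases g M" by (auto simp: nbhd_def)
  have small: "cmod (term1 g lam b) \<le> ?t1 + ?t2" if b: "b \<in> phases g M - nbhd g M \<delta> 0" for b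
  proof -
    have n: "cmod (term1 g lam b) = cmod (phi1 g b) ^ (g * lam)"
      using norm_chi[OF M0, of b g lam] b by (simp add: term1_def norm_mult norm_power)
    show ?thesis
    proof (cases "\<forall>c<g. b \<notin> nbhd g M \<delta> c")
      case True
      have "cmod (term1 g lam b) \<le> ?t1"
        unfolding n by (rule phi1_remote[OF g M0 \<delta>]) (use b True in auto)
      moreover have "?t2 \<ge> 0" using \<delta> by simp
      ultimately show ?thesis by linarith
    next
      case False
      then obtain c where c: "c < g" "b \<in> nbhd g M \<delta> c" by blast
      then have "c \<noteq> 0" using b by (cases "c = 0") auto
      then have "cmod (term1 g lam b) \<le> ?t2"
        unfolding n by (intro power_mono phi1_nontrivial[OF g0 c(2,1)]) auto
      then show ?thesis by (smt (verit) exp_ge_zero)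
    qed
  qed
  have split: "(\<Sum>b\<in>phases g M. term1 g lam b) = (\<Sum>b\<in>phases g M - nbhd g M \<delta> 0. term1 g lam b) + (\<Sum>b\<in>nbhd g M \<delta> 0. term1 g lam b)"
    by (rule sum.subset_diff[OF sub]) (simp add: M0)
  have t0: "0 \<le> ?t1 + ?t2" using \<delta> by simp
  have "cmod (\<Sum>b\<in>phases g M - nbhd g M \<delta> 0. term1 g lam b) \<le> (\<Sum>b\<in>phases g M - nbhd g M \<delta> 0. ?t1 + ?t2)"
    by (rule sum_norm_le) (rule small)
  also have "\<dots> = real (card (phases g M - nbhd g M \<delta> 0)) * (?t1 + ?t2)" by simp
  also have "\<dots> \<le> real (card (phases g M)) * (?t1 + ?t2)"
    using t0 M0 by (intro mult_right_mono of_nat_mono card_mono) auto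
  finally have bad: "cmod (\<Sum>b\<in>phases g M - nbhd g M \<delta> 0. term1 g lam b) \<le> real M ^ g * (?t1 + ?t2)"
    by (simp add: card_phases[OF M0])
  have "of_real (balanced_prob g lam) = (\<Sum>b\<in>phases g M. term1 g lam b) / of_nat M ^ g"
    using balanced_prob_fourier[OF g0 M(1)] M0 unfolding term1_def by (simp add: field_simps)
  then have "of_real (balanced_prob g lam) - (\<Sum>b\<in>nbhd g M \<delta> 0. term1 g lam b) / of_nat M ^ g
     = (\<Sum>b\<in>phases g M - nbhd g M \<delta> 0. term1 g lam b) / of_nat M ^ g"
    unfolding split by (simp add: add_divide_distrib)
  then show ?thesis
    using bad M0 by (simp add: norm_divide norm_power divide_le_eq mult.commute)
qed

lemma balanced_prob_pos: "g > 0 \<Longrightarrow> balanced_prob g lam > 0"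
  by (simp add: balanced_prob_def)

lemma balanced_prob_le_1:
  assumes g: "g > 0"
  shows "balanced_prob g lam \<le> 1"
proof -
  let ?S = "{s \<in> {..<g * lam} \<rightarrow>\<^sub>E {..<g}. \<forall>a<g. card {l. l < g * lam \<and> s l = a} = lam}"
  have "card ?S \<le> card ({..<g * lam} \<rightarrow>\<^sub>E {..<g})"
    by (rule card_mono) (auto simp: finite_PiE)
  also have "\<dots> = g ^ (g * lam)" by (simp add: card_PiE)
  finally have "real (card ?S) \<le> real (g ^ (g * lam))" unfolding of_nat_le_iff .
  from mult_right_mono[OF this, of "fact lam ^ g"]
  have "real (card ?S) * fact lam ^ g \<le> real g ^ (g * lam) * fact lam ^ g" by simp
  moreover have "real (card ?S) * fact lam ^ g = fact (g * lam)"
    using arg_cong[OF card_balanced[of g lam], of real] by simp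
  ultimately have "fact (g * lam) \<le> real g ^ (g * lam) * fact lam ^ g" by linarith
  then show ?thesis using g by (simp add: balanced_prob_def divide_le_eq mult.commute)
qed

text \<open>The non-asymptotic core: \<open>\<tau>\<close> collects what lies away from the flows
  and \<open>\<kappa>\<close> is the third-order error near them. The chain is R ~ L G ~ L G1^K ~ L
  P^K, with G and G1 the near-trivial Fourier averages for k rows and for one pair.\<close>

lemma num_diff_matrices_ratio:
  assumes g: "g \<ge> 2" and k: "k \<ge> 2" and par: "even g \<Longrightarrow> even lam"
    and \<delta>: "0 < \<delta>" "2 * \<delta> < 1 / real g"
    and K: "K = card (pairs k)" and \<kappa>: "\<kappa> = real (g * lam) * (real K * (4 * \<delta>)) ^ 3" "32 * \<kappa> \<le> 1"
      "real K * (4 * \<delta>) \<le> 1 / 2"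
    and \<tau>: "\<tau> = exp (- (real (g * lam) * \<delta>\<^sup>2 / (36 * real g ^ 4))) + (real K * \<delta>) ^ (g * lam)"
      "8 * real K * \<tau> \<le> balanced_prob g lam ^ K"
  shows "\<bar>real (num_diff_matrices g k lam) / (real g ^ (k * (g * lam)) * real (card (flows g k)) * balanced_prob g lam ^ K) - 1\<bar>
    \<le> 3 * real K * (\<tau> / balanced_prob g lam ^ K) + 36 * \<kappa>"
proof -
  define N where "N = g * lam"
  \<comment> \<open>Larger than N, so that the inversion is exact, and divisible by g, so that flows
    can be shifted.\<close>
  define M where "M = g * (N + 1)"
  define L where "L = real (card (flows g k))"
  define P where "P = balanced_prob g lam"
  define B where "B = nbhd g M \<delta> 0"
  define G1 where "G1 = (\<Sum>b\<in>B. term1 g lam b) / of_nat M ^ g"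
  \<comment> \<open>The error in comparing \<open>G\<close> with \<open>G1 ^ K\<close> is relative
    to this sum of absolute values, so \<open>Q ^ K\<close> has to be bounded by a constant times
    \<open>P ^ K\<close>.\<close>
  define Q where "Q = (\<Sum>b\<in>B. cmod (term1 g lam b)) / real M ^ g"
  define G where "G = (\<Sum>W\<in>(\<Pi>\<^sub>E p\<in>pairs k. B). termk g k lam W) / of_nat M ^ (g * K)"
  define R where "R = real (num_diff_matrices g k lam) / real g ^ (k * N)"
  have g0: "g > 0" using g by simp
  have M0: "M > 0" using g by (simp add: M_def)
  have NM: "g * lam < M" "g dvd M"
  proof -
    have "1 * (N + 1) \<le> g * (N + 1)" using g by (intro mult_right_mono) auto
    then show "g * lam < M" by (simp add: M_def N_def)
  qed (simp add: M_def)
  have "(0, 1) \<in> pairs k" using k by (simp add: pairs_def)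
  then have "K > 0" by (auto simp: card_gt_0_iff K)
  then have K1: "real K \<ge> 1" by simp
  have d4: "4 * \<delta> \<le> real K * (4 * \<delta>)" using mult_right_mono[OF K1, of "4 * \<delta>"] \<delta> by simp
  then have d4h: "4 * \<delta> \<le> 1 / 2" using \<kappa>(3) by linarith
  then have \<delta>1: "\<delta> \<le> 1" using \<delta> by linarith
  have P0: "P > 0" "P \<le> 1" using balanced_prob_pos[OF g0] balanced_prob_le_1[OF g0] by (auto simp: P_def)
  have PK: "P ^ K > 0" "P ^ K \<le> P"
    using P0 power_decreasing[of 1 K P] \<open>K > 0\<close> by auto
  have \<kappa>0: "\<kappa> \<ge> 0" using \<delta> by (simp add: \<kappa>(1))
  have \<tau>0: "\<tau> \<ge> 0" using \<delta> by (simp add: \<tau>(1))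
  have A1: "cmod (of_real R - of_real L * G) \<le> \<tau>"
  proof -
    have "of_real R - of_real L * G = of_nat (num_diff_matrices g k lam) / of_nat g ^ (k * (g * lam))
      - of_nat (card (flows g k)) * (\<Sum>W\<in>(\<Pi>\<^sub>E p\<in>pairs k. nbhd g M \<delta> 0). termk g k lam W) / of_nat M ^ (g * card (pairs k))"
      by (simp add: R_def L_def G_def B_def N_def K)
    then show ?thesis
      using num_diff_matrices_approx[OF g k par NM \<delta>(1) \<delta>1 \<delta>(2)] unfolding \<tau>(1) K by simp
  qed
  have A2: "cmod (G1 - of_real P) \<le> \<tau>"
  proof -
    have "\<delta> ^ (g * lam) \<le> (real K * \<delta>) ^ (g * lam)"
      using mult_right_mono[OF K1, of \<delta>] \<delta> by (intro power_mono) auto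
    then have "cmod (of_real P - G1) \<le> \<tau>"
      using balanced_prob_approx[OF g NM \<delta>(1) \<delta>1] unfolding P_def G1_def B_def \<tau>(1) by linarith
    then show ?thesis by (simp add: norm_minus_commute)
  qed
  have A3: "cmod (G - G1 ^ K) \<le> 12 * \<kappa> * Q ^ K"
  proof -
    have fB: "finite B" using M0 by (simp add: B_def)
    have "G1 ^ K = (\<Prod>p\<in>pairs k. \<Sum>b\<in>B. term1 g lam b) / of_nat M ^ (g * K)"
      by (simp add: G1_def K power_divide power_mult)
    also have "(\<Prod>p\<in>pairs k. \<Sum>b\<in>B. term1 g lam b) = (\<Sum>W\<in>(\<Pi>\<^sub>E p\<in>pairs k. B). \<Prod>p\<in>pairs k. term1 g lam (W p))"
      by (rule prod_sum_PiE) (simp_all add: fB)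
    finally have "G - G1 ^ K = (\<Sum>W\<in>(\<Pi>\<^sub>E p\<in>pairs k. B). termk g k lam W - (\<Prod>p\<in>pairs k. term1 g lam (W p))) / of_nat M ^ (g * K)"
      by (simp add: G_def sum_subtractf diff_divide_distrib)
    then have "cmod (G - G1 ^ K) = cmod (\<Sum>W\<in>(\<Pi>\<^sub>E p\<in>pairs k. B). termk g k lam W - (\<Prod>p\<in>pairs k. term1 g lam (W p))) / real M ^ (g * K)"
      by (simp add: norm_divide norm_power)
    also have "\<dots> \<le> (\<Sum>W\<in>(\<Pi>\<^sub>E p\<in>pairs k. B). 12 * \<kappa> * (\<Prod>p\<in>pairs k. cmod (term1 g lam (W p)))) / real M ^ (g * K)"
    proof (intro divide_right_mono sum_norm_le)
      fix W assume W: "W \<in> (\<Pi>\<^sub>E p\<in>pairs k. B)"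
      have "6 * real (g * lam) * (real K * (4 * \<delta>)) ^ 3 \<le> 1"
        using \<kappa>(1,2) \<kappa>0 by simp
      then have "cmod (termk g k lam W - (\<Prod>p\<in>pairs k. term1 g lam (W p)))
        \<le> 12 * real (g * lam) * (real K * (4 * \<delta>)) ^ 3 * (\<Prod>p\<in>pairs k. cmod (term1 g lam (W p)))"
        using W \<delta> \<kappa>(3) by (intro termk_near_product[OF g0 M0 k, where \<delta> = \<delta>]) (auto simp: B_def K)
      then show "cmod (termk g k lam W - (\<Prod>p\<in>pairs k. term1 g lam (W p)))
        \<le> 12 * \<kappa> * (\<Prod>p\<in>pairs k. cmod (term1 g lam (W p)))" by (simp add: \<kappa>(1) mult.assoc)
    qed simp
    also have "(\<Sum>W\<in>(\<Pi>\<^sub>E p\<in>pairs k. B). 12 * \<kappa> * (\<Prod>p\<in>pairs k. cmod (term1 g lam (W p))))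
       = 12 * \<kappa> * (\<Prod>p\<in>pairs k. \<Sum>b\<in>B. cmod (term1 g lam b))"
      unfolding sum_distrib_left[symmetric]
      by (subst prod_sum_PiE) (simp_all add: fB)
    also have "\<dots> / real M ^ (g * K) = 12 * \<kappa> * Q ^ K"
      by (simp add: Q_def K power_divide power_mult)
    finally show ?thesis .
  qed
  have Q0: "Q \<ge> 0" by (simp add: Q_def sum_nonneg)
  define e where "e = 8 * (real N * (4 * \<delta>) ^ 3)"
  have Kcube: "real K * (4 * \<delta>) ^ 3 \<le> (real K * (4 * \<delta>)) ^ 3"
  proof -
    have "real K ^ 1 \<le> real K ^ 3" using K1 by (intro power_increasing) auto
    then have "real K * (4 * \<delta>) ^ 3 \<le> real K ^ 3 * (4 * \<delta>) ^ 3" using \<delta> by (intro mult_right_mono) auto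
    then show ?thesis by (simp add: power_mult_distrib)
  qed
  have Ke: "real K * e \<le> 8 * \<kappa>"
    using mult_left_mono[OF Kcube, of "8 * real N"] by (simp add: e_def \<kappa>(1) N_def mult_ac)
  have e0: "e \<ge> 0" using \<delta> by (simp add: e_def)
  have eKe: "e \<le> real K * e" using mult_right_mono[OF K1 e0] by simp
  \<comment> \<open>The summands are nearly positive, so passing to absolute values changes the sum
    by at most \<open>e * Q\<close>, which is absorbed into the left side below.\<close>
  have A4: "Q \<le> cmod G1 + e * Q"
  proof -
    have "cmod (G1 - of_real Q) = cmod (\<Sum>b\<in>B. term1 g lam b - of_real (cmod (term1 g lam b))) / real M ^ g"
    proof -
      have "G1 - of_real Q = (\<Sum>b\<in>B. term1 g lam b - of_real (cmod (term1 g lam b))) / of_nat M ^ g"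
        by (simp add: G1_def Q_def sum_subtractf diff_divide_distrib)
      then show ?thesis by (simp add: norm_divide norm_power)
    qed
    also have "\<dots> \<le> (\<Sum>b\<in>B. e * cmod (term1 g lam b)) / real M ^ g"
    proof (intro divide_right_mono sum_norm_le)
      fix b assume b: "b \<in> B"
      have "4 * real (g * lam) * (4 * \<delta>) ^ 3 \<le> 1"
        using Ke eKe \<kappa>(2) by (simp add: e_def N_def)
      then have "cmod (term1 g lam b - of_real (cmod (term1 g lam b))) \<le> 8 * real (g * lam) * (4 * \<delta>) ^ 3 * cmod (term1 g lam b)"
        using b \<delta> d4h by (intro term1_near_positive[OF g0 M0]) (auto simp: B_def)
      then show "cmod (term1 g lam b - of_real (cmod (term1 g lam b))) \<le> e * cmod (term1 g lam b)"
        by (simp add: e_def N_def mult.assoc)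
    qed simp
    also have "\<dots> = e * Q" by (simp add: Q_def sum_distrib_left)
    finally have "cmod (of_real Q - G1) \<le> e * Q" by (simp add: norm_minus_commute)
    moreover have "Q \<le> cmod (of_real Q - G1) + cmod G1"
      using norm_triangle_ineq[of "of_real Q - G1" G1] Q0 by simp
    ultimately show ?thesis by linarith
  qed
  \<comment> \<open>The error is measured on the scale of the final main term. Since P <= 1, the
    same \<open>t\<close> also bounds \<open>\<tau>\<close> relative to \<open>P\<close>, as needed
    for \<open>G1\<close>.\<close>
  define t where "t = \<tau> / P ^ K"
  have t0: "t \<ge> 0" using \<tau>0 PK by (simp add: t_def)
  have Kt: "real K * t \<le> 1 / 8" using \<tau>(2) PK by (simp add: t_def P_def field_simps)
  have tKt: "t \<le> real K * t" using mult_right_mono[OF K1 t0] by simp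
  have \<tau>t: "\<tau> \<le> t * P"
    using PK \<tau>0 mult_left_mono[OF PK(2), of t] t0 by (simp add: t_def)
  have QP: "Q \<le> P * (1 + (2 * t + 2 * e))"
  proof -
    have "cmod G1 \<le> P + \<tau>"
      using norm_triangle_ineq[of "G1 - of_real P" "of_real P"] A2 P0 by simp
    then have "Q \<le> P + t * P + e * Q" using A4 \<tau>t by linarith
    then have q: "Q * (1 - e) \<le> P * (1 + t)" by (simp add: algebra_simps)
    have e2: "e \<le> 1 / 4" using Ke eKe \<kappa>(2) by linarith
    have "1 \<le> (1 - e) * (1 + 2 * e)" using e2 e0 mult_left_mono[of e "1/2" e] by (simp add: algebra_simps)
    then have "Q * 1 \<le> Q * ((1 - e) * (1 + 2 * e))" using Q0 by (intro mult_left_mono)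
    also have "\<dots> = (Q * (1 - e)) * (1 + 2 * e)" by simp
    also have "\<dots> \<le> (P * (1 + t)) * (1 + 2 * e)" using q e0 by (intro mult_right_mono) auto
    also have "\<dots> \<le> P * (1 + (2 * t + 2 * e))"
    proof -
      have "(1 + t) * (1 + 2 * e) \<le> 1 + (2 * t + 2 * e)"
        using mult_left_mono[OF e2 t0] t0 by (simp add: algebra_simps)
      then show ?thesis using P0 by (simp add: mult.assoc mult_left_mono)
    qed
    finally show ?thesis by simp
  qed
  have "Q ^ K \<le> (P * (1 + (2 * t + 2 * e))) ^ K" using QP Q0 by (intro power_mono)
  also have "\<dots> = P ^ K * (1 + (2 * t + 2 * e)) ^ K" by (rule power_mult_distrib)
  \<comment> \<open>From K t <= 1/8 and K e <= 8 \<open>\<kappa>\<close> <= 1/4 the exponent below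
    is at most 3/4, so taking the K-th power costs only a constant factor.\<close>
  also have "\<dots> \<le> P ^ K * 3"
  proof -
    have "(1 + (2 * t + 2 * e)) ^ K \<le> exp (2 * t + 2 * e) ^ K"
      using t0 e0 by (intro power_mono exp_ge_add_one_self) auto
    also have "\<dots> = exp (2 * (real K * t) + 2 * (real K * e))"
      by (simp add: exp_of_nat_mult[symmetric] algebra_simps)
    also have "\<dots> \<le> exp 1"
    proof -
      have "2 * (real K * t) + 2 * (real K * e) \<le> 1" using Kt Ke \<kappa>(2) by linarith
      then show ?thesis by simp
    qed
    also have "\<dots> \<le> 3" by (rule exp_le)
    finally show ?thesis using PK by simp
  qed
  finally have QK: "Q ^ K \<le> 3 * P ^ K" by simp
  have G1P: "cmod (G1 ^ K - of_real P ^ K) \<le> 2 * real K * t * P ^ K"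
  proof -
    have "cmod (G1 - of_real P) \<le> t * cmod (of_real P)" using A2 \<tau>t P0 by simp
    then have "cmod (G1 ^ K - of_real P ^ K) \<le> 2 * real K * t * cmod (of_real P) ^ K"
      by (rule power_close) (use t0 Kt in auto)
    then show ?thesis using P0 by simp
  qed
  have "G - of_real P ^ K = (G - G1 ^ K) + (G1 ^ K - of_real P ^ K)" by simp
  then have "cmod (G - of_real P ^ K) \<le> cmod (G - G1 ^ K) + cmod (G1 ^ K - of_real P ^ K)"
    by (metis norm_triangle_ineq)
  also have "\<dots> \<le> 12 * \<kappa> * (3 * P ^ K) + 2 * real K * t * P ^ K"
    using A3 G1P mult_left_mono[OF QK, of "12 * \<kappa>"] \<kappa>0 by linarith
  finally have GP: "cmod (G - of_real P ^ K) \<le> (36 * \<kappa> + 2 * real K * t) * P ^ K"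
    by (simp add: algebra_simps)
  have "card (flows g k) > 0"
    using card_flows[OF g0, of k] k g0 by (intro gr0I) auto
  then have L1: "L \<ge> 1" by (simp add: L_def)
  have "of_real (R - L * P ^ K) = (of_real R - of_real L * G) + of_real L * (G - of_real P ^ K)"
    by (simp add: algebra_simps)
  then have "cmod (of_real (R - L * P ^ K)) \<le> cmod (of_real R - of_real L * G) + cmod (of_real L * (G - of_real P ^ K))"
    by (metis norm_triangle_ineq)
  also have "\<dots> \<le> \<tau> + L * ((36 * \<kappa> + 2 * real K * t) * P ^ K)"
  proof -
    have "cmod (of_real L * (G - of_real P ^ K)) = L * cmod (G - of_real P ^ K)"
      using L1 by (simp add: norm_mult)
    then show ?thesis using A1 mult_left_mono[OF GP, of L] L1 by linarith
  qed
  also have "\<tau> = t * P ^ K" using PK by (simp add: t_def)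
  also have "t * P ^ K \<le> L * (t * P ^ K)"
    using mult_right_mono[OF L1, of "t * P ^ K"] t0 PK by simp
  finally have "cmod (of_real (R - L * P ^ K)) \<le> L * P ^ K * (36 * \<kappa> + 2 * real K * t + t)"
    by (simp add: algebra_simps)
  then have "\<bar>R - L * P ^ K\<bar> \<le> L * P ^ K * (36 * \<kappa> + 2 * real K * t + t)"
    by (simp only: norm_of_real)
  also have "\<dots> \<le> L * P ^ K * (36 * \<kappa> + 3 * (real K * t))"
  proof (rule mult_left_mono)
    show "36 * \<kappa> + 2 * real K * t + t \<le> 36 * \<kappa> + 3 * (real K * t)" using tKt by linarith
    show "0 \<le> L * P ^ K" using L1 PK by simp
  qed
  finally have fin: "\<bar>R - L * P ^ K\<bar> \<le> L * P ^ K * (36 * \<kappa> + 3 * (real K * t))" .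
  have LP: "L * P ^ K > 0" using L1 PK by simp
  have "real (num_diff_matrices g k lam) / (real g ^ (k * (g * lam)) * real (card (flows g k)) * balanced_prob g lam ^ K) = R / (L * P ^ K)"
    by (simp add: R_def L_def P_def N_def mult.assoc)
  moreover have "R / (L * P ^ K) - 1 = (R - L * P ^ K) / (L * P ^ K)"
  proof -
    have ne: "L * P ^ K \<noteq> 0" using LP by linarith
    show ?thesis unfolding diff_divide_distrib divide_self[OF ne] ..
  qed
  moreover have "\<bar>(R - L * P ^ K) / (L * P ^ K)\<bar> \<le> 36 * \<kappa> + 3 * (real K * t)"
    using fin LP by (simp add: abs_divide divide_le_eq mult.commute)
  ultimately show ?thesis by (simp add: t_def P_def)
qed

section \<open>Stirling's formula with an error bound\<close>

text \<open>The difference of the two sides has derivative t^2 / ((1 + t)(2 + t)^2). This lower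
  bound is chosen because at x = 1 / n its product with n + 1/2 is exactly 1.\<close>

lemma ln_one_plus_ge:
  fixes x :: real
  assumes "x \<ge> 0"
  shows "ln (1 + x) \<ge> 2 * x / (2 + x)"
proof -
  define f where "f = (\<lambda>t::real. ln (1 + t) - 2 * t / (2 + t))"
  have "f 0 \<le> f x"
  proof (rule DERIV_nonneg_imp_nondecreasing[OF assms])
    fix t :: real assume t: "0 \<le> t" "t \<le> x"
    have "(f has_real_derivative (1 / (1 + t) - (2 * (2 + t) - 2 * t) / (2 + t)\<^sup>2)) (at t)"
      unfolding f_def using t by (auto intro!: derivative_eq_intros simp: power2_eq_square)
    moreover have "1 / (1 + t) - (2 * (2 + t) - 2 * t) / (2 + t)\<^sup>2 = t\<^sup>2 / ((1 + t) * (2 + t)\<^sup>2)"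
    proof -
      have "1 + t \<noteq> 0" "(2 + t)\<^sup>2 \<noteq> 0" using t by auto
      then show ?thesis by (simp add: diff_frac_eq) (simp add: power2_eq_square algebra_simps)
    qed
    ultimately show "\<exists>y. (f has_real_derivative y) (at t) \<and> 0 \<le> y" using t by auto
  qed
  then show ?thesis by (simp add: f_def)
qed

lemma ln_one_plus_le:
  fixes x :: real
  assumes "x \<ge> 0"
  shows "ln (1 + x) \<le> x - x\<^sup>2 / 2 + x ^ 3 / 3"
proof -
  define f where "f = (\<lambda>t::real. t - t\<^sup>2 / 2 + t ^ 3 / 3 - ln (1 + t))"
  have "f 0 \<le> f x"
  proof (rule DERIV_nonneg_imp_nondecreasing[OF assms])
    fix t :: real assume t: "0 \<le> t" "t \<le> x"
    have "(f has_real_derivative (1 - t + t\<^sup>2 - 1 / (1 + t))) (at t)"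
      unfolding f_def using t by (auto intro!: derivative_eq_intros simp: power2_eq_square)
    moreover have "1 - t + t\<^sup>2 - 1 / (1 + t) = t ^ 3 / (1 + t)"
    proof -
      have "1 + t \<noteq> 0" using t by auto
      then show ?thesis by (simp add: field_simps power2_eq_square power3_eq_cube)
    qed
    ultimately show "\<exists>y. (f has_real_derivative y) (at t) \<and> 0 \<le> y" using t by auto
  qed
  then show ?thesis by (simp add: f_def)
qed

text \<open>The logarithm of n! divided by n^(n + 1/2) exp(-n), which tends to ln(2 pi) / 2.\<close>

definition stirling_rest :: "nat \<Rightarrow> real" where
  "stirling_rest n = ln (fact n) - (real n + 1 / 2) * ln (real n) + real n"

text \<open>The upper bound is put in telescoping form: \<open>stirling_rest n\<close> decreases
  while \<open>stirling_rest n - 2 / real n\<close> increases, so the two enclose the limit with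
  error 2 / n.\<close>

lemma stirling_rest_step:
  assumes n: "n \<ge> 1"
  shows "0 \<le> stirling_rest n - stirling_rest (Suc n)" "stirling_rest n - stirling_rest (Suc n) \<le> 2 / real n - 2 / real (Suc n)"
proof -
  define x where "x = 1 / real n"
  have x: "0 < x" "x \<le> 1" using n by (auto simp: x_def)
  have nx: "real n = 1 / x" using n by (simp add: x_def)
  have lnS: "ln (real (Suc n)) = ln (real n) + ln (1 + x)"
  proof -
    have "real (Suc n) = real n * (1 + x)" using n by (simp add: x_def field_simps)
    then show ?thesis using n x by (simp add: ln_mult)
  qed
  have lnf: "ln (fact (Suc n) :: real) = ln (real (Suc n)) + ln (fact n)"
    unfolding fact_Suc by (subst ln_mult) simp_all
  have d: "stirling_rest n - stirling_rest (Suc n) = (real n + 1 / 2) * ln (1 + x) - 1"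
    unfolding stirling_rest_def lnf lnS by (simp add: algebra_simps)
  have "real n + 1 / 2 = (2 + x) / (2 * x)"
    using x unfolding nx by (simp add: field_simps)
  then have "(real n + 1 / 2) * (2 * x / (2 + x)) = 1" using x by simp
  moreover have "(real n + 1 / 2) * (2 * x / (2 + x)) \<le> (real n + 1 / 2) * ln (1 + x)"
    using x by (intro mult_left_mono ln_one_plus_ge) auto
  ultimately show "0 \<le> stirling_rest n - stirling_rest (Suc n)" unfolding d by linarith
  have "(real n + 1 / 2) * ln (1 + x) \<le> (real n + 1 / 2) * (x - x\<^sup>2 / 2 + x ^ 3 / 3)"
    using x by (intro mult_left_mono ln_one_plus_le) auto
  also have "\<dots> = 1 + x\<^sup>2 / 12 + x ^ 3 / 6"
    using x unfolding nx by (simp add: field_simps power2_eq_square power3_eq_cube)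
  also have "\<dots> \<le> 1 + x\<^sup>2"
  proof -
    have "x\<^sup>2 * x \<le> x\<^sup>2 * 1" using x by (intro mult_left_mono) auto
    then have "x ^ 3 \<le> x\<^sup>2" by (simp add: power3_eq_cube power2_eq_square)
    moreover have "0 \<le> x\<^sup>2" by simp
    ultimately show ?thesis by linarith
  qed
  finally have 1: "stirling_rest n - stirling_rest (Suc n) \<le> x\<^sup>2" unfolding d by simp
  have "2 / real n - 2 / real (Suc n) = 2 / (real n * real (Suc n))"
    using n by (simp add: field_simps)
  also have "\<dots> \<ge> 2 / (real n * (2 * real n))"
    using n by (intro divide_left_mono mult_left_mono) auto
  finally have "x\<^sup>2 \<le> 2 / real n - 2 / real (Suc n)"
    using n by (simp add: x_def power2_eq_square)
  with 1 show "stirling_rest n - stirling_rest (Suc n) \<le> 2 / real n - 2 / real (Suc n)" by simp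
qed

lemma stirling_rest_bounds_aux:
  assumes "1 \<le> m" "m \<le> n"
  shows "stirling_rest n \<le> stirling_rest m" "stirling_rest m - 2 / real m \<le> stirling_rest n - 2 / real n"
  using assms(2)
proof (induction n rule: dec_induct)
  case base
  { case 1 show ?case by simp }
  { case 2 show ?case by simp }
next
  case (step n)
  have n: "n \<ge> 1" using step assms by simp
  { case 1 show ?case using step stirling_rest_step[OF n] by simp }
  { case 2 show ?case using step stirling_rest_step[OF n] by simp }
qed

text \<open>In this closed form the logarithm of the Wallis product can be expressed by
  \<open>stirling_rest\<close> at n and at 2 n.\<close>

lemma wallis_fact:
  "(\<Prod>k=1..n. (4 * real k ^ 2) / (4 * real k ^ 2 - 1)) = (2 ^ (4 * n) * fact n ^ 4) / ((fact (2 * n))\<^sup>2 * (2 * real n + 1))"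
proof (induction n)
  case 0
  then show ?case by simp
next
  case (Suc n)
  have f: "fact (2 * Suc n) = (2 * real n + 2) * (2 * real n + 1) * fact (2 * n)"
    by (simp add: algebra_simps)
  have nz: "2 * real n + 1 \<noteq> 0" "2 * real n + 3 \<noteq> 0" "(fact (2 * n) :: real) \<noteq> 0" "real n + 1 \<noteq> 0" by (auto simp: add_eq_0_iff)
  have e: "4 * real (Suc n) ^ 2 - 1 = (2 * real n + 1) * (2 * real n + 3)"
    by (simp add: power2_eq_square algebra_simps)
  have "(\<Prod>k=1..Suc n. (4 * real k ^ 2) / (4 * real k ^ 2 - 1))
     = (2 ^ (4 * n) * fact n ^ 4) / ((fact (2 * n))\<^sup>2 * (2 * real n + 1)) * ((4 * (real n + 1)\<^sup>2) / ((2 * real n + 1) * (2 * real n + 3)))"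
  proof -
    have "(\<Prod>k=1..Suc n. (4 * real k ^ 2) / (4 * real k ^ 2 - 1))
       = (\<Prod>k=1..n. (4 * real k ^ 2) / (4 * real k ^ 2 - 1)) * ((4 * real (Suc n) ^ 2) / (4 * real (Suc n) ^ 2 - 1))"
      by simp
    then show ?thesis unfolding Suc.IH e by (simp add: add.commute)
  qed
  also have "\<dots> = (2 ^ (4 * Suc n) * fact (Suc n) ^ 4) / ((fact (2 * Suc n))\<^sup>2 * (2 * real (Suc n) + 1))"
    unfolding f using nz
    by (simp add: divide_simps power_mult_distrib) (simp add: power2_eq_square power4_eq_xxxx power_add algebra_simps)
  finally show ?case .
qed

lemma stirling_rest_limit: "stirling_rest \<longlonglongrightarrow> ln (2 * pi) / 2"
proof -
  define f where "f = (\<lambda>n. stirling_rest (Suc n))"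
  have "decseq f"
    unfolding f_def decseq_Suc_iff using stirling_rest_step(1) by (metis One_nat_def Suc_le_mono diff_ge_0_iff_ge le0)
  moreover have "stirling_rest 1 - 2 \<le> f n" for n
    using stirling_rest_bounds_aux(2)[of 1 "Suc n"] unfolding f_def by (smt (verit) One_nat_def Suc_le_mono div_by_1 divide_nonneg_nonneg le0 of_nat_0_le_iff of_nat_1)
  ultimately obtain c where "f \<longlonglongrightarrow> c" using decseq_convergent[of f] by metis
  then have c: "stirling_rest \<longlonglongrightarrow> c" unfolding f_def by (rule LIMSEQ_imp_Suc)
  have "(\<lambda>n. stirling_rest (2 * n)) \<longlonglongrightarrow> c"
    using LIMSEQ_subseq_LIMSEQ[OF c, of "\<lambda>n. 2 * n"] by (simp add: strict_mono_def o_def)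
  \<comment> \<open>The coefficients are those of ln n! and ln (2 n)! in the logarithm of the Wallis
    product. Comparing limits gives 2 c - 2 ln 2 = ln(pi / 2).\<close>
  then have "(\<lambda>n. 4 * stirling_rest n - 2 * stirling_rest (2 * n) + (ln (real n) - ln 2 - ln (2 * real n + 1))) \<longlonglongrightarrow> 4 * c - 2 * c + (- 2 * ln 2)"
  proof (intro tendsto_add tendsto_diff tendsto_mult tendsto_const c)
    show "(\<lambda>n. ln (real n) - ln 2 - ln (2 * real n + 1)) \<longlonglongrightarrow> - 2 * ln 2" by real_asymp
  qed
  moreover have "\<forall>\<^sub>F n in sequentially. 4 * stirling_rest n - 2 * stirling_rest (2 * n) + (ln (real n) - ln 2 - ln (2 * real n + 1))
     = ln (\<Prod>k=1..n. (4 * real k ^ 2) / (4 * real k ^ 2 - 1))"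
    using eventually_gt_at_top[of 0]
  proof eventually_elim
    case (elim n)
    have "ln (\<Prod>k=1..n. (4 * real k ^ 2) / (4 * real k ^ 2 - 1))
       = (4 * real n) * ln 2 + 4 * ln (fact n) - (2 * ln (fact (2 * n)) + ln (2 * real n + 1))"
      unfolding wallis_fact by (simp add: ln_div ln_mult ln_realpow add_pos_pos)
    moreover have "ln (real (2 * n)) = ln 2 + ln (real n)" using elim by (simp add: ln_mult)
    ultimately show ?case by (simp add: stirling_rest_def algebra_simps)
  qed
  ultimately have 1: "(\<lambda>n. ln (\<Prod>k=1..n. (4 * real k ^ 2) / (4 * real k ^ 2 - 1))) \<longlonglongrightarrow> 4 * c - 2 * c + (- 2 * ln 2)"
    by (rule Lim_transform_eventually)
  have 2: "(\<lambda>n. ln (\<Prod>k=1..n. (4 * real k ^ 2) / (4 * real k ^ 2 - 1))) \<longlonglongrightarrow> ln (pi / 2)"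
    by (rule tendsto_ln[OF wallis]) simp
  have "4 * c - 2 * c + (- 2 * ln 2) = ln (pi / 2)" by (rule LIMSEQ_unique[OF 1 2])
  then have "c = ln (2 * pi) / 2" by (simp add: ln_div ln_mult)
  with c show ?thesis by simp
qed

lemma stirling_rest_bounds:
  assumes n: "n \<ge> 1"
  shows "ln (2 * pi) / 2 \<le> stirling_rest n" "stirling_rest n \<le> ln (2 * pi) / 2 + 2 / real n"
proof -
  show "ln (2 * pi) / 2 \<le> stirling_rest n"
    by (rule LIMSEQ_le_const2[OF stirling_rest_limit]) (use stirling_rest_bounds_aux(1)[OF n] in blast)
  have "(\<lambda>m. stirling_rest m - 2 / real m) \<longlonglongrightarrow> ln (2 * pi) / 2 - 0"
    by (intro tendsto_diff stirling_rest_limit) real_asymp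
  then have "stirling_rest n - 2 / real n \<le> ln (2 * pi) / 2 - 0"
    by (rule LIMSEQ_le_const) (use stirling_rest_bounds_aux(2)[OF n] in blast)
  then show "stirling_rest n \<le> ln (2 * pi) / 2 + 2 / real n" by simp
qed

text \<open>The main term of Stirling's formula for \<open>balanced_prob\<close>, which is the value
  predicted by the local central limit theorem.\<close>

definition balanced_gauss :: "nat \<Rightarrow> nat \<Rightarrow> real" where
  "balanced_gauss g lam = sqrt (real g) / sqrt ((2 * pi * real lam) ^ (g - 1))"

lemma balanced_gauss_pos: "g > 0 \<Longrightarrow> lam > 0 \<Longrightarrow> balanced_gauss g lam > 0"
  by (simp add: balanced_gauss_def)

lemma ln_balanced_gauss:
  assumes "g > 0" "lam > 0"
  shows "ln (balanced_gauss g lam) = ln (real g) / 2 - (real g - 1) / 2 * (ln (2 * pi) + ln (real lam))"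
proof -
  have "ln (2 * pi * real lam) = ln (2 * pi) + ln (real lam)"
    using assms by (subst ln_mult) auto
  then show ?thesis
    using assms by (simp add: balanced_gauss_def ln_div ln_sqrt ln_realpow of_nat_diff)
qed

text \<open>All growing terms cancel, leaving the Stirling remainder at N minus g times the
  remainder at lam. An explicit rate is needed because this logarithm is later multiplied by the
  number of pairs, which may grow.\<close>

lemma balanced_prob_stirling:
  assumes g: "g > 0" and lam: "lam > 0"
  shows "\<bar>ln (balanced_prob g lam / balanced_gauss g lam)\<bar> \<le> 4 * real g / real lam"
proof -
  define N where "N = g * lam"
  define c where "c = ln (2 * pi) / 2"
  have N: "N \<ge> 1" using g lam by (simp add: N_def Suc_le_eq)
  have lnN: "ln (real N) = ln (real g) + ln (real lam)"
    using g lam by (simp add: N_def ln_mult)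
  have fN: "ln (fact N) = stirling_rest N + (real N + 1 / 2) * ln (real N) - real N" by (simp add: stirling_rest_def)
  have fl: "ln (fact lam) = stirling_rest lam + (real lam + 1 / 2) * ln (real lam) - real lam" by (simp add: stirling_rest_def)
  have "ln (balanced_prob g lam) = ln (fact N) - (real g * ln (fact lam) + real N * ln (real g))"
    using g by (simp add: balanced_prob_def N_def ln_div ln_mult ln_realpow)
  then have "ln (balanced_prob g lam) - ln (balanced_gauss g lam) = (stirling_rest N - c) - real g * (stirling_rest lam - c)"
    unfolding ln_balanced_gauss[OF g lam] fN fl lnN by (simp add: N_def c_def field_simps)
  then have eq: "ln (balanced_prob g lam / balanced_gauss g lam) = (stirling_rest N - c) - real g * (stirling_rest lam - c)"
    using balanced_prob_pos[OF g, of lam] balanced_gauss_pos[OF g lam] by (simp add: ln_div)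
  have sN: "0 \<le> stirling_rest N - c" "stirling_rest N - c \<le> 2 / real N" using stirling_rest_bounds[OF N] by (auto simp: c_def)
  have "0 \<le> stirling_rest lam - c" "stirling_rest lam - c \<le> 2 / real lam" using stirling_rest_bounds[of lam] lam by (auto simp: c_def)
  then have sl: "0 \<le> real g * (stirling_rest lam - c)" "real g * (stirling_rest lam - c) \<le> real g * (2 / real lam)"
    using mult_left_mono[of "stirling_rest lam - c" "2 / real lam" "real g"] by auto
  have "2 / real N \<le> 2 / real lam"
    using g lam by (intro divide_left_mono) (auto simp: N_def)
  also have "\<dots> \<le> real g * (2 / real lam)"
    using g mult_right_mono[of 1 "real g" "2 / real lam"] by simp
  finally show ?thesis unfolding eq using sN sl by (simp add: abs_le_iff)
qed

lemma balanced_prob_gauss: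
  assumes g: "g > 0" and lam: "lam > 0"
  obtains E where "balanced_prob g lam = balanced_gauss g lam * exp E" "\<bar>E\<bar> \<le> 4 * real g / real lam"
proof
  have pos: "balanced_prob g lam > 0" "balanced_gauss g lam > 0" using balanced_prob_pos balanced_gauss_pos g lam by auto
  show "balanced_prob g lam = balanced_gauss g lam * exp (ln (balanced_prob g lam / balanced_gauss g lam))" using pos by simp
  show "\<bar>ln (balanced_prob g lam / balanced_gauss g lam)\<bar> \<le> 4 * real g / real lam"
    by (rule balanced_prob_stirling[OF g lam])
qed

section \<open>Asymptotics\<close>

text \<open>Besides the total number of matrices, the powers of g are K + 1 - k from the flows and K
  / 2 from the factor sqrt g of each pair. For K = k (k - 1) / 2 these add up to (3 k - 4)(k - 1) /
  4.\<close>

lemma main_term_eq: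
  assumes g: "g \<ge> 2" and k: "k \<ge> 3" and lam: "lam > 0"
  shows "real g powr (real k * real lam * real g + real ((3 * k - 4) * (k - 1)) / 4)
             / sqrt ((2 * pi * real lam) ^ ((k choose 2) * (g - 1)))
     = real g ^ (k * (g * lam)) * real (card (flows g k)) * balanced_gauss g lam ^ card (pairs k)"
proof -
  define K where "K = card (pairs k)"
  have K: "K = k choose 2" by (simp add: K_def card_pairs)
  have gp: "real g > 0" using g by simp
  have "real (card (flows g k) * g ^ k) = real (g ^ (K + 1))"
    using card_flows[of g k] g k by (simp add: K_def)
  then have "real (card (flows g k)) * real g powr real k = real g powr (real K + 1)"
    using gp by (simp add: powr_realpow powr_add)
  then have L: "real (card (flows g k)) = real g powr (real K + 1 - real k)"
    using gp by (simp add: powr_diff field_simps)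
  have "even (k * (k - 1))" using k by auto
  then have "2 * K = k * (k - 1)" unfolding K choose_two by (rule dvd_mult_div_cancel)
  then have "real (2 * K) = real (k * (k - 1))" by simp
  then have K2: "2 * real K = real k * (real k - 1)" using k by (simp add: of_nat_diff)
  have s: "sqrt (real g) ^ K = real g powr (real K / 2)"
    using gp by (simp add: powr_half_sqrt[symmetric] powr_powr flip: powr_realpow)
  have e0: "real g ^ (k * (g * lam)) = real g powr (real k * real lam * real g)"
    using gp by (simp add: powr_realpow[symmetric] mult_ac)
  have e1: "real k * real lam * real g + real ((3 * k - 4) * (k - 1)) / 4
     = real k * real lam * real g + (real K + 1 - real k) + real K / 2"
  proof -
    have "real ((3 * k - 4) * (k - 1)) = (3 * real k - 4) * (real k - 1)"
      using k by (simp add: of_nat_diff)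
    then show ?thesis using K2 by (simp add: algebra_simps)
  qed
  have e2: "sqrt ((2 * pi * real lam) ^ (g - 1)) ^ K = sqrt ((2 * pi * real lam) ^ ((k choose 2) * (g - 1)))"
    by (simp add: real_sqrt_power[symmetric] power_mult[symmetric] K mult.commute)
  show ?thesis
    unfolding e0 e1 K_def[symmetric] balanced_gauss_def power_divide e2 L s powr_add by simp
qed

text \<open>Since 1/6 <= 1/2 <= ln g, the number of rows is at most ln x, and there are at most k^2
  pairs.\<close>

lemma rows_log_bound:
  assumes g: "g \<ge> (2::nat)" and x: "x \<ge> (1::real)" and \<epsilon>: "\<epsilon> > 0"
    and k: "real k < (1 / 6 - \<epsilon>) * ln x / ln (real g)"
  shows "real (card (pairs k)) \<le> (ln x)\<^sup>2"
proof -
  have "ln (real g) \<ge> ln 2" using g by simp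
  then have lg: "ln (real g) \<ge> 1 / 2" using ln2_ge_two_thirds by linarith
  have lx: "ln x \<ge> 0" using x by simp
  have "(1 / 6 - \<epsilon>) * ln x \<le> 1 / 2 * ln x" using lx \<epsilon> by (intro mult_right_mono) auto
  also have "\<dots> \<le> ln (real g) * ln x" using lg lx by (intro mult_right_mono)
  finally have "(1 / 6 - \<epsilon>) * ln x / ln (real g) \<le> ln x"
    using lg by (simp add: divide_le_eq mult.commute)
  then have kx: "real k \<le> ln x" using k by linarith
  have "card (pairs k) \<le> k\<^sup>2"
    by (simp add: card_pairs choose_two power2_eq_square) (metis div_le_dividend le_trans diff_le_self mult_le_mono2)
  then have "real (card (pairs k)) \<le> (real k)\<^sup>2" by (simp flip: of_nat_power)
  also have "\<dots> \<le> (ln x)\<^sup>2" using kx by (intro power_mono) auto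
  finally show ?thesis .
qed

text \<open>For \<open>\<delta>\<close> = x^(-2/5), x \<open>\<delta>\<close>^2 = x^(1/5) outgrows
  (ln x)^3, the order of the exponent in the last factor of the first limit, while x
  \<open>\<delta>\<close>^3 = x^(-1/5) absorbs every power of ln x. The last limit is for the
  Stirling error 4 g / lam, written as 4 g^2 / x.\<close>

lemma error_limits:
  fixes c G :: real
  assumes c: "c > 0" and G: "G > 0"
  shows "((\<lambda>x. (ln x)\<^sup>2 * ((exp (- (c * (x * (x powr (-2/5))\<^sup>2))) + ((ln x)\<^sup>2 * x powr (-2/5)) powr x)
      * exp ((ln x)\<^sup>2 * (4 * G + G * ln (2 * pi * x))))) \<longlongrightarrow> 0) at_top"
    and "((\<lambda>x::real. x * ((ln x)\<^sup>2 * (4 * x powr (-2/5))) ^ 3) \<longlongrightarrow> 0) at_top"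
    and "((\<lambda>x::real. (ln x)\<^sup>2 * (4 * x powr (-2/5))) \<longlongrightarrow> 0) at_top"
    and "((\<lambda>x::real. x powr (-2/5)) \<longlongrightarrow> 0) at_top"
    and "((\<lambda>x::real. (ln x)\<^sup>2 * (4 * G * G / x)) \<longlongrightarrow> 0) at_top"
  using assms by (real_asymp)+


text \<open>One balanced word has probability only polynomially small in x, so with B = (ln x)^2
  dividing by the K-th power costs a factor exp(O((ln x)^3)).\<close>

lemma balanced_prob_power_ge:
  assumes g: "g > 0" and lam: "lam > 0" and x: "x = real (g * lam)" and K: "real K \<le> B"
  shows "inverse (balanced_prob g lam ^ K) \<le> exp (B * (4 * real g + real g * ln (2 * pi * x)))"
proof -
  have p0: "balanced_prob g lam > 0" by (rule balanced_prob_pos[OF g])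
  have l1: "real lam \<ge> 1" using lam by simp
  have lx: "real lam \<le> x" using g lam by (simp add: x)
  have "2 * pi * real lam \<ge> 1 * 1" using pi_gt3 l1 by (intro mult_mono) auto
  then have l0: "ln (2 * pi * real lam) \<ge> 0" by simp
  have lle: "ln (2 * pi * real lam) \<le> ln (2 * pi * x)"
    using lx l1 by (subst ln_le_cancel_iff) auto
  obtain E where E: "balanced_prob g lam = balanced_gauss g lam * exp E" "\<bar>E\<bar> \<le> 4 * real g / real lam"
    using balanced_prob_gauss[OF g lam] .
  have "4 * real g / real lam \<le> 4 * real g" using l1 g by (simp add: divide_le_eq)
  then have E4: "E \<ge> - (4 * real g)" using E(2) by linarith
  have "ln (balanced_prob g lam) = ln (balanced_gauss g lam) + E"
    using E(1) balanced_gauss_pos[OF g lam] by (simp add: ln_mult)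
  moreover have "ln (balanced_gauss g lam) = ln (real g) / 2 - (real g - 1) / 2 * ln (2 * pi * real lam)"
    unfolding ln_balanced_gauss[OF g lam] using lam by (simp add: ln_mult[of "2 * pi" "real lam"])
  moreover have "(real g - 1) / 2 * ln (2 * pi * real lam) \<le> real g * ln (2 * pi * x)"
    using g l0 lle by (intro mult_mono) auto
  moreover have "ln (real g) \<ge> 0" using g by simp
  ultimately have lp: "- ln (balanced_prob g lam) \<le> 4 * real g + real g * ln (2 * pi * x)"
    using E4 by linarith
  have "inverse (balanced_prob g lam ^ K) = exp (real K * (- ln (balanced_prob g lam)))"
    using p0 by (simp add: exp_minus exp_of_nat_mult)
  also have "real K * (- ln (balanced_prob g lam)) \<le> real K * (4 * real g + real g * ln (2 * pi * x))"
    using lp by (intro mult_left_mono) auto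
  also have "\<dots> \<le> B * (4 * real g + real g * ln (2 * pi * x))"
    using K l0 lle by (intro mult_right_mono) auto
  finally show ?thesis by simp
qed

theorem theorem1p2:
  fixes g :: nat and kk lam :: "nat \<Rightarrow> nat" and \<epsilon>0 :: real
  assumes "g \<ge> 2"
    and "\<And>n. kk n \<ge> 3"
    and "\<And>n. lam n > 0"
    and "filterlim lam at_top sequentially"
    and "even g \<Longrightarrow> (\<And>n. even (lam n))"
    and "\<epsilon>0 > 0"
    and "\<And>n. real (kk n) < (1/6 - \<epsilon>0) * ln (real (lam n) * real g) / ln (real g)"
  shows "((\<lambda>n. real (num_diff_matrices g (kk n) (lam n)) /
            (real g powr (real (kk n) * real (lam n) * real g
                           + real ((3 * kk n - 4) * (kk n - 1)) / 4)
             / sqrt ((2 * pi * real (lam n)) ^ ((kk n choose 2) * (g - 1)))))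
          \<longlongrightarrow> 1) sequentially"
proof -
  define x where "x = (\<lambda>n. real (g * lam n))"
  define K where "K = (\<lambda>n. card (pairs (kk n)))"
  define \<delta> where "\<delta> = (\<lambda>n. x n powr (-2/5))"
  define \<kappa> where "\<kappa> = (\<lambda>n. x n * (real (K n) * (4 * \<delta> n)) ^ 3)"
  define \<tau> where "\<tau> = (\<lambda>n. exp (- (x n * (\<delta> n)\<^sup>2 / (36 * real g ^ 4))) + (real (K n) * \<delta> n) ^ (g * lam n))"
  define p where "p = (\<lambda>n. balanced_prob g (lam n))"
  define q where "q = (\<lambda>n. balanced_gauss g (lam n))"
  define T where "T = (\<lambda>n. real g ^ (kk n * (g * lam n)) * real (card (flows g (kk n))))"
  define c where "c = 1 / (36 * real g ^ 4)"
  \<comment> \<open>A majorant of K \<open>\<tau>\<close> / p^K in the single variable x = g lam,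
    obtained by replacing K by (ln x)^2.\<close>
  define \<Phi> where "\<Phi> = (\<lambda>t. (ln t)\<^sup>2 * ((exp (- (c * (t * (t powr (-2/5))\<^sup>2))) + ((ln t)\<^sup>2 * t powr (-2/5)) powr t)
      * exp ((ln t)\<^sup>2 * (4 * real g + real g * ln (2 * pi * t)))))"
  have g0: "g > 0" using assms(1) by simp
  have gr: "real g > 0" using g0 by simp
  have c0: "c > 0" using g0 by (simp add: c_def)
  have xtop: "filterlim x at_top sequentially"
  proof -
    have "filterlim (\<lambda>n. real (lam n)) at_top sequentially"
      by (rule filterlim_compose[OF filterlim_real_sequentially assms(4)])
    then have "filterlim (\<lambda>n. real g * real (lam n)) at_top sequentially"
      using gr by (intro filterlim_tendsto_pos_mult_at_top[OF tendsto_const])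
    then show ?thesis by (simp add: x_def)
  qed
  note lims = error_limits[OF c0 gr]
  have lim\<Phi>: "(\<lambda>n. \<Phi> (x n)) \<longlonglongrightarrow> 0"
    unfolding \<Phi>_def by (rule filterlim_compose[OF lims(1) xtop])
  have lim\<kappa>: "(\<lambda>n. x n * ((ln (x n))\<^sup>2 * (4 * x n powr (-2/5))) ^ 3) \<longlonglongrightarrow> 0"
    by (rule filterlim_compose[OF lims(2) xtop])
  have limd: "(\<lambda>n. (ln (x n))\<^sup>2 * (4 * x n powr (-2/5))) \<longlonglongrightarrow> 0"
    by (rule filterlim_compose[OF lims(3) xtop])
  have lim\<delta>: "\<delta> \<longlonglongrightarrow> 0"
    unfolding \<delta>_def by (rule filterlim_compose[OF lims(4) xtop])
  have limE: "(\<lambda>n. (ln (x n))\<^sup>2 * (4 * real g * real g / x n)) \<longlonglongrightarrow> 0"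
    by (rule filterlim_compose[OF lims(5) xtop])
  have x1: "x n \<ge> 1" for n
  proof -
    have "1 \<le> g * lam n" using g0 assms(3)[of n] by (simp add: Suc_le_eq)
    then have "real 1 \<le> real (g * lam n)" by (rule of_nat_mono)
    then show ?thesis by (simp add: x_def)
  qed
  have KB: "real (K n) \<le> (ln (x n))\<^sup>2" for n
    unfolding K_def
  proof (rule rows_log_bound[OF assms(1) x1 assms(6)])
    show "real (kk n) < (1 / 6 - \<epsilon>0) * ln (x n) / ln (real g)"
      using assms(7)[of n] by (simp add: x_def mult.commute)
  qed
  have p0: "p n > 0" and q0: "q n > 0" for n
    using balanced_prob_pos[OF g0] balanced_gauss_pos[OF g0 assms(3)] by (auto simp: p_def q_def)
  have \<delta>0: "\<delta> n > 0" for n using x1[of n] by (simp add: \<delta>_def)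
  have Kd: "real (K n) * (4 * \<delta> n) \<le> (ln (x n))\<^sup>2 * (4 * x n powr (-2/5))" for n
    unfolding \<delta>_def using KB[of n] by (intro mult_right_mono) auto
  have \<kappa>le: "\<kappa> n \<le> x n * ((ln (x n))\<^sup>2 * (4 * x n powr (-2/5))) ^ 3" for n
    unfolding \<kappa>_def using Kd[of n] x1[of n] \<delta>0[of n] by (intro mult_left_mono power_mono) auto
  have \<Phi>le: "\<forall>\<^sub>F n in sequentially. real (K n) * (\<tau> n / p n ^ K n) \<le> \<Phi> (x n)"
    using filterlim_at_top_dense[THEN iffD1, OF xtop, rule_format, of 1]
  proof eventually_elim
    case (elim n)
    \<comment> \<open>Strict positivity makes the base below positive, so that its integer power may
      be rewritten with \<open>powr\<close>.\<close>
    have lnx: "ln (x n) > 0" using elim by simp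
    have b: "real (K n) * \<delta> n \<le> (ln (x n))\<^sup>2 * x n powr (-2/5)"
      unfolding \<delta>_def using KB[of n] by (intro mult_right_mono) auto
    have "(real (K n) * \<delta> n) ^ (g * lam n) \<le> ((ln (x n))\<^sup>2 * x n powr (-2/5)) ^ (g * lam n)"
      using b \<delta>0[of n] by (intro power_mono) auto
    also have "\<dots> = ((ln (x n))\<^sup>2 * x n powr (-2/5)) powr x n"
    proof -
      have "(ln (x n))\<^sup>2 * x n powr (-2/5) > 0" using lnx elim by simp
      from powr_realpow[OF this, of "g * lam n"] show ?thesis by (simp only: x_def)
    qed
    finally have "\<tau> n \<le> exp (- (c * (x n * (x n powr (-2/5))\<^sup>2))) + ((ln (x n))\<^sup>2 * x n powr (-2/5)) powr x n"
      by (simp add: \<tau>_def c_def \<delta>_def)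
    moreover have "inverse (p n ^ K n) \<le> exp ((ln (x n))\<^sup>2 * (4 * real g + real g * ln (2 * pi * x n)))"
      unfolding p_def by (rule balanced_prob_power_ge[OF g0 assms(3) _ KB]) (simp add: x_def)
    moreover have "\<tau> n \<ge> 0" using \<delta>0[of n] by (simp add: \<tau>_def)
    ultimately show ?case
      unfolding \<Phi>_def divide_inverse using KB[of n] p0[of n] by (intro mult_mono) auto
  qed
  \<comment> \<open>Thresholds for the smallness hypotheses of
    \<open>num_diff_matrices_ratio\<close>: on \<open>\<tau>\<close>, on \<open>\<kappa>\<close>, on
    K times 4 \<open>\<delta>\<close>, and on \<open>\<delta>\<close> against 1 / (2 g).\<close>
  have e8: "(0::real) < 1 / 8" and e32: "(0::real) < 1 / 32" and half: "(0::real) < 1 / 2"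
    and eg: "0 < 1 / (2 * real g)" using gr by simp_all
  have "\<forall>\<^sub>F n in sequentially. \<bar>real (num_diff_matrices g (kk n) (lam n)) / (T n * p n ^ K n) - 1\<bar>
     \<le> 3 * \<Phi> (x n) + 36 * (x n * ((ln (x n))\<^sup>2 * (4 * x n powr (-2/5))) ^ 3)"
    using \<Phi>le order_tendstoD(2)[OF lim\<Phi> e8] order_tendstoD(2)[OF lim\<kappa> e32]
      order_tendstoD(2)[OF limd half] order_tendstoD(2)[OF lim\<delta> eg]
  proof eventually_elim
    case (elim n)
    have "\<bar>real (num_diff_matrices g (kk n) (lam n)) / (real g ^ (kk n * (g * lam n)) * real (card (flows g (kk n))) * balanced_prob g (lam n) ^ K n) - 1\<bar>
      \<le> 3 * real (K n) * (\<tau> n / balanced_prob g (lam n) ^ K n) + 36 * \<kappa> n"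
    proof (rule num_diff_matrices_ratio[OF assms(1), where \<delta> = "\<delta> n"])
      show "2 \<le> kk n" using assms(2)[of n] by simp
      show "even (lam n)" if "even g" using assms(5)[OF that] .
      show "0 < \<delta> n" by (rule \<delta>0)
      show "2 * \<delta> n < 1 / real g" using elim gr by (simp add: field_simps)
      show "K n = card (pairs (kk n))" by (simp add: K_def)
      show "\<kappa> n = real (g * lam n) * (real (K n) * (4 * \<delta> n)) ^ 3" by (simp add: \<kappa>_def x_def)
      show "32 * \<kappa> n \<le> 1" using \<kappa>le[of n] elim by linarith
      show "real (K n) * (4 * \<delta> n) \<le> 1 / 2" using Kd[of n] elim by linarith
      show "\<tau> n = exp (- (real (g * lam n) * (\<delta> n)\<^sup>2 / (36 * real g ^ 4))) + (real (K n) * \<delta> n) ^ (g * lam n)"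
        by (simp add: \<tau>_def x_def)
      have "real (K n) * (\<tau> n / p n ^ K n) \<le> 1 / 8" using elim(1,2) by linarith
      then have "real (K n) * \<tau> n / p n ^ K n \<le> 1 / 8" unfolding times_divide_eq_right .
      then have "real (K n) * \<tau> n \<le> 1 / 8 * p n ^ K n"
        using p0[of n] by (subst (asm) pos_divide_le_eq) simp_all
      then show "8 * real (K n) * \<tau> n \<le> balanced_prob g (lam n) ^ K n"
        by (simp add: p_def)
    qed
    then have "\<bar>real (num_diff_matrices g (kk n) (lam n)) / (T n * p n ^ K n) - 1\<bar> \<le> 3 * (real (K n) * (\<tau> n / p n ^ K n)) + 36 * \<kappa> n"
      unfolding T_def p_def mult.assoc .
    then show ?case using elim(1) \<kappa>le[of n] by linarith
  qed
  moreover have "(\<lambda>n. 3 * \<Phi> (x n) + 36 * (x n * ((ln (x n))\<^sup>2 * (4 * x n powr (-2/5))) ^ 3)) \<longlonglongrightarrow> 0"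
    using tendsto_add[OF tendsto_mult_right_zero[OF lim\<Phi>, of 3] tendsto_mult_right_zero[OF lim\<kappa>, of 36]] by simp
  ultimately have "(\<lambda>n. real (num_diff_matrices g (kk n) (lam n)) / (T n * p n ^ K n) - 1) \<longlonglongrightarrow> 0"
    unfolding real_norm_def[symmetric] by (rule Lim_null_comparison)
  then have lim1: "(\<lambda>n. real (num_diff_matrices g (kk n) (lam n)) / (T n * p n ^ K n)) \<longlonglongrightarrow> 1"
    by (simp add: LIM_zero_iff)
  \<comment> \<open>The Stirling error survives the K-th power because K is at most (ln x)^2 and the
    logarithm is O(1 / x).\<close>
  have "(\<lambda>n. real (K n) * ln (p n / q n)) \<longlonglongrightarrow> 0"
  proof (rule Lim_null_comparison[OF always_eventually limE], rule allI)
    fix n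
    have "\<bar>ln (p n / q n)\<bar> \<le> 4 * real g * real g / x n"
      using balanced_prob_stirling[OF g0 assms(3)] g0 by (simp add: p_def q_def x_def)
    then show "norm (real (K n) * ln (p n / q n)) \<le> (ln (x n))\<^sup>2 * (4 * real g * real g / x n)"
      unfolding real_norm_def abs_mult using KB[of n] by (intro mult_mono) auto
  qed
  then have "(\<lambda>n. exp (real (K n) * ln (p n / q n))) \<longlonglongrightarrow> exp 0"
    by (rule tendsto_exp)
  moreover have "exp (real (K n) * ln (p n / q n)) = (p n / q n) ^ K n" for n
    using p0[of n] q0[of n] by (simp add: exp_of_nat_mult)
  ultimately have lim2: "(\<lambda>n. (p n / q n) ^ K n) \<longlonglongrightarrow> 1" by simp
  have eq: "real (num_diff_matrices g (kk n) (lam n)) /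
            (real g powr (real (kk n) * real (lam n) * real g
                           + real ((3 * kk n - 4) * (kk n - 1)) / 4)
             / sqrt ((2 * pi * real (lam n)) ^ ((kk n choose 2) * (g - 1))))
     = real (num_diff_matrices g (kk n) (lam n)) / (T n * p n ^ K n) * (p n / q n) ^ K n" for n
  proof -
    have "p n ^ K n \<noteq> 0" using p0[of n] by simp
    moreover have "real g ^ (kk n * (g * lam n)) * real (card (flows g (kk n))) * balanced_gauss g (lam n) ^ card (pairs (kk n)) = T n * q n ^ K n"
      by (simp only: T_def q_def K_def)
    ultimately show ?thesis
      unfolding main_term_eq[OF assms(1,2,3)] power_divide by simp
  qed
  show ?thesis unfolding eq using tendsto_mult[OF lim1 lim2] by simp
qed

end
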